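(* Let $X$ be an essentially periodic graph with infinite critical density. Then there exists a vertex $x_0\in X$ such that, if one adds to $X$ a single new vertex $\#$ linked only to $x_0$, then the resulting graph $X\cup\{\#\}$ has finite critical density.
   Context: Graphs are simple, countable and of bounded degree; $A_X$ is the adjacency operator on $\ell^2(VX)$. An amenable exhaustion of an infinite graph $X$ is an increasing exhaustion by finite subgraphs $K_n$ with $|\mathcal FK_n|/|VK_n|\to0$, where $\mathcal FK_n=\{v\in VK_n: d(v,VX\setminus VK_n)=1\}$; $P_n$ is the projection onto $\ell^2(VK_n)$. A periodic amenable graph is an infinite graph with a countable discrete amenable group $\Gamma$ of automorphisms acting freely with finite quotient, with fundamental domain $F\subset VX$, and with an amenable exhaustion $K_n$ such that $VK_n\setminus\mathcal FK_n\subseteq E_nF\subseteq VK_n$ for suitable finite $E_n\subset\Gamma$. If $VX=VY$, $Y$ is a density zero perturbation of $X$ if $\frac{1}{|VK_n|}\mathrm{Tr}((A_X-A_Y)^2P_n)\to0$. An essentially periodic graph is a graph obtained from a periodic amenable graph by a density zero perturbation and/or a finite perturbation (adding or removing finitely many vertices and edges), endowed with the (correspondingly modified) exhaustion. For $H=\|A\|I-A$ and $\varphi$ continuous, $\tau(\varphi(H))=\lim_n\frac{1}{|VK_n|}\mathrm{Tr}(\varphi(H)P_n)=\int\varphi\,dN_H$ defines the measure $dN_H$. The critical density at inverse temperature $\beta>0$ is $\rho_c(\beta)=\int\frac{dN_H(h)}{e^{\beta h}-1}\in[0,+\infty]$; its finiteness does not depend on $\beta$ and is equivalent to $\int\frac{dN_H(h)}{h}<\infty$.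 *)

theory Defs
  imports
    "HOL-Analysis.Analysis"
    "HOL-Computational_Algebra.Polynomial"
    "HOL-Algebra.Group_Action"
begin

section \<open>The Hilbert space of square-summable functions\<close>

typedef 'a ell2 = "{f :: 'a \<Rightarrow> complex. (\<lambda>x. (cmod (f x))\<^sup>2) summable_on UNIV}"
  morphisms ell2_fun Abs_ell2
proof
  show "(\<lambda>_. 0) \<in> {f :: 'a \<Rightarrow> complex. (\<lambda>x. (cmod (f x))\<^sup>2) summable_on UNIV}"
    by simp
qed

setup_lifting type_definition_ell2

lemma square_summable_add:
  fixes f g :: "'a \<Rightarrow> complex"
  assumes "(\<lambda>x. (cmod (f x))\<^sup>2) summable_on UNIV" "(\<lambda>x. (cmod (g x))\<^sup>2) summable_on UNIV"
  shows "(\<lambda>x. (cmod (f x + g x))\<^sup>2) summable_on UNIV"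
    and "sqrt (\<Sum>\<^sub>\<infinity>x. (cmod (f x + g x))\<^sup>2) \<le>
           sqrt (\<Sum>\<^sub>\<infinity>x. (cmod (f x))\<^sup>2) + sqrt (\<Sum>\<^sub>\<infinity>x. (cmod (g x))\<^sup>2)"
proof -
  let ?a = "sqrt (\<Sum>\<^sub>\<infinity>x. (cmod (f x))\<^sup>2)" and ?b = "sqrt (\<Sum>\<^sub>\<infinity>x. (cmod (g x))\<^sup>2)"
  have nonneg: "0 \<le> ?a" "0 \<le> ?b"
    by (auto intro!: infsum_nonneg)
  have fin: "(\<Sum>x\<in>F. (cmod (f x + g x))\<^sup>2) \<le> (?a + ?b)\<^sup>2" if "finite F" for F
  proof -
    have "L2_set (\<lambda>x. cmod (f x + g x)) F \<le> L2_set (\<lambda>x. cmod (f x) + cmod (g x)) F"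
      by (rule L2_set_mono) (auto intro: norm_triangle_ineq)
    also have "\<dots> \<le> L2_set (\<lambda>x. cmod (f x)) F + L2_set (\<lambda>x. cmod (g x)) F"
      by (rule L2_set_triangle_ineq)
    also have "\<dots> \<le> ?a + ?b"
      unfolding L2_set_def
      by (intro add_mono real_sqrt_le_mono finite_sum_le_infsum assms that) auto
    finally have "(L2_set (\<lambda>x. cmod (f x + g x)) F)\<^sup>2 \<le> (?a + ?b)\<^sup>2"
      by (rule power_mono) (rule L2_set_nonneg)
    then show ?thesis
      by (simp add: L2_set_def sum_nonneg)
  qed
  show summ: "(\<lambda>x. (cmod (f x + g x))\<^sup>2) summable_on UNIV"
    by (rule nonneg_bdd_above_summable_on) (auto intro!: bdd_aboveI2 fin)
  have "(\<Sum>\<^sub>\<infinity>x. (cmod (f x + g x))\<^sup>2) \<le> (?a + ?b)\<^sup>2"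
    by (rule infsum_le_finite_sums[OF summ]) (use fin in auto)
  then show "sqrt (\<Sum>\<^sub>\<infinity>x. (cmod (f x + g x))\<^sup>2) \<le> ?a + ?b"
    using nonneg by (intro real_le_lsqrt) auto
qed

lemma square_summable_scale:
  fixes f :: "'a \<Rightarrow> complex"
  assumes "(\<lambda>x. (cmod (f x))\<^sup>2) summable_on UNIV"
  shows "(\<lambda>x. (cmod (c * f x))\<^sup>2) summable_on UNIV"
  using summable_on_cmult_right[OF assms, of "(cmod c)\<^sup>2"]
  by (simp add: norm_mult power_mult_distrib)

instantiation ell2 :: (type) real_normed_vector
begin

lift_definition zero_ell2 :: "'a ell2" is "\<lambda>_. 0" by simp

lift_definition plus_ell2 :: "'a ell2 \<Rightarrow> 'a ell2 \<Rightarrow> 'a ell2" is "\<lambda>f g x. f x + g x"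
  by (rule square_summable_add)

lift_definition uminus_ell2 :: "'a ell2 \<Rightarrow> 'a ell2" is "\<lambda>f x. - f x" by simp

lift_definition minus_ell2 :: "'a ell2 \<Rightarrow> 'a ell2 \<Rightarrow> 'a ell2" is "\<lambda>f g x. f x - g x"
  using square_summable_add(1)[of _ "\<lambda>x. - _ x"] by simp

lift_definition scaleR_ell2 :: "real \<Rightarrow> 'a ell2 \<Rightarrow> 'a ell2" is "\<lambda>r f x. complex_of_real r * f x"
  by (rule square_summable_scale)

lift_definition norm_ell2 :: "'a ell2 \<Rightarrow> real" is "\<lambda>f. sqrt (\<Sum>\<^sub>\<infinity>x. (cmod (f x))\<^sup>2)" .

definition sgn_ell2 :: "'a ell2 \<Rightarrow> 'a ell2" where
  "sgn_ell2 f = inverse (norm f) *\<^sub>R f"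

definition dist_ell2 :: "'a ell2 \<Rightarrow> 'a ell2 \<Rightarrow> real" where
  "dist_ell2 f g = norm (f - g)"

definition uniformity_ell2 :: "('a ell2 \<times> 'a ell2) filter" where
  "uniformity_ell2 = (INF e\<in>{0<..}. principal {(f, g). dist f g < e})"

definition open_ell2 :: "'a ell2 set \<Rightarrow> bool" where
  "open_ell2 U = (\<forall>f\<in>U. \<forall>\<^sub>F (f', g) in uniformity. f' = f \<longrightarrow> g \<in> U)"

instance
proof
  fix f g h :: "'a ell2" and r s :: real and U :: "'a ell2 set"
  show "f + g + h = f + (g + h)" by transfer (simp add: add.assoc)
  show "f + g = g + f" by transfer (simp add: add.commute)
  show "0 + f = f" by transfer simp
  show "- f + f = 0" by transfer simp
  show "f - g = f + - g" by transfer simp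
  show "r *\<^sub>R (f + g) = r *\<^sub>R f + r *\<^sub>R g" by transfer (simp add: algebra_simps)
  show "(r + s) *\<^sub>R f = r *\<^sub>R f + s *\<^sub>R f" by transfer (simp add: algebra_simps)
  show "r *\<^sub>R s *\<^sub>R f = (r * s) *\<^sub>R f" by transfer (simp add: mult.assoc)
  show "1 *\<^sub>R f = f" by transfer simp
  show "sgn f = inverse (norm f) *\<^sub>R f" by (rule sgn_ell2_def)
  show "dist f g = norm (f - g)" by (rule dist_ell2_def)
  show "uniformity = (INF e\<in>{0<..}. principal {(f, g :: 'a ell2). dist f g < e})"
    by (rule uniformity_ell2_def)
  show "open U = (\<forall>f\<in>U. \<forall>\<^sub>F (f', g) in uniformity. f' = f \<longrightarrow> g \<in> U)"
    by (rule open_ell2_def)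
  show "(norm f = 0) = (f = 0)"
  proof
    assume "norm f = 0"
    then show "f = 0"
    proof transfer
      fix f :: "'a \<Rightarrow> complex"
      assume summ: "(\<lambda>x. (cmod (f x))\<^sup>2) summable_on UNIV"
        and "sqrt (\<Sum>\<^sub>\<infinity>x. (cmod (f x))\<^sup>2) = 0"
      then have "(\<Sum>\<^sub>\<infinity>x. (cmod (f x))\<^sup>2) \<le> 0" by simp
      then have "(cmod (f x))\<^sup>2 = 0" for x
        by (rule nonneg_infsum_le_0D) (use summ in auto)
      then show "f = (\<lambda>_. 0)" by auto
    qed
  next
    assume "f = 0"
    then show "norm f = 0" by transfer simp
  qed
  show "norm (f + g) \<le> norm f + norm g"
    by transfer (rule square_summable_add)
  show "norm (r *\<^sub>R f) = \<bar>r\<bar> * norm f"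
    by transfer
      (simp add: norm_mult power_mult_distrib infsum_cmult_right' real_sqrt_mult)
qed

end

lift_definition delta :: "'a \<Rightarrow> 'a ell2" is "\<lambda>v x. if x = v then 1 else 0"
proof -
  fix v :: 'a
  have "(\<lambda>x. (cmod (if x = v then 1 else 0))\<^sup>2) summable_on {v}" by simp
  then show "(\<lambda>x. (cmod (if x = v then 1 else 0))\<^sup>2) summable_on UNIV"
    by (rule summable_on_cong_neutral[THEN iffD1, rotated -1]) auto
qed


section \<open>Operators on the space of square-summable functions\<close>

text \<open>
  For a set \<open>V\<close> of vertices the space of square-summable functions on \<open>V\<close> is the closed subspace
  of the functions in \<^typ>\<open>'a ell2\<close> that vanish off \<open>V\<close>. All operators below leave both this
  subspace and its orthogonal complement invariant, and the adjacency operator vanishes on the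
  complement, so its norm, and all traces over subsets of \<open>V\<close>, are those of the restrictions
  to \<open>V\<close>.
\<close>

type_synonym 'a op = "'a ell2 \<Rightarrow>\<^sub>L 'a ell2"

definition proj_op :: "'a set \<Rightarrow> 'a op" where
  "proj_op S = Blinfun (\<lambda>f. Abs_ell2 (\<lambda>x. if x \<in> S then ell2_fun f x else 0))"

lemma Abs_ell2_norm_bound:
  fixes f :: "'a ell2" and B :: real and g
  assumes B: "B \<ge> 0" and b: "\<And>F. finite F \<Longrightarrow> (\<Sum>v\<in>F. (cmod (g v))\<^sup>2) \<le> B\<^sup>2 * (norm f)\<^sup>2"
  shows "(\<lambda>v. (cmod (g v))\<^sup>2) summable_on UNIV" "norm (Abs_ell2 g) \<le> B * norm f"
proof -
  show s: "(\<lambda>v. (cmod (g v))\<^sup>2) summable_on UNIV"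
    by (rule nonneg_bdd_above_summable_on) (auto intro!: bdd_aboveI2 b)
  have "(\<Sum>\<^sub>\<infinity>v. (cmod (g v))\<^sup>2) \<le> B\<^sup>2 * (norm f)\<^sup>2"
    by (rule infsum_le_finite_sums[OF s]) (use b in auto)
  then have "sqrt (\<Sum>\<^sub>\<infinity>v. (cmod (g v))\<^sup>2) \<le> B * norm f"
    using B by (intro real_le_lsqrt) (auto simp: power_mult_distrib)
  then show "norm (Abs_ell2 g) \<le> B * norm f" using s
    by (simp add: norm_ell2.rep_eq Abs_ell2_inverse)
qed

lemma finite_sum_le_norm_ell2: "finite F \<Longrightarrow> (\<Sum>v\<in>F. (cmod (ell2_fun f v))\<^sup>2) \<le> (norm f)\<^sup>2"
proof -
  assume F: "finite F"
  have s: "(\<lambda>v. (cmod (ell2_fun f v))\<^sup>2) summable_on UNIV" using ell2_fun[of f] by simp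
  have "(norm f)\<^sup>2 = (\<Sum>\<^sub>\<infinity>v. (cmod (ell2_fun f v))\<^sup>2)"
    by (simp add: norm_ell2.rep_eq infsum_nonneg)
  then show ?thesis using finite_sum_le_infsum[OF s F] by simp
qed

lemma proj_op_apply: "ell2_fun (blinfun_apply (proj_op S) f) v = (if v \<in> S then ell2_fun f v else 0)"
proof -
  have b: "(\<Sum>v\<in>F. (cmod (if v \<in> S then ell2_fun f v else 0))\<^sup>2) \<le> 1\<^sup>2 * (norm f)\<^sup>2" if "finite F" for F f
    by (rule order.trans[OF sum_mono]) (use finite_sum_le_norm_ell2[OF that, of f] in auto)
  have inv: "ell2_fun (Abs_ell2 (\<lambda>v. if v \<in> S then ell2_fun f v else 0)) = (\<lambda>v. if v \<in> S then ell2_fun f v else 0)" for f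
    by (rule Abs_ell2_inverse) (use Abs_ell2_norm_bound(1)[of 1 _ f, OF _ b] in simp)
  have "bounded_linear (\<lambda>f. Abs_ell2 (\<lambda>x. if x \<in> S then ell2_fun f x else 0))" (is "bounded_linear ?T")
  proof (rule bounded_linear_intro[of _ 1])
    show "norm (Abs_ell2 (\<lambda>v. if v \<in> S then ell2_fun f v else 0)) \<le> norm f * 1" for f
      using Abs_ell2_norm_bound(2)[of 1 _ f, OF _ b] by simp
  next
    fix f g :: "'a ell2" and r :: real
    show "?T (f + g) = ?T f + ?T g"
      unfolding ell2_fun_inject[symmetric] plus_ell2.rep_eq[of "?T _"] inv
      unfolding plus_ell2.rep_eq
      by (simp add: fun_eq_iff sum.distrib)
    show "?T (r *\<^sub>R f) = r *\<^sub>R ?T f"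
      unfolding ell2_fun_inject[symmetric] scaleR_ell2.rep_eq[of _ "?T _"] inv
      unfolding scaleR_ell2.rep_eq
      by (simp add: fun_eq_iff sum_distrib_left)
  qed
  then show ?thesis by (simp add: proj_op_def bounded_linear_Blinfun_apply inv)
qed

text \<open>Only used for operators of finite rank.\<close>

definition op_trace :: "'a op \<Rightarrow> complex" where
  "op_trace T = (\<Sum>\<^sub>\<infinity>v. ell2_fun (blinfun_apply T (delta v)) v)"

definition op_power :: "'a op \<Rightarrow> nat \<Rightarrow> 'a op" where
  "op_power T k = ((\<lambda>S. T o\<^sub>L S) ^^ k) id_blinfun"

definition poly_op :: "real poly \<Rightarrow> 'a op \<Rightarrow> 'a op" where
  "poly_op p T = (\<Sum>i\<le>degree p. coeff p i *\<^sub>R op_power T i)"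

text \<open>
  Continuous functional calculus of a self-adjoint operator: \<open>\<phi>(T)\<close> is the norm limit of \<open>p\<^sub>n(T)\<close>
  whenever the real polynomials \<open>p\<^sub>n\<close> converge to \<open>\<phi>\<close> uniformly on the interval
  \<open>[-\<parallel>T\<parallel>, \<parallel>T\<parallel>]\<close>, which contains the spectrum of \<open>T\<close>.
\<close>

definition fun_calc :: "(real \<Rightarrow> real) \<Rightarrow> 'a op \<Rightarrow> 'a op" where
  "fun_calc \<phi> T = (THE S. \<forall>p :: nat \<Rightarrow> real poly.
     uniform_limit {- norm T..norm T} (\<lambda>n. poly (p n)) \<phi> sequentially \<longrightarrow>
     (\<lambda>n. poly_op (p n) T) \<longlonglongrightarrow> S)"


section \<open>Graphs, exhaustions and perturbations\<close>

record 'a sgraph =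
  verts :: "'a set"
  edges :: "'a set set"

definition neighbours :: "'a sgraph \<Rightarrow> 'a \<Rightarrow> 'a set" where
  "neighbours X v = {w. {v, w} \<in> edges X}"

definition graph :: "'a sgraph \<Rightarrow> bool" where
  "graph X \<longleftrightarrow>
     countable (verts X) \<and>
     edges X \<subseteq> {{v, w} | v w. v \<in> verts X \<and> w \<in> verts X \<and> v \<noteq> w} \<and>
     (\<exists>d. \<forall>v\<in>verts X. finite (neighbours X v) \<and> card (neighbours X v) \<le> d)"

definition adj_op :: "'a sgraph \<Rightarrow> 'a op" where
  "adj_op X = Blinfun (\<lambda>f. Abs_ell2 (\<lambda>v. \<Sum>w\<in>neighbours X v. ell2_fun f w))"

lemma adj_op_bound:
  fixes X :: "'a sgraph"
  assumes "graph X"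
  obtains d :: nat where "\<And>f F. finite F \<Longrightarrow> (\<Sum>v\<in>F. (cmod (\<Sum>w\<in>neighbours X v. ell2_fun f w))\<^sup>2) \<le> (real d)\<^sup>2 * (norm f)\<^sup>2"
proof -
  from assms obtain d where d0: "\<forall>v\<in>verts X. finite (neighbours X v) \<and> card (neighbours X v) \<le> d"
    and E: "edges X \<subseteq> {{v, w} | v w. v \<in> verts X \<and> w \<in> verts X \<and> v \<noteq> w}"
    unfolding graph_def by blast
  have nV: "neighbours X v = {}" if "v \<notin> verts X" for v
    using E that by (auto simp: neighbours_def doubleton_eq_iff)
  have d: "finite (neighbours X v)" "card (neighbours X v) \<le> d" for v
    using d0 nV[of v] by (cases "v \<in> verts X"; auto)+
  have sym: "v \<in> neighbours X w \<longleftrightarrow> w \<in> neighbours X v" for v w by (simp add: neighbours_def insert_commute)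
  show ?thesis
  proof (rule that[of d])
    fix f :: "'a ell2" and F :: "'a set" assume F: "finite F"
    let ?U = "\<Union>v\<in>F. neighbours X v"
    have U: "finite ?U" using F d by auto
    have "(cmod (\<Sum>w\<in>neighbours X v. ell2_fun f w))\<^sup>2 \<le> d * (\<Sum>w\<in>neighbours X v. (cmod (ell2_fun f w))\<^sup>2)" for v
    proof -
      have "(cmod (\<Sum>w\<in>neighbours X v. ell2_fun f w))\<^sup>2 \<le> (\<Sum>w\<in>neighbours X v. cmod (ell2_fun f w))\<^sup>2"
        by (intro power_mono norm_sum) auto
      also have "\<dots> \<le> card (neighbours X v) * (\<Sum>w\<in>neighbours X v. (cmod (ell2_fun f w))\<^sup>2)"
        using Cauchy_Schwarz_ineq_sum[of "\<lambda>_. 1" "\<lambda>w. cmod (ell2_fun f w)" "neighbours X v"] by simp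
      also have "\<dots> \<le> d * (\<Sum>w\<in>neighbours X v. (cmod (ell2_fun f w))\<^sup>2)"
        using d by (intro mult_right_mono sum_nonneg) auto
      finally show ?thesis .
    qed
    then have "(\<Sum>v\<in>F. (cmod (\<Sum>w\<in>neighbours X v. ell2_fun f w))\<^sup>2) \<le> (\<Sum>v\<in>F. d * (\<Sum>w\<in>neighbours X v. (cmod (ell2_fun f w))\<^sup>2))"
      by (rule sum_mono)
    also have "\<dots> = d * (\<Sum>v\<in>F. \<Sum>w | w \<in> ?U \<and> w \<in> neighbours X v. (cmod (ell2_fun f w))\<^sup>2)"
      by (simp add: sum_distrib_left[symmetric]) (rule disjI2, rule sum.cong, auto intro!: sum.cong)
    also have "\<dots> = d * (\<Sum>w\<in>?U. \<Sum>v | v \<in> F \<and> w \<in> neighbours X v. (cmod (ell2_fun f w))\<^sup>2)"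
      using sum.swap_restrict[OF F U, of "\<lambda>v w. (cmod (ell2_fun f w))\<^sup>2" "\<lambda>v w. w \<in> neighbours X v"] by simp
    also have "\<dots> \<le> d * (\<Sum>w\<in>?U. d * (cmod (ell2_fun f w))\<^sup>2)"
    proof (intro mult_left_mono sum_mono)
      fix w
      have "card {v \<in> F. w \<in> neighbours X v} \<le> card (neighbours X w)" using d sym by (intro card_mono) auto
      then have "card {v \<in> F. w \<in> neighbours X v} \<le> d" using d(2)[of w] by linarith
      then show "(\<Sum>v | v \<in> F \<and> w \<in> neighbours X v. (cmod (ell2_fun f w))\<^sup>2) \<le> d * (cmod (ell2_fun f w))\<^sup>2"
        by (simp add: mult_right_mono)
    qed auto
    also have "\<dots> = d\<^sup>2 * (\<Sum>w\<in>?U. (cmod (ell2_fun f w))\<^sup>2)" by (simp add: sum_distrib_left power2_eq_square mult.assoc)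
    also have "\<dots> \<le> d\<^sup>2 * (norm f)\<^sup>2" using finite_sum_le_norm_ell2[OF U, of f] by (intro mult_left_mono) auto
    finally show "(\<Sum>v\<in>F. (cmod (\<Sum>w\<in>neighbours X v. ell2_fun f w))\<^sup>2) \<le> (real d)\<^sup>2 * (norm f)\<^sup>2" by simp
  qed
qed

lemma adj_op_apply:
  assumes "graph X"
  shows "ell2_fun (blinfun_apply (adj_op X) f) v = (\<Sum>w\<in>neighbours X v. ell2_fun f w)"
proof -
  from adj_op_bound[OF assms] obtain d :: nat where b: "\<And>f F. finite F \<Longrightarrow> (\<Sum>v\<in>F. (cmod (\<Sum>w\<in>neighbours X v. ell2_fun f w))\<^sup>2) \<le> (real d)\<^sup>2 * (norm f)\<^sup>2" by blast
  have s: "(\<lambda>v. (cmod (\<Sum>w\<in>neighbours X v. ell2_fun f w))\<^sup>2) summable_on UNIV" for f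
    by (rule Abs_ell2_norm_bound[of "real d" _ f]) (use b in auto)
  have inv: "ell2_fun (Abs_ell2 (\<lambda>v. \<Sum>w\<in>neighbours X v. ell2_fun f w)) = (\<lambda>v. \<Sum>w\<in>neighbours X v. ell2_fun f w)" for f
    by (rule Abs_ell2_inverse) (use s in simp)
  have "bounded_linear (\<lambda>f. Abs_ell2 (\<lambda>v. \<Sum>w\<in>neighbours X v. ell2_fun f w))" (is "bounded_linear ?T")
  proof (rule bounded_linear_intro[of _ "real d"])
    show "norm (Abs_ell2 (\<lambda>v. \<Sum>w\<in>neighbours X v. ell2_fun f w)) \<le> norm f * d" for f
      using Abs_ell2_norm_bound(2)[of "real d" _ f, OF _ b] by (simp add: mult.commute)
  next
    fix f g :: "'a ell2" and r :: real
    show "?T (f + g) = ?T f + ?T g"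
      unfolding ell2_fun_inject[symmetric] plus_ell2.rep_eq[of "?T _"] inv
      unfolding plus_ell2.rep_eq
      by (simp add: fun_eq_iff sum.distrib)
    show "?T (r *\<^sub>R f) = r *\<^sub>R ?T f"
      unfolding ell2_fun_inject[symmetric] scaleR_ell2.rep_eq[of _ "?T _"] inv
      unfolding scaleR_ell2.rep_eq
      by (simp add: fun_eq_iff sum_distrib_left)
  qed
  then show ?thesis by (simp add: adj_op_def bounded_linear_Blinfun_apply inv)
qed

text \<open>Points of \<open>K\<close> at graph distance \<open>1\<close> from the complement of \<open>K\<close>.\<close>

definition frontier_verts :: "'a sgraph \<Rightarrow> 'a set \<Rightarrow> 'a set" where
  "frontier_verts X K = {v \<in> K. \<exists>w \<in> verts X - K. {v, w} \<in> edges X}"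

text \<open>An exhaustion by finite subgraphs enters only through the vertex sets of the subgraphs, so
  it is represented by the sequence of these vertex sets.\<close>

definition exhaustion :: "'a sgraph \<Rightarrow> (nat \<Rightarrow> 'a set) \<Rightarrow> bool" where
  "exhaustion X K \<longleftrightarrow> (\<forall>n. finite (K n)) \<and> incseq K \<and> (\<Union>n. K n) = verts X"

definition amenable_exhaustion :: "'a sgraph \<Rightarrow> (nat \<Rightarrow> 'a set) \<Rightarrow> bool" where
  "amenable_exhaustion X K \<longleftrightarrow>
     exhaustion X K \<and>
     (\<lambda>n. real (card (frontier_verts X (K n))) / real (card (K n))) \<longlonglongrightarrow> 0"

definition amenable_group :: "('g, 'b) monoid_scheme \<Rightarrow> bool" where
  "amenable_group G \<longleftrightarrow> group G \<and>
     (\<exists>m :: 'g set \<Rightarrow> real.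
        (\<forall>S. S \<subseteq> carrier G \<longrightarrow> 0 \<le> m S) \<and>
        m (carrier G) = 1 \<and>
        (\<forall>S T. S \<subseteq> carrier G \<longrightarrow> T \<subseteq> carrier G \<longrightarrow> S \<inter> T = {} \<longrightarrow> m (S \<union> T) = m S + m T) \<and>
        (\<forall>g\<in>carrier G. \<forall>S. S \<subseteq> carrier G \<longrightarrow> m (g <#\<^bsub>G\<^esub> S) = m S))"

definition graph_auts :: "'a sgraph \<Rightarrow> ('a \<Rightarrow> 'a) set" where
  "graph_auts X = {\<gamma> \<in> Bij (verts X).
     \<forall>v\<in>verts X. \<forall>w\<in>verts X. {\<gamma> v, \<gamma> w} \<in> edges X \<longleftrightarrow> {v, w} \<in> edges X}"

definition periodic_amenable :: "'a sgraph \<Rightarrow> (nat \<Rightarrow> 'a set) \<Rightarrow> bool" where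
  "periodic_amenable X K \<longleftrightarrow>
     graph X \<and> infinite (verts X) \<and> amenable_exhaustion X K \<and>
     (\<exists>\<Gamma> F E.
        let G = BijGroup (verts X)\<lparr>carrier := \<Gamma>\<rparr> in
        subgroup \<Gamma> (BijGroup (verts X)) \<and> \<Gamma> \<subseteq> graph_auts X \<and>
        countable \<Gamma> \<and> amenable_group G \<and>
        (\<forall>\<gamma>\<in>\<Gamma>. \<gamma> \<noteq> \<one>\<^bsub>G\<^esub> \<longrightarrow> (\<forall>v\<in>verts X. \<gamma> v \<noteq> v)) \<and>
        finite (orbits G (verts X) (\<lambda>\<gamma>. \<gamma>)) \<and>
        F \<subseteq> verts X \<and> (\<forall>B\<in>orbits G (verts X) (\<lambda>\<gamma>. \<gamma>). \<exists>!v. v \<in> F \<inter> B) \<and>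
        (\<forall>n :: nat. finite (E n) \<and> E n \<subseteq> \<Gamma> \<and>
           K n - frontier_verts X (K n) \<subseteq> {\<gamma> v | \<gamma> v. \<gamma> \<in> E n \<and> v \<in> F} \<and>
           {\<gamma> v | \<gamma> v. \<gamma> \<in> E n \<and> v \<in> F} \<subseteq> K n))"

definition density_zero_perturbation :: "'a sgraph \<Rightarrow> (nat \<Rightarrow> 'a set) \<Rightarrow> 'a sgraph \<Rightarrow> bool" where
  "density_zero_perturbation X K Y \<longleftrightarrow>
     graph Y \<and> verts Y = verts X \<and>
     (\<lambda>n. op_trace ((adj_op X - adj_op Y) o\<^sub>L (adj_op X - adj_op Y) o\<^sub>L proj_op (K n))
            / of_nat (card (K n))) \<longlonglongrightarrow> 0"

definition finite_perturbation :: "'a sgraph \<Rightarrow> 'a sgraph \<Rightarrow> bool" where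
  "finite_perturbation X Y \<longleftrightarrow>
     graph Y \<and> finite (sym_diff (verts X) (verts Y)) \<and> finite (sym_diff (edges X) (edges Y))"

text \<open>The removed vertices are deleted from, and the added ones put into, all the sets of the
  exhaustion \<open>K\<close> of \<open>X\<close>.\<close>

definition modified_exhaustion ::
    "'a sgraph \<Rightarrow> (nat \<Rightarrow> 'a set) \<Rightarrow> 'a sgraph \<Rightarrow> nat \<Rightarrow> 'a set" where
  "modified_exhaustion X K Y n = (K n \<inter> verts Y) \<union> (verts Y - verts X)"

definition relabel :: "('a \<Rightarrow> 'b) \<Rightarrow> 'a sgraph \<Rightarrow> 'b sgraph" where
  "relabel f X = \<lparr>verts = f ` verts X, edges = (`) f ` edges X\<rparr>"

text \<open>
  The graph \<open>X\<close> with exhaustion \<open>K\<close> is, up to a relabelling \<open>f\<close> of its vertices, a perturbation of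
  a periodic amenable graph \<open>Z\<close>. The relabelling into \<^typ>\<open>nat\<close> (graphs are countable) makes
  the notion invariant under isomorphism and independent of how many elements outside
  \<^term>\<open>verts X\<close> the type \<^typ>\<open>'a\<close> has. Both perturbations may be trivial, and they may come in
  either order.
\<close>

definition essentially_periodic :: "'a sgraph \<Rightarrow> (nat \<Rightarrow> 'a set) \<Rightarrow> bool" where
  "essentially_periodic X K \<longleftrightarrow> graph X \<and>
     (\<exists>(f :: 'a \<Rightarrow> nat) Z L Y. inj_on f (verts X) \<and> periodic_amenable Z L \<and>
        (density_zero_perturbation Z L Y \<and>
           finite_perturbation Y (relabel f X) \<and>
           (\<forall>n. f ` K n = modified_exhaustion Y L (relabel f X) n)
         \<or>
         finite_perturbation Z Y \<and>
           density_zero_perturbation Y (modified_exhaustion Z L Y) (relabel f X) \<and>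
           (\<forall>n. f ` K n = modified_exhaustion Z L Y n)) \<and>
        (\<forall>n. K n \<subseteq> verts X))"


section \<open>Density of states and critical density\<close>

definition hamiltonian :: "'a sgraph \<Rightarrow> 'a op" where
  "hamiltonian X = norm (adj_op X) *\<^sub>R id_blinfun - adj_op X"

definition is_dos :: "'a sgraph \<Rightarrow> (nat \<Rightarrow> 'a set) \<Rightarrow> real measure \<Rightarrow> bool" where
  "is_dos X K N \<longleftrightarrow> sets N = sets borel \<and>
     (\<forall>\<phi> :: real \<Rightarrow> real. continuous_on UNIV \<phi> \<longrightarrow>
        integrable N \<phi> \<and>
        (\<lambda>n. op_trace (fun_calc \<phi> (hamiltonian X) o\<^sub>L proj_op (K n)) / of_nat (card (K n)))
          \<longlonglongrightarrow> complex_of_real (\<integral>h. \<phi> h \<partial>N))"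

definition dos :: "'a sgraph \<Rightarrow> (nat \<Rightarrow> 'a set) \<Rightarrow> real measure" where
  "dos X K = (THE N. is_dos X K N)"

text \<open>In \<^typ>\<open>ennreal\<close> division by zero gives \<open>\<infinity>\<close>, so an atom of the density of states at \<open>0\<close>
  makes the critical density infinite.\<close>

definition critical_density :: "'a sgraph \<Rightarrow> (nat \<Rightarrow> 'a set) \<Rightarrow> real \<Rightarrow> ennreal" where
  "critical_density X K \<beta> = (\<integral>\<^sup>+h. 1 / ennreal (exp (\<beta> * h) - 1) \<partial>dos X K)"


section \<open>Adding a pendant vertex\<close>

text \<open>The new vertex is \<^const>\<open>None\<close>.\<close>

definition add_pendant :: "'a sgraph \<Rightarrow> 'a \<Rightarrow> 'a option sgraph" where
  "add_pendant X x =
     \<lparr>verts = insert None (Some ` verts X),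
      edges = insert {None, Some x} ((`) Some ` edges X)\<rparr>"

definition add_pendant_exhaustion :: "(nat \<Rightarrow> 'a set) \<Rightarrow> nat \<Rightarrow> 'a option set" where
  "add_pendant_exhaustion K n = insert None (Some ` K n)"

end

theory Submission
  imports
    Defs
    "HOL-Probability.Probability"
    "HOL-Computational_Algebra.Fundamental_Theorem_Algebra"
begin

text \<open>Since \<open>dos\<close> is a definite description, its existence and uniqueness have to
  be proved before densities can be compared. Normalised traces of polynomials in the Hamiltonian
  are combinations of averaged closed walk counts. Passing to continuous functions rests on one
  bound for selfadjoint T: ||p(T)|| is at most the supremum of |p| on [-||T||, ||T||]. It is derived
  from the factorisation of real polynomials, in place of a spectral theorem.

  The measure \<nu> does not see a single extra vertex, but the norm may: a larger norm shifts \<nu>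
  away from the energy 0, where the Bose factor blows up. In the inequality at a vertex, the square
  on the left comes from optimising the scalar s at #. It survives averaging because the square of a
  mean is at most the mean of the squares. The averaged inequality then improves itself: if p >= 0
  and (M - t) p <= 1 on the support, then (M - t) p^2 <= p, so I^2 <= M I for I the integral of p,
  and I <= M.\<close>

text \<open>
  The averages over \<open>K n\<close> of the numbers of closed walks converge on a periodic amenable graph, and
  their limits do not change under density zero and finite perturbations; in particular \<open>X\<close> and
  \<open>X\<close> with a pendant vertex \<open>#\<close> have the same limits. By the Hausdorff moment problem these are the
  moments of a probability measure \<open>\<nu>\<close> on \<open>[-\<parallel>A\<^sub>X\<parallel>, \<parallel>A\<^sub>X\<parallel>]\<close>, and the densities of states of the two
  graphs are the images of \<open>\<nu>\<close> under \<open>t \<mapsto> \<parallel>A\<parallel> - t\<close> with the respective norms. So the critical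
  density of \<open>X \<union> {#}\<close> is finite as soon as \<open>\<parallel>A\<^bsub>X \<union> {#}\<^esub>\<parallel> > M\<close> with \<open>M = \<parallel>A\<^sub>X\<parallel>\<close>.

  If this failed for every choice of the vertex \<open>x\<close>, positivity of \<open>M - A\<^bsub>X \<union> {#}\<^esub>\<close> on vectors
  \<open>s \<delta>\<^sub># + p(A\<^sub>X) \<delta>\<^sub>x\<close> would give
  \<open>\<langle>p(A\<^sub>X) \<delta>\<^sub>x, \<delta>\<^sub>x\<rangle>\<^sup>2 \<le> M \<langle>(M - A\<^sub>X) p(A\<^sub>X)\<^sup>2 \<delta>\<^sub>x, \<delta>\<^sub>x\<rangle>\<close>, hence, averaging over \<open>x\<close>,
  \<open>(\<integral>p d\<nu>)\<^sup>2 \<le> M \<integral>(M - t) p(t)\<^sup>2 d\<nu>\<close> for all real polynomials \<open>p\<close>. Letting \<open>p\<close> increase to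
  \<open>1 / (M - t)\<close> along partial sums of a geometric series bounds \<open>\<integral>d\<nu> / (M - t)\<close> by \<open>M\<close>, which
  contradicts the infinite critical density of \<open>X\<close>.
\<close>

section \<open>The Hilbert space structure\<close>

lemma ell2_summable: "(\<lambda>x. (cmod (ell2_fun f x))\<^sup>2) summable_on UNIV"
  using ell2_fun[of f] by simp

lemma norm_ell2_sq: "(norm f)\<^sup>2 = (\<Sum>\<^sub>\<infinity>x. (cmod (ell2_fun f x))\<^sup>2)"
  by (simp add: norm_ell2.rep_eq infsum_nonneg)

lemma cmod_ell2_fun_le_norm: "cmod (ell2_fun f x) \<le> norm f"
  using finite_sum_le_norm_ell2[of "{x}" f] by (simp add: power2_le_iff_abs_le)

lemma ell2_inner_summable: "(\<lambda>x. Re (ell2_fun f x * cnj (ell2_fun g x))) summable_on UNIV"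
proof (rule Infinite_Sum.abs_summable_summable, rule Infinite_Sum.abs_summable_on_comparison_test'[where g = "\<lambda>x. (cmod (ell2_fun f x))\<^sup>2 + (cmod (ell2_fun g x))\<^sup>2"])
  show "(\<lambda>x. (cmod (ell2_fun f x))\<^sup>2 + (cmod (ell2_fun g x))\<^sup>2) summable_on UNIV"
    by (intro summable_on_add ell2_summable)
next
  fix x
  have "\<bar>Re (ell2_fun f x * cnj (ell2_fun g x))\<bar> \<le> cmod (ell2_fun f x) * cmod (ell2_fun g x)"
    using abs_Re_le_cmod[of "ell2_fun f x * cnj (ell2_fun g x)"] by (simp add: norm_mult)
  also have "\<dots> \<le> (cmod (ell2_fun f x))\<^sup>2 + (cmod (ell2_fun g x))\<^sup>2"
    using sum_squares_bound[of "cmod (ell2_fun f x)" "cmod (ell2_fun g x)"]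
      mult_nonneg_nonneg[OF norm_ge_zero norm_ge_zero, of "ell2_fun f x" "ell2_fun g x"] by linarith
  finally show "norm (Re (ell2_fun f x * cnj (ell2_fun g x))) \<le> (cmod (ell2_fun f x))\<^sup>2 + (cmod (ell2_fun g x))\<^sup>2"
    by simp
qed

text \<open>The real part of the complex inner product. The operators are bounded real-linear maps,
  and Re <f, f> is already the squared norm, so selfadjointness and positivity can be expressed
  through this form.\<close>

instantiation ell2 :: (type) real_inner
begin

lift_definition inner_ell2 :: "'a ell2 \<Rightarrow> 'a ell2 \<Rightarrow> real" is
  "\<lambda>f g. \<Sum>\<^sub>\<infinity>x. Re (f x * cnj (g x))" .

instance
proof
  fix f g h :: "'a ell2" and r :: real
  have sq: "inner f f = (norm f)\<^sup>2"
    by (simp add: inner_ell2.rep_eq norm_ell2_sq complex_mult_cnj cmod_power2)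
  show "inner f g = inner g f"
    by (simp add: inner_ell2.rep_eq mult.commute)
  show "inner (f + g) h = inner f h + inner g h"
    using infsum_add[OF ell2_inner_summable[of f h] ell2_inner_summable[of g h]]
    by (simp add: inner_ell2.rep_eq plus_ell2.rep_eq algebra_simps)
  show "inner (r *\<^sub>R f) g = r * inner f g"
    unfolding inner_ell2.rep_eq scaleR_ell2.rep_eq
    by (simp add: infsum_cmult_right'[symmetric] algebra_simps)
  show "0 \<le> inner f f" "(inner f f = 0) = (f = 0)" "norm f = sqrt (inner f f)"
    by (simp_all add: sq)
qed

end

text \<open>Completeness passes on to the operator space, where the polynomial approximants behind
  \<open>fun_calc\<close> are at first only known to be Cauchy.\<close>

instance ell2 :: (type) banach
proof
  fix X :: "nat \<Rightarrow> 'a ell2" assume "Cauchy X"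
  then have C: "\<exists>N. \<forall>m\<ge>N. \<forall>n\<ge>N. norm (X m - X n) < e" if "e > 0" for e
    using that by (auto simp: Cauchy_iff)
  have "Cauchy (\<lambda>n. ell2_fun (X n) x)" for x
    unfolding Cauchy_iff
  proof (intro allI impI)
    fix e :: real assume "e > 0"
    then obtain N where N: "norm (X m - X n) < e" if "m \<ge> N" "n \<ge> N" for m n using C by blast
    have "norm (ell2_fun (X m) x - ell2_fun (X n) x) < e" if "m \<ge> N" "n \<ge> N" for m n
      using N[OF that] cmod_ell2_fun_le_norm[of "X m - X n" x] by (simp add: minus_ell2.rep_eq)
    then show "\<exists>M. \<forall>m\<ge>M. \<forall>n\<ge>M. norm (ell2_fun (X m) x - ell2_fun (X n) x) < e" by blast
  qed
  then have "\<exists>l. (\<lambda>n. ell2_fun (X n) x) \<longlonglongrightarrow> l" for x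
    by (simp add: Cauchy_convergent_iff convergent_def)
  then obtain g where g: "\<And>x. (\<lambda>n. ell2_fun (X n) x) \<longlonglongrightarrow> g x" by metis
  \<comment> \<open>For finite F the limit m -> infinity can be taken inside the sum. The bound does
    not depend on F, so it carries over to the full norm.\<close>
  have fin: "(\<Sum>x\<in>F. (cmod (ell2_fun (X n) x - g x))\<^sup>2) \<le> e\<^sup>2"
    if "finite F" "\<And>m. m \<ge> N \<Longrightarrow> norm (X n - X m) < e" for F e n N
  proof (rule LIMSEQ_le_const2)
    show "(\<lambda>m. \<Sum>x\<in>F. (cmod (ell2_fun (X n) x - ell2_fun (X m) x))\<^sup>2) \<longlonglongrightarrow>
      (\<Sum>x\<in>F. (cmod (ell2_fun (X n) x - g x))\<^sup>2)"
      by (intro tendsto_intros g)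
    have "(\<Sum>x\<in>F. (cmod (ell2_fun (X n) x - ell2_fun (X m) x))\<^sup>2) \<le> e\<^sup>2" if "m \<ge> N" for m
    proof -
      have "(\<Sum>x\<in>F. (cmod (ell2_fun (X n - X m) x))\<^sup>2) \<le> (norm (X n - X m))\<^sup>2"
        by (rule finite_sum_le_norm_ell2) fact
      also have "\<dots> \<le> e\<^sup>2" using \<open>\<And>m. m \<ge> N \<Longrightarrow> norm (X n - X m) < e\<close>[OF that] by (intro power_mono) auto
      finally show ?thesis by (simp add: minus_ell2.rep_eq)
    qed
    then show "\<exists>N. \<forall>m\<ge>N. (\<Sum>x\<in>F. (cmod (ell2_fun (X n) x - ell2_fun (X m) x))\<^sup>2) \<le> e\<^sup>2" by blast
  qed
  have diff_summ: "(\<lambda>x. (cmod (ell2_fun (X n) x - g x))\<^sup>2) summable_on UNIV"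
    if "\<And>m. m \<ge> N \<Longrightarrow> norm (X n - X m) < e" for e n N
    by (rule nonneg_bdd_above_summable_on) (auto intro!: bdd_aboveI2 fin that)
  have g_summ: "(\<lambda>x. (cmod (g x))\<^sup>2) summable_on UNIV"
  proof -
    obtain N where N: "\<And>m. m \<ge> N \<Longrightarrow> norm (X N - X m) < 1" using C[of 1] by (metis order_refl zero_less_one)
    have "(\<lambda>x. (cmod (g x - ell2_fun (X N) x))\<^sup>2) summable_on UNIV"
      using diff_summ[OF N] by (simp add: norm_minus_commute)
    then show ?thesis
      using square_summable_add(1)[OF _ ell2_summable, of "\<lambda>x. g x - ell2_fun (X N) x" "X N"] by simp
  qed
  define G where "G = Abs_ell2 g"
  have G: "ell2_fun G = g" unfolding G_def by (rule Abs_ell2_inverse) (use g_summ in simp)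
  have "X \<longlonglongrightarrow> G"
  proof (rule LIMSEQ_I)
    fix e :: real assume "e > 0"
    then obtain N where N: "\<And>m n. m \<ge> N \<Longrightarrow> n \<ge> N \<Longrightarrow> norm (X n - X m) < e/2" using C[of "e/2"] by auto
    have "norm (X n - G) < e" if "n \<ge> N" for n
    proof -
      have "(norm (X n - G))\<^sup>2 \<le> (e/2)\<^sup>2"
        unfolding norm_ell2_sq minus_ell2.rep_eq G
        by (rule infsum_le_finite_sums[OF diff_summ[OF N[OF _ that]] fin[OF _ N[OF _ that]]])
      then have "norm (X n - G) \<le> e/2" using \<open>e > 0\<close> by (simp add: power2_le_iff_abs_le)
      then show ?thesis using \<open>e > 0\<close> by simp
    qed
    then show "\<exists>no. \<forall>n\<ge>no. norm (X n - G) < e" by blast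
  qed
  then show "convergent X" by (auto simp: convergent_def)
qed

lemma ell2_fun_delta [simp]: "ell2_fun (delta v) x = (if x = v then 1 else 0)"
  by (simp add: delta.rep_eq)

lemma infsum_single: "(\<Sum>\<^sub>\<infinity>x. if x = v then c else 0) = (c :: 'b :: {comm_monoid_add, t2_space})"
proof -
  have "(\<Sum>\<^sub>\<infinity>x. if x = v then c else 0) = (\<Sum>\<^sub>\<infinity>x\<in>{v}. if x = v then c else 0)"
    by (rule infsum_cong_neutral) auto
  then show ?thesis by simp
qed

lemma inner_delta_right: "inner f (delta v) = Re (ell2_fun f v)"
proof -
  have "inner f (delta v) = (\<Sum>\<^sub>\<infinity>x. if x = v then Re (ell2_fun f v) else 0)"
    unfolding inner_ell2.rep_eq by (rule infsum_cong) simp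
  then show ?thesis by (simp only: infsum_single)
qed

lemma norm_delta [simp]: "norm (delta v) = 1"
  by (simp add: norm_eq_sqrt_inner inner_delta_right)

lemma cmod_diagonal_le_norm: "cmod (ell2_fun (blinfun_apply S (delta v)) v) \<le> norm S"
  using cmod_ell2_fun_le_norm[of "blinfun_apply S (delta v)" v] norm_blinfun[of S "delta v"] by simp

lemma ell2_fun_sum: "ell2_fun (sum f A) x = (\<Sum>i\<in>A. ell2_fun (f i) x)"
  by (induction A rule: infinite_finite_induct) (simp_all add: zero_ell2.rep_eq plus_ell2.rep_eq)


section \<open>Polynomials in an operator\<close>

lemma op_power_0 [simp]: "op_power T 0 = id_blinfun"
  by (simp add: op_power_def)

lemma op_power_Suc [simp]: "op_power T (Suc k) = T o\<^sub>L op_power T k"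
  by (simp add: op_power_def)

lemma poly_op_eq: "degree p \<le> n \<Longrightarrow> poly_op p T = (\<Sum>i\<le>n. coeff p i *\<^sub>R op_power T i)"
  unfolding poly_op_def by (rule sum.mono_neutral_left) (auto simp: coeff_eq_0)

lemma poly_op_0 [simp]: "poly_op 0 T = 0"
  by (simp add: poly_op_def)

lemma poly_op_add: "poly_op (p + q) T = poly_op p T + poly_op q T"
proof -
  let ?n = "max (degree p) (degree q)"
  have "degree (p + q) \<le> ?n" by (rule degree_add_le) auto
  then show ?thesis
    by (simp add: poly_op_eq[of _ ?n] sum.distrib scaleR_left_distrib)
qed

lemma poly_op_smult: "poly_op (smult c p) T = c *\<^sub>R poly_op p T"
  by (simp add: poly_op_eq[OF degree_smult_le] poly_op_def scaleR_sum_right)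

lemma poly_op_diff: "poly_op (p - q) T = poly_op p T - poly_op q T"
  using poly_op_add[of "p - q" q T] by simp

lemma blinfun_compose_distrib:
  "(S + T) o\<^sub>L U = (S o\<^sub>L U) + (T o\<^sub>L U)" "S o\<^sub>L (T + U) = (S o\<^sub>L T) + (S o\<^sub>L U)"
  "(r *\<^sub>R S) o\<^sub>L U = r *\<^sub>R (S o\<^sub>L U)" "S o\<^sub>L (r *\<^sub>R U) = r *\<^sub>R (S o\<^sub>L U)"
  "(S - T) o\<^sub>L U = (S o\<^sub>L U) - (T o\<^sub>L U)" "S o\<^sub>L (T - U) = (S o\<^sub>L T) - (S o\<^sub>L U)"
  by (rule blinfun_eqI; simp add: blinfun.bilinear_simps)+

lemma poly_op_pCons: "poly_op (pCons a p) T = a *\<^sub>R id_blinfun + (T o\<^sub>L poly_op p T)"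
proof -
  have "poly_op (pCons a p) T = (\<Sum>i\<le>Suc (degree p). coeff (pCons a p) i *\<^sub>R op_power T i)"
    by (rule poly_op_eq) (rule degree_pCons_le)
  also have "\<dots> = a *\<^sub>R id_blinfun + (\<Sum>i\<le>degree p. coeff p i *\<^sub>R (T o\<^sub>L op_power T i))"
    by (simp add: sum.atMost_Suc_shift del: sum.atMost_Suc)
  also have "(\<Sum>i\<le>degree p. coeff p i *\<^sub>R (T o\<^sub>L op_power T i)) = T o\<^sub>L poly_op p T"
    by (rule blinfun_eqI) (simp add: poly_op_def blinfun.sum_left blinfun.sum_right blinfun.bilinear_simps)
  finally show ?thesis .
qed

lemma poly_op_1 [simp]: "poly_op 1 T = id_blinfun"
  by (simp add: one_pCons poly_op_pCons)

lemma blinfun_compose_id [simp]: "T o\<^sub>L id_blinfun = T" "id_blinfun o\<^sub>L T = T"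
  by (rule blinfun_eqI; simp)+

lemma poly_op_mult: "poly_op (p * q) T = poly_op p T o\<^sub>L poly_op q T"
proof (induction p)
  case 0
  then show ?case by (simp add: blinfun_eqI)
next
  case (pCons a p)
  have "poly_op (pCons a p * q) T = a *\<^sub>R poly_op q T + (T o\<^sub>L poly_op (p * q) T)"
    by (simp add: poly_op_add poly_op_smult poly_op_pCons)
  then show ?case
    by (simp add: pCons poly_op_pCons blinfun_compose_distrib blinfun_eqI)
qed

lemma poly_op_pcompose: "poly_op (pcompose p q) T = poly_op p (poly_op q T)"
  by (induction p) (simp_all add: pcompose_pCons poly_op_add poly_op_mult poly_op_pCons)


section \<open>The spectral bound for polynomials in a self-adjoint operator\<close>

definition selfadjoint :: "'a op \<Rightarrow> bool" where
  "selfadjoint T \<longleftrightarrow> (\<forall>f g. inner (blinfun_apply T f) g = inner f (blinfun_apply T g))"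

lemma selfadjointD: "selfadjoint T \<Longrightarrow> inner (blinfun_apply T f) g = inner f (blinfun_apply T g)"
  by (simp add: selfadjoint_def)

lemma selfadjoint_id: "selfadjoint id_blinfun"
  by (simp add: selfadjoint_def)

lemma selfadjoint_add: "selfadjoint S \<Longrightarrow> selfadjoint T \<Longrightarrow> selfadjoint (S + T)"
  by (simp add: selfadjoint_def blinfun.bilinear_simps inner_add_left inner_add_right)

lemma selfadjoint_diff: "selfadjoint S \<Longrightarrow> selfadjoint T \<Longrightarrow> selfadjoint (S - T)"
  by (simp add: selfadjoint_def blinfun.bilinear_simps inner_diff_left inner_diff_right)

lemma selfadjoint_scaleR: "selfadjoint S \<Longrightarrow> selfadjoint (r *\<^sub>R S)"
  by (simp add: selfadjoint_def blinfun.bilinear_simps)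

lemma poly_op_commute: "poly_op p T o\<^sub>L T = T o\<^sub>L poly_op p T"
proof -
  have "poly_op [:0, 1:] T = T"
    by (simp add: poly_op_pCons)
  then show ?thesis
    by (metis mult.commute poly_op_mult)
qed

lemma selfadjoint_poly_op:
  assumes "selfadjoint T" shows "selfadjoint (poly_op p T)"
proof (induction p)
  case 0
  then show ?case by (simp add: selfadjoint_def)
next
  case (pCons a p)
  have "selfadjoint (T o\<^sub>L poly_op p T)"
    unfolding selfadjoint_def
  proof (intro allI)
    fix f g
    have "inner (blinfun_apply (T o\<^sub>L poly_op p T) f) g = inner f (blinfun_apply (poly_op p T o\<^sub>L T) g)"
      using assms pCons.IH by (simp add: selfadjoint_def)
    then show "inner (blinfun_apply (T o\<^sub>L poly_op p T) f) g = inner f (blinfun_apply (T o\<^sub>L poly_op p T) g)"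
      by (simp only: poly_op_commute)
  qed
  then show ?case
    unfolding poly_op_pCons by (intro selfadjoint_add selfadjoint_scaleR selfadjoint_id)
qed

text \<open>Says that 0 is not an approximate eigenvalue. Unlike a bound on the norm of p(T), this
  property can be checked factor by factor.\<close>

definition bounded_below :: "'a op \<Rightarrow> bool" where
  "bounded_below T \<longleftrightarrow> (\<exists>c>0. \<forall>f. c * norm f \<le> norm (blinfun_apply T f))"

lemma bounded_below_compose:
  assumes "bounded_below S" "bounded_below T" shows "bounded_below (S o\<^sub>L T)"
proof -
  obtain c d where c: "c > 0" "\<And>f. c * norm f \<le> norm (blinfun_apply S f)"
    and d: "d > 0" "\<And>f. d * norm f \<le> norm (blinfun_apply T f)"
    using assms unfolding bounded_below_def by blast
  have "c * d * norm f \<le> norm (blinfun_apply (S o\<^sub>L T) f)" for f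
  proof -
    have "c * (d * norm f) \<le> c * norm (blinfun_apply T f)"
      using c d by (intro mult_left_mono) auto
    also have "\<dots> \<le> norm (blinfun_apply S (blinfun_apply T f))" by (rule c)
    finally show ?thesis by (simp add: mult.assoc)
  qed
  then show ?thesis unfolding bounded_below_def using c d by (intro exI[of _ "c * d"]) auto
qed

lemma bounded_below_linear_factor:
  assumes "\<bar>r\<bar> > norm T" shows "bounded_below (poly_op [:- r, 1:] T)"
  unfolding bounded_below_def
proof (intro exI conjI allI)
  show "\<bar>r\<bar> - norm T > 0" using assms by simp
  fix f
  have "norm (r *\<^sub>R f) \<le> norm (r *\<^sub>R f - blinfun_apply T f) + norm (blinfun_apply T f)"
    by (metis diff_add_cancel norm_triangle_ineq)
  then show "(\<bar>r\<bar> - norm T) * norm f \<le> norm (blinfun_apply (poly_op [:- r, 1:] T) f)"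
    using norm_blinfun[of T f]
    by (simp add: poly_op_pCons blinfun.bilinear_simps algebra_simps norm_minus_commute)
qed

text \<open>The operator is (T - a)^2 + b^2. As T - a is selfadjoint, the quadratic form is at least
  b^2 |f|^2, and Cauchy-Schwarz turns this into a lower bound for the norm.\<close>

lemma bounded_below_quadratic_factor:
  assumes "selfadjoint T" "b \<noteq> 0" shows "bounded_below (poly_op [:a\<^sup>2 + b\<^sup>2, - 2 * a, 1:] T)"
  unfolding bounded_below_def
proof (intro exI conjI allI)
  show "b\<^sup>2 > 0" using assms by simp
  fix f
  define S where "S = poly_op [:- a, 1:] T"
  have S: "selfadjoint S" unfolding S_def by (rule selfadjoint_poly_op) fact
  have "[:a\<^sup>2 + b\<^sup>2, - 2 * a, 1:] = [:- a, 1:] * [:- a, 1:] + smult (b\<^sup>2) 1"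
    by (simp add: power2_eq_square one_pCons)
  then have eq: "poly_op [:a\<^sup>2 + b\<^sup>2, - 2 * a, 1:] T = (S o\<^sub>L S) + b\<^sup>2 *\<^sub>R id_blinfun"
    by (simp only: poly_op_add poly_op_mult poly_op_smult poly_op_1 S_def)
  have "b\<^sup>2 * (norm f)\<^sup>2 \<le> inner (blinfun_apply ((S o\<^sub>L S) + b\<^sup>2 *\<^sub>R id_blinfun) f) f"
    by (simp add: blinfun.bilinear_simps inner_add_left selfadjointD[OF S, of _ f] power2_norm_eq_inner)
  also have "\<dots> \<le> norm (blinfun_apply ((S o\<^sub>L S) + b\<^sup>2 *\<^sub>R id_blinfun) f) * norm f"
    by (rule norm_cauchy_schwarz)
  finally have "(b\<^sup>2 * norm f) * norm f \<le> norm (blinfun_apply ((S o\<^sub>L S) + b\<^sup>2 *\<^sub>R id_blinfun) f) * norm f"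
    by (simp add: power2_eq_square mult.assoc)
  then show "b\<^sup>2 * norm f \<le> norm (blinfun_apply (poly_op [:a\<^sup>2 + b\<^sup>2, - 2 * a, 1:] T) f)"
    unfolding eq by (cases "f = 0") auto
qed

section \<open>Real polynomials at complex points and their real factors\<close>

lemma poly_map_of_real_pCons:
  "poly (map_poly complex_of_real (pCons a p)) z = of_real a + z * poly (map_poly of_real p) z"
  by (simp add: map_poly_pCons)

lemma poly_map_of_real_add:
  "poly (map_poly complex_of_real (p + q)) z = poly (map_poly of_real p) z + poly (map_poly of_real q) z"
  by (induction p q rule: poly_induct2) (simp_all add: map_poly_pCons algebra_simps)

lemma poly_map_of_real_smult:
  "poly (map_poly complex_of_real (smult c q)) z = of_real c * poly (map_poly of_real q) z"
  by (induction q) (simp_all add: map_poly_pCons algebra_simps)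

lemma poly_map_of_real_mult:
  "poly (map_poly complex_of_real (p * q)) z = poly (map_poly of_real p) z * poly (map_poly of_real q) z"
proof (induction p)
  case (pCons a p)
  have "pCons a p * q = smult a q + pCons 0 (p * q)" by simp
  then show ?case using pCons
    by (simp only: poly_map_of_real_add poly_map_of_real_smult poly_map_of_real_pCons)
      (simp add: algebra_simps)
qed simp

lemma poly_map_of_real_of_real: "poly (map_poly complex_of_real p) (of_real x) = of_real (poly p x)"
  by (induction p) (simp_all add: map_poly_pCons)

text \<open>A complex root z of q is either real, which gives the linear factor, or it is also a
  root of the real quadratic (x - Re z)^2 + (Im z)^2. In the second case the remainder of q by that
  quadratic is real, of degree at most 1, and vanishes at the non-real point z, so it is 0.\<close>

lemma real_poly_real_or_quadratic_factor:
  fixes q :: "real poly"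
  assumes "degree q > 0"
  obtains (real) r s where "q = [:- r, 1:] * s"
  | (quadratic) a b s where "b \<noteq> 0" "q = [:a\<^sup>2 + b\<^sup>2, - 2 * a, 1:] * s"
proof -
  have "\<not> constant (poly (map_poly complex_of_real q))"
    using assms by (simp add: constant_degree degree_map_poly)
  then obtain z where z: "poly (map_poly complex_of_real q) z = 0"
    using fundamental_theorem_of_algebra by blast
  show ?thesis
  proof (cases "Im z = 0")
    case True
    then have "poly (map_poly complex_of_real q) (of_real (Re z)) = 0" using z
      by (metis complex_is_Real_iff of_real_Re)
    then have "poly q (Re z) = 0" by (simp only: poly_map_of_real_of_real of_real_eq_0_iff)
    then show ?thesis using real by (metis dvdE poly_eq_0_iff_dvd)
  next
    case False
    define d where "d = [:(Re z)\<^sup>2 + (Im z)\<^sup>2, - 2 * Re z, 1:]"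
    have dz: "poly (map_poly complex_of_real d) z = 0"
      by (simp add: d_def map_poly_pCons complex_eq_iff power2_eq_square algebra_simps)
    have "q mod d = 0 \<or> degree (q mod d) < degree d" by (rule degree_mod_less) (auto simp: d_def)
    then have "degree (q mod d) < 2" by (auto simp: d_def)
    then obtain u v where uv: "q mod d = [:u, v:]"
      by (metis One_nat_def Suc_1 degree_eq_zeroE degree_pCons_eq_if less_2_cases_iff not_less_eq pCons_cases less_Suc0 pCons_0_0 old.nat.inject)
    have "poly (map_poly complex_of_real (q div d * d + q mod d)) z = 0" using z by simp
    then have "of_real u + z * of_real v = 0"
      unfolding poly_map_of_real_add poly_map_of_real_mult dz uv by (simp add: map_poly_pCons)
    then have "v = 0" "u = 0" using False by (auto simp: complex_eq_iff)
    then have "q = d * (q div d)" using div_mult_mod_eq[of q d] uv by (simp add: mult.commute)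
    then show ?thesis using quadratic[OF False] unfolding d_def by blast
  qed
qed

text \<open>Induction along the real factorisation of q: a real root lies outside [-||T||, ||T||] by
  assumption, a non-real one comes with a quadratic factor that selfadjointness controls.\<close>

lemma bounded_below_poly_op:
  assumes T: "selfadjoint T" and "q \<noteq> 0" "\<And>t. \<bar>t\<bar> \<le> norm T \<Longrightarrow> poly q t \<noteq> 0"
  shows "bounded_below (poly_op q T)"
  using assms(2,3)
proof (induction "degree q" arbitrary: q rule: less_induct)
  case less
  show ?case
  proof (cases "degree q = 0")
    case True
    then obtain c where c: "q = [:c:]" by (rule degree_eq_zeroE)
    then have "c \<noteq> 0" using less by auto
    then show ?thesis
      unfolding bounded_below_def c by (intro exI[of _ "\<bar>c\<bar>"]) (simp add: poly_op_pCons blinfun.bilinear_simps)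
  next
    case False
    then have "degree q > 0" by simp
    then show ?thesis
    proof (cases rule: real_poly_real_or_quadratic_factor)
      case (real r s)
      have s: "s \<noteq> 0" using less.prems real by auto
      then have deg: "degree s < degree q" unfolding real by (subst degree_mult_eq) auto
      have "poly s t \<noteq> 0" if "\<bar>t\<bar> \<le> norm T" for t using less.prems(2)[OF that] real by auto
      with s deg have "bounded_below (poly_op s T)" by (intro less.hyps)
      moreover have "\<bar>r\<bar> > norm T" using less.prems(2)[of r] real by fastforce
      ultimately show ?thesis unfolding real poly_op_mult
        by (intro bounded_below_compose bounded_below_linear_factor)
    next
      case (quadratic b a s)
      have s: "s \<noteq> 0" using less.prems quadratic by auto
      then have "degree s < degree q" unfolding quadratic by (subst degree_mult_eq) auto
      moreover have "poly s t \<noteq> 0" if "\<bar>t\<bar> \<le> norm T" for t using less.prems(2)[OF that] quadratic by auto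
      ultimately have "bounded_below (poly_op s T)" using s by (intro less.hyps)
      then show ?thesis unfolding quadratic(2) poly_op_mult
        by (intro bounded_below_compose bounded_below_quadratic_factor T quadratic)
    qed
  qed
qed

text \<open>One of \<open>\<plusminus>\<parallel>S\<parallel>\<close> is an approximate eigenvalue of the self-adjoint operator \<open>S\<close>.\<close>

lemma not_bounded_below_norm_sq:
  assumes S: "selfadjoint S"
  shows "\<not> bounded_below ((S o\<^sub>L S) - (norm S)\<^sup>2 *\<^sub>R id_blinfun)"
proof
  let ?c = "norm S"
  assume "bounded_below ((S o\<^sub>L S) - ?c\<^sup>2 *\<^sub>R id_blinfun)"
  then obtain d where d: "d > 0"
    and bb: "\<And>f. d * norm f \<le> norm (blinfun_apply ((S o\<^sub>L S) - ?c\<^sup>2 *\<^sub>R id_blinfun) f)"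
    unfolding bounded_below_def by blast
  \<comment> \<open>Expanding the square gives the cross term -2 c^2 |S f|^2, and |S S f| <= c |S
    f|. A lower bound d > 0 thus keeps |S f| a fixed proportion below c |f|, against c being the
    norm of S.\<close>
  have key: "d\<^sup>2 * (norm f)\<^sup>2 \<le> ?c\<^sup>2 * (?c\<^sup>2 * (norm f)\<^sup>2 - (norm (blinfun_apply S f))\<^sup>2)" for f
  proof -
    let ?g = "blinfun_apply S f"
    have "(d * norm f)\<^sup>2 \<le> (norm (blinfun_apply S ?g - ?c\<^sup>2 *\<^sub>R f))\<^sup>2"
      using bb[of f] d by (intro power_mono) (auto simp: blinfun.bilinear_simps)
    also have "\<dots> = (norm (blinfun_apply S ?g))\<^sup>2 - 2 * ?c\<^sup>2 * inner (blinfun_apply S ?g) f + ?c^4 * (norm f)\<^sup>2"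
      unfolding power2_norm_eq_inner
      by (simp add: algebra_simps inner_commute power4_eq_xxxx power2_eq_square)
    also have "inner (blinfun_apply S ?g) f = (norm ?g)\<^sup>2"
      by (simp add: selfadjointD[OF S] power2_norm_eq_inner)
    also have "(norm (blinfun_apply S ?g))\<^sup>2 \<le> ?c\<^sup>2 * (norm ?g)\<^sup>2"
      using norm_blinfun[of S ?g] by (metis norm_ge_zero power_mono power_mult_distrib)
    finally show ?thesis by (simp add: algebra_simps power4_eq_xxxx power2_eq_square)
  qed
  \<comment> \<open>The first entry yields e c^2 <= d^2; the minimum with c^2 keeps sqrt (c^2 - e)
    meaningful.\<close>
  define e where "e = min (d\<^sup>2 / (?c\<^sup>2 + 1)) (?c\<^sup>2)"
  have "?c \<noteq> 0"
  proof
    assume "?c = 0"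
    then show False using key[of "delta undefined"] d by simp
  qed
  then have e: "e > 0" "e \<le> ?c\<^sup>2" using d by (auto simp: e_def add_pos_nonneg)
  have "norm (blinfun_apply S f) \<le> sqrt (?c\<^sup>2 - e) * norm f" for f
  proof -
    have "e * ?c\<^sup>2 \<le> d\<^sup>2 / (?c\<^sup>2 + 1) * (?c\<^sup>2 + 1)"
      unfolding e_def by (intro mult_mono) auto
    also have "\<dots> = d\<^sup>2" using add_pos_nonneg[of 1 "?c\<^sup>2"] by (simp add: add.commute)
    finally have "e * ?c\<^sup>2 * (norm f)\<^sup>2 \<le> ?c\<^sup>2 * (?c\<^sup>2 * (norm f)\<^sup>2 - (norm (blinfun_apply S f))\<^sup>2)"
      using key[of f] by (meson mult_right_mono order_trans zero_le_power2)
    then have "?c\<^sup>2 * (e * (norm f)\<^sup>2) \<le> ?c\<^sup>2 * (?c\<^sup>2 * (norm f)\<^sup>2 - (norm (blinfun_apply S f))\<^sup>2)"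
      by (simp add: mult_ac)
    then have "e * (norm f)\<^sup>2 \<le> ?c\<^sup>2 * (norm f)\<^sup>2 - (norm (blinfun_apply S f))\<^sup>2"
      using \<open>?c \<noteq> 0\<close> by simp
    then have "(norm (blinfun_apply S f))\<^sup>2 \<le> (sqrt (?c\<^sup>2 - e) * norm f)\<^sup>2"
      using e by (simp add: power_mult_distrib algebra_simps)
    then show ?thesis by (rule power2_le_imp_le) (use e in simp)
  qed
  then have "?c \<le> sqrt (?c\<^sup>2 - e)" using e by (intro norm_blinfun_bound) (auto simp: mult.commute)
  then have "?c\<^sup>2 \<le> ?c\<^sup>2 - e" using e by (metis norm_ge_zero real_sqrt_le_iff real_sqrt_pow2_iff real_sqrt_unique)
  then show False using e by simp
qed

text \<open>With q = p^2 - ||p(T)||^2, the operator q(T) is not bounded below, because p(T) is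
  selfadjoint and attains its norm approximately. By \<open>bounded_below_poly_op\<close>, q must
  then vanish somewhere on the interval.\<close>

theorem norm_poly_op_eq:
  assumes T: "selfadjoint T"
  obtains t where "\<bar>t\<bar> \<le> norm T" "norm (poly_op p T) = \<bar>poly p t\<bar>"
proof -
  define q where "q = p * p - [:(norm (poly_op p T))\<^sup>2:]"
  have "\<exists>t. \<bar>t\<bar> \<le> norm T \<and> poly q t = 0"
  proof (rule ccontr)
    assume neg: "\<nexists>t. \<bar>t\<bar> \<le> norm T \<and> poly q t = 0"
    then have "q \<noteq> 0" by (metis abs_zero norm_ge_zero poly_0)
    then have "bounded_below (poly_op q T)" using neg by (intro bounded_below_poly_op T) auto
    moreover have "poly_op q T = (poly_op p T o\<^sub>L poly_op p T) - (norm (poly_op p T))\<^sup>2 *\<^sub>R id_blinfun"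
      by (simp add: q_def poly_op_diff poly_op_mult poly_op_pCons)
    ultimately show False using not_bounded_below_norm_sq[OF selfadjoint_poly_op[OF T, of p]] by simp
  qed
  then obtain t where t: "\<bar>t\<bar> \<le> norm T" "poly q t = 0" by blast
  then have "(poly p t)\<^sup>2 = (norm (poly_op p T))\<^sup>2" by (simp add: q_def power2_eq_square)
  then have "norm (poly_op p T) = \<bar>poly p t\<bar>" by (metis abs_norm_cancel power2_eq_iff abs_minus_cancel)
  with t show ?thesis using that by blast
qed

lemma norm_poly_op_le:
  assumes "selfadjoint T" "\<And>t. \<bar>t\<bar> \<le> norm T \<Longrightarrow> \<bar>poly p t\<bar> \<le> c"
  shows "norm (poly_op p T) \<le> c"
  using norm_poly_op_eq[OF assms(1), of p] assms(2) by metis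

text \<open>If 0 <= p <= c on the interval, then 0 <= c - p <= c there, so ||c - p(T)|| <= c and the
  quadratic form of c - p(T) is at most c |f|^2.\<close>

lemma poly_op_nonneg:
  assumes T: "selfadjoint T" and p: "\<And>t. \<bar>t\<bar> \<le> norm T \<Longrightarrow> 0 \<le> poly p t"
  shows "0 \<le> inner (blinfun_apply (poly_op p T) f) f"
proof -
  have "compact (poly p ` {- norm T..norm T})"
    by (intro compact_continuous_image continuous_intros) auto
  then obtain c where c: "\<And>t. \<bar>t\<bar> \<le> norm T \<Longrightarrow> poly p t \<le> c"
    using bounded_imp_bdd_above[OF compact_imp_bounded] by (force simp: bdd_above_def abs_le_iff)
  have c0: "0 \<le> c" using p[of 0] c[of 0] by simp
  have "norm (poly_op ([:c:] - p) T) \<le> c"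
    using p c by (intro norm_poly_op_le T) (auto simp: abs_le_iff)
  then have "inner (blinfun_apply (poly_op ([:c:] - p) T) f) f \<le> c * norm f * norm f"
    by (meson norm_blinfun norm_cauchy_schwarz norm_ge_zero mult_right_mono order_trans)
  then show ?thesis
    by (simp add: poly_op_diff poly_op_pCons blinfun.bilinear_simps inner_diff_left
        power2_norm_eq_inner[symmetric] power2_eq_square)
qed


section \<open>The moment problem on a compact interval\<close>

text \<open>
  Applying \<open>\<Lambda>\<close> to the Bernstein polynomials of degree \<open>n\<close> gives the weights of an atomic measure on
  the points \<open>k/n\<close>; Helly's selection theorem provides a weak limit of these measures.
\<close>

lemma hausdorff_moment_problem:
  fixes \<Lambda> :: "real poly \<Rightarrow> real"
  assumes add: "\<And>p q. \<Lambda> (p + q) = \<Lambda> p + \<Lambda> q" and smult: "\<And>c p. \<Lambda> (smult c p) = c * \<Lambda> p"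
    and pos: "\<And>p. (\<And>t. 0 \<le> t \<Longrightarrow> t \<le> 1 \<Longrightarrow> 0 \<le> poly p t) \<Longrightarrow> 0 \<le> \<Lambda> p" and one: "\<Lambda> 1 = 1"
  obtains \<nu> :: "real measure" where "real_distribution \<nu>" "AE t in \<nu>. 0 \<le> t \<and> t \<le> 1"
    "\<And>p. (\<integral>t. poly p t \<partial>\<nu>) = \<Lambda> p"
proof -
  define bern :: "nat \<Rightarrow> nat \<Rightarrow> real poly"
    where "bern n k = smult (of_nat (n choose k)) ([:0, 1:] ^ k * [:1, -1:] ^ (n - k))" for n k
  have poly_bern: "poly (bern n k) t = Bernstein n k t" for n k t
    by (simp add: bern_def Bernstein_def)
  have zero: "\<Lambda> 0 = 0" using smult[of 0 0] by simp
  have sum: "\<Lambda> (\<Sum>i\<in>A. f i) = (\<Sum>i\<in>A. \<Lambda> (f i))" for A :: "nat set" and f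
    by (induction A rule: infinite_finite_induct) (simp_all add: zero add)
  define w where "w n k = \<Lambda> (bern n k)" for n k
  have w_nonneg: "0 \<le> w n k" for n k
    unfolding w_def by (rule pos) (simp add: poly_bern Bernstein_nonneg)
  have "(\<Sum>k\<le>n. bern n k) = 1" for n
    by (rule poly_eqI_degree_lead_coeff poly_eq_poly_eq_iff[THEN iffD1], rule ext) (simp add: poly_sum poly_bern)
  then have w_sum: "(\<Sum>k\<le>n. w n k) = 1" for n
    unfolding w_def sum[symmetric] by (simp add: one)
  define \<mu> where "\<mu> n = distr (point_measure {..n} (\<lambda>k. ennreal (w n k))) borel (\<lambda>k. real k / real n)" for n
  have int_\<mu>: "(\<integral>t. f t \<partial>\<mu> n) = (\<Sum>k\<le>n. w n k * f (k / n))" if [measurable]: "f \<in> borel_measurable borel" for f :: "real \<Rightarrow> real" and n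
    unfolding \<mu>_def
    by (subst integral_distr) (auto simp: lebesgue_integral_point_measure_finite w_nonneg)
  have dist: "real_distribution (\<mu> n)" for n
  proof -
    interpret prob_space "point_measure {..n} (\<lambda>k. ennreal (w n k))"
      by (rule prob_spaceI) (simp add: emeasure_point_measure_finite space_point_measure sum_ennreal w_nonneg w_sum)
    show ?thesis unfolding \<mu>_def
      by (auto simp: real_distribution_def real_distribution_axioms_def intro!: prob_space_distr)
  qed
  \<comment> \<open>This includes n = 0, where the quotient is 0 by the convention for division and
    still lies in [0, 1].\<close>
  have in01: "0 \<le> real k / real n" "real k / real n \<le> 1" if "k \<le> n" for k n
    using that by (auto simp: divide_le_eq_1)
  have "tight \<mu>"
    unfolding tight_def
  proof (intro conjI allI impI dist)
    fix e :: real assume "e > 0"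
    \<comment> \<open>Tightness is phrased with intervals open on the left, so the left end has to
      lie strictly below 0 to capture a possible mass at 0.\<close>
    have "measure (\<mu> n) {-1<..2} = 1" for n
    proof -
      interpret real_distribution "\<mu> n" by (rule dist)
      have "measure (\<mu> n) {-1<..2} = (\<integral>t. indicator {-1<..2} t \<partial>\<mu> n)" by simp
      also have "\<dots> = (\<Sum>k\<le>n. w n k * indicator {-1<..2} (real k / real n))" by (rule int_\<mu>) simp
      also have "\<dots> = (\<Sum>k\<le>n. w n k)"
      proof (rule sum.cong)
        fix k assume "k \<in> {..n}"
        then have "real k / real n \<in> {-1<..2}" using in01[of k n] by (auto intro: less_le_trans[of _ 0])
        then show "w n k * indicator {-1<..2} (real k / real n) = w n k" by simp
      qed simp
      finally show ?thesis by (simp add: w_sum)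
    qed
    then show "\<exists>a b. a < b \<and> (\<forall>n. 1 - e < measure (\<mu> n) {a<..b})"
      using \<open>e > 0\<close> by (intro exI[of _ "-1"] exI[of _ 2]) simp
  qed
  \<comment> \<open>A subsequence is enough: the Bernstein approximations of a fixed polynomial
    converge along the whole sequence, so the integrals found below do not depend on
    \<open>r\<close>.\<close>
  from tight_imp_convergent_subsubsequence[OF this strict_mono_id]
  obtain r \<nu> where r: "strict_mono r" and \<nu>: "real_distribution \<nu>" and conv: "weak_conv_m (\<mu> \<circ> r) \<nu>"
    by auto
  interpret \<nu>: real_distribution \<nu> by (rule \<nu>)
  \<comment> \<open>Weak convergence tests bounded continuous functions on the whole line, while
    polynomials are unbounded. Composing with the retraction onto [0, 1] makes them admissible and
    leaves the values at all points k/n unchanged.\<close>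
  define clamp :: "real \<Rightarrow> real" where "clamp t = max 0 (min 1 t)" for t
  have clamp: "0 \<le> clamp t" "clamp t \<le> 1" "0 \<le> t \<Longrightarrow> t \<le> 1 \<Longrightarrow> clamp t = t" for t
    by (auto simp: clamp_def)
  have clamp_cont: "continuous_on UNIV clamp"
    unfolding clamp_def by (intro continuous_intros)
  have meas: "f \<in> borel_measurable \<nu>" if "continuous_on UNIV f" for f :: "real \<Rightarrow> real"
    using borel_measurable_continuous_onI[OF that] measurable_cong_sets[OF \<nu>.events_eq_borel refl] by blast
  have lim: "(\<lambda>n. \<Sum>k\<le>r n. w (r n) k * f (k / r n)) \<longlonglongrightarrow> (\<integral>t. f t \<partial>\<nu>)"
    if "continuous_on UNIV f" "\<And>t. \<bar>f t\<bar> \<le> B" for f B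
  proof -
    have "(\<lambda>n. \<integral>t. f t \<partial>(\<mu> \<circ> r) n) \<longlonglongrightarrow> (\<integral>t. f t \<partial>\<nu>)"
      by (rule weak_conv_imp_integral_bdd_continuous_conv[OF _ \<nu> conv])
        (use that dist in \<open>auto simp: continuous_on_eq_continuous_at\<close>)
    then show ?thesis using that
      by (simp add: int_\<mu> borel_measurable_continuous_onI)
  qed
  \<comment> \<open>The integrand is bounded and continuous, and it vanishes exactly on [0, 1].
    Since it is 0 at all atoms of the approximating measures, the limit measure is carried by
    [0, 1].\<close>
  have "(\<integral>t. min 1 \<bar>t - clamp t\<bar> \<partial>\<nu>) = 0"
  proof (rule LIMSEQ_unique[OF lim[of _ 1]])
    show "continuous_on UNIV (\<lambda>t. min 1 \<bar>t - clamp t\<bar>)"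
      by (intro continuous_intros clamp_cont)
    have "(\<Sum>k\<le>r n. w (r n) k * min 1 \<bar>real k / real (r n) - clamp (real k / real (r n))\<bar>) = 0" for n
      by (intro sum.neutral ballI) (simp add: clamp(3) in01)
    then show "(\<lambda>n. \<Sum>k\<le>r n. w (r n) k * min 1 \<bar>real k / real (r n) - clamp (real k / real (r n))\<bar>) \<longlonglongrightarrow> 0"
      by simp
  qed simp
  moreover have "integrable \<nu> (\<lambda>t. min 1 \<bar>t - clamp t\<bar>)"
    by (rule \<nu>.integrable_const_bound[of _ 1])
      (auto intro!: meas continuous_intros clamp_cont)
  ultimately have "AE t in \<nu>. min 1 \<bar>t - clamp t\<bar> = 0"
    by (subst (asm) integral_nonneg_eq_0_iff_AE) auto
  then have supp: "AE t in \<nu>. 0 \<le> t \<and> t \<le> 1"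
  proof (rule AE_mp, intro AE_I2 impI)
    fix t assume "min 1 \<bar>t - clamp t\<bar> = 0"
    then have "t = clamp t" by (auto simp: min_def split: if_splits)
    then show "0 \<le> t \<and> t \<le> 1" using clamp[of t] by simp
  qed
  have "(\<integral>t. poly p t \<partial>\<nu>) = \<Lambda> p" for p
  proof -
    have "compact (poly p ` {0..1})"
      by (intro compact_continuous_image continuous_intros) auto
    then obtain B where B: "\<And>t. 0 \<le> t \<Longrightarrow> t \<le> 1 \<Longrightarrow> \<bar>poly p t\<bar> \<le> B"
      using compact_imp_bounded by (force simp: bounded_iff)
    have cont: "continuous_on UNIV (\<lambda>t. poly p (clamp t))"
      by (intro continuous_intros clamp_cont)
    have "(\<integral>t. poly p t \<partial>\<nu>) = (\<integral>t. poly p (clamp t) \<partial>\<nu>)"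
      by (rule integral_cong_AE)
        (use supp cont in \<open>auto intro!: meas continuous_intros simp: clamp(3) elim!: AE_mp\<close>)
    also have "\<dots> = \<Lambda> p"
    proof (rule LIMSEQ_unique[OF lim[OF cont, of B]])
      have eq: "(\<Sum>k\<le>n. w n k * poly p (clamp (k / n))) = \<Lambda> (\<Sum>k\<le>n. smult (poly p (k / n)) (bern n k))" for n
        unfolding sum smult w_def by (intro sum.cong) (auto simp: clamp(3) in01)
      have "(\<lambda>n. \<Lambda> (\<Sum>k\<le>n. smult (poly p (k / n)) (bern n k))) \<longlonglongrightarrow> \<Lambda> p"
      proof (rule LIMSEQ_I)
        fix e :: real assume "e > 0"
        have "continuous_on {0..1} (poly p)" by (intro continuous_intros)
        from Bernstein_Weierstrass[OF this half_gt_zero[OF \<open>e > 0\<close>]]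
        obtain N where N: "\<And>n x. n \<ge> N \<Longrightarrow> x \<in> {0..1} \<Longrightarrow>
            \<bar>poly p x - (\<Sum>k\<le>n. poly p (k / n) * Bernstein n k x)\<bar> < e / 2"
          by blast
        have "norm (\<Lambda> (\<Sum>k\<le>n. smult (poly p (k / n)) (bern n k)) - \<Lambda> p) < e" if n: "n \<ge> N" for n
        proof -
          let ?q = "\<Sum>k\<le>n. smult (poly p (k / n)) (bern n k)"
          have q: "\<bar>poly p t - poly ?q t\<bar> < e / 2" if "0 \<le> t" "t \<le> 1" for t
            using N[OF n, of t] that by (simp add: poly_sum poly_bern)
          \<comment> \<open>Positivity makes \<Lambda> continuous for the supremum norm: e/2 plus or
            minus the error of approximation is nonnegative on [0, 1], and \<Lambda> 1 = 1.\<close>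
          have "0 \<le> \<Lambda> (smult (e/2) 1 + ?q + smult (-1) p)"
          proof (rule pos)
            fix t :: real assume "0 \<le> t" "t \<le> 1"
            from q[OF this] have "poly p t \<le> e / 2 + poly ?q t" by linarith
            then show "0 \<le> poly (smult (e/2) 1 + ?q + smult (-1) p) t" by simp
          qed
          moreover have "0 \<le> \<Lambda> (smult (e/2) 1 + smult (-1) ?q + p)"
          proof (rule pos)
            fix t :: real assume "0 \<le> t" "t \<le> 1"
            from q[OF this] have "poly ?q t \<le> e / 2 + poly p t" by linarith
            then show "0 \<le> poly (smult (e/2) 1 + smult (-1) ?q + p) t" by simp
          qed
          ultimately show ?thesis
            unfolding add smult one using \<open>e > 0\<close> by (auto simp: abs_less_iff)
        qed
        then show "\<exists>no. \<forall>n\<ge>no. norm (\<Lambda> (\<Sum>k\<le>n. smult (poly p (k / n)) (bern n k)) - \<Lambda> p) < e" by blast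
      qed
      then show "(\<lambda>n. \<Sum>k\<le>r n. w (r n) k * poly p (clamp (k / r n))) \<longlonglongrightarrow> \<Lambda> p"
        unfolding eq using r by (rule LIMSEQ_subseq_LIMSEQ[unfolded comp_def])
    qed (use B clamp in auto)
    finally show ?thesis .
  qed
  with that \<nu> supp show ?thesis by blast
qed

text \<open>Transport from [0, 1] by s = 1/2 + t/(2M), whose inverse is t = 2Ms - M. For M = 0 this
  map degenerates; there positivity applied to p - p(0) and its negative gives \<Lambda> p = p(0),
  the point mass at 0.\<close>

lemma moment_problem_symmetric_interval:
  fixes \<Lambda> :: "real poly \<Rightarrow> real"
  assumes add: "\<And>p q. \<Lambda> (p + q) = \<Lambda> p + \<Lambda> q" and smult: "\<And>c p. \<Lambda> (smult c p) = c * \<Lambda> p"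
    and pos: "\<And>p. (\<And>t. \<bar>t\<bar> \<le> M \<Longrightarrow> 0 \<le> poly p t) \<Longrightarrow> 0 \<le> \<Lambda> p" and one: "\<Lambda> 1 = 1" and M: "0 \<le> M"
  obtains \<nu> :: "real measure" where "real_distribution \<nu>" "AE t in \<nu>. \<bar>t\<bar> \<le> M"
    "\<And>p. (\<integral>t. poly p t \<partial>\<nu>) = \<Lambda> p"
proof (cases "M = 0")
  case True
  have "\<Lambda> p = poly p 0" for p
  proof -
    have "0 \<le> \<Lambda> (p + smult (- poly p 0) 1)" "0 \<le> \<Lambda> (smult (-1) p + smult (poly p 0) 1)"
      using True by (auto intro!: pos)
    then show ?thesis unfolding add smult one by simp
  qed
  moreover have "real_distribution (return borel (0::real))"
    by (simp add: real_distribution_def real_distribution_axioms_def prob_space_return)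
  ultimately show ?thesis
    using True by (intro that[of "return borel 0"])
      (auto simp: AE_return integral_return borel_measurable_continuous_onI continuous_intros)
next
  case False
  with M have M: "M > 0" by simp
  define \<Lambda>' where "\<Lambda>' p = \<Lambda> (pcompose p [:1/2, 1/(2*M):])" for p
  obtain \<nu> where \<nu>: "real_distribution \<nu>" "AE t in \<nu>. 0 \<le> t \<and> t \<le> 1" "\<And>p. (\<integral>t. poly p t \<partial>\<nu>) = \<Lambda>' p"
  proof (rule hausdorff_moment_problem[of \<Lambda>'])
    fix p :: "real poly" assume p: "\<And>t. 0 \<le> t \<Longrightarrow> t \<le> 1 \<Longrightarrow> 0 \<le> poly p t"
    show "0 \<le> \<Lambda>' p" unfolding \<Lambda>'_def
    proof (rule pos)
      fix t assume "\<bar>t\<bar> \<le> M"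
      then have "-1 \<le> t / M" "t / M \<le> 1" using M by (auto simp: field_simps)
      then show "0 \<le> poly (pcompose p [:1/2, 1/(2*M):]) t"
        unfolding poly_pcompose by (intro p) (auto simp: field_simps)
    qed
  qed (auto simp: \<Lambda>'_def pcompose_add pcompose_smult add smult one pcompose_1)
  interpret \<nu>: real_distribution \<nu> by (rule \<nu>)
  define \<nu>' where "\<nu>' = distr \<nu> borel (\<lambda>s. 2 * M * s - M)"
  show ?thesis
  proof (rule that[of \<nu>'])
    show "real_distribution \<nu>'"
      unfolding \<nu>'_def by (auto simp: real_distribution_def real_distribution_axioms_def intro!: \<nu>.prob_space_distr)
    have "\<bar>2 * M * s - M\<bar> \<le> M" if "0 \<le> s \<and> s \<le> 1" for s
    proof -
      have "0 \<le> 2 * M * s" "2 * M * s \<le> 2 * M * 1" using that M by (auto intro!: mult_left_mono)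
      then show ?thesis by (simp add: abs_le_iff)
    qed
    then show "AE t in \<nu>'. \<bar>t\<bar> \<le> M"
      unfolding \<nu>'_def using \<nu>(2) by (subst AE_distr_iff) (auto elim!: AE_mp)
    fix p
    have eq: "poly (pcompose p [:- M, 2 * M:]) s = poly p (2 * M * s - M)" for s
      by (simp add: poly_pcompose algebra_simps)
    have "(\<integral>t. poly p t \<partial>\<nu>') = (\<integral>s. poly (pcompose p [:- M, 2 * M:]) s \<partial>\<nu>)"
      unfolding \<nu>'_def eq
      by (subst integral_distr) (auto intro!: borel_measurable_continuous_onI continuous_intros)
    also have "\<dots> = \<Lambda> (pcompose (pcompose p [:- M, 2 * M:]) [:1/2, 1/(2*M):])"
      by (simp add: \<nu>(3) \<Lambda>'_def)
    also have "pcompose (pcompose p [:- M, 2 * M:]) [:1/2, 1/(2*M):] = p"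
      using M by (intro poly_eq_poly_eq_iff[THEN iffD1] ext) (simp add: poly_pcompose field_simps)
    finally show "(\<integral>t. poly p t \<partial>\<nu>') = \<Lambda> p" .
  qed
qed

text \<open>The source of the uniqueness of the density of states. \<open>N\<close> is not assumed
  to be a probability measure; the constant test function shows that it is one. Ramps falling from 1
  to 0 between a and a + 1/(n+1) converge to the indicator of {..a}, so the distribution functions
  agree.\<close>

lemma real_distribution_eqI_continuous:
  fixes M N :: "real measure"
  assumes M: "real_distribution M" and sets: "sets N = sets borel"
    and int: "\<And>f :: real \<Rightarrow> real. continuous_on UNIV f \<Longrightarrow> integrable N f"
    and eq: "\<And>f :: real \<Rightarrow> real. continuous_on UNIV f \<Longrightarrow> (\<integral>x. f x \<partial>N) = (\<integral>x. f x \<partial>M)"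
  shows "N = M"
proof -
  interpret M: real_distribution M by (rule M)
  have space: "space N = UNIV" using sets_eq_imp_space_eq[OF sets] by simp
  have N: "real_distribution N"
  proof -
    have "integrable N (\<lambda>_. 1 :: real)" by (rule int) simp
    then have "emeasure N (space N) < \<infinity>" by (simp add: integrable_iff_bounded)
    then interpret finite_measure N by (intro finite_measureI) auto
    have "measure N (space N) = 1" using eq[of "\<lambda>_. 1"] M.prob_space by simp
    then have "emeasure N (space N) = 1" by (simp add: emeasure_eq_measure)
    then show ?thesis
      by (intro real_distribution.intro prob_spaceI) (auto simp: real_distribution_axioms_def sets space)
  qed
  have cdf: "(\<lambda>n. \<integral>x. cts_step a (a + 1 / Suc n) x \<partial>L) \<longlonglongrightarrow> cdf L a" if "real_distribution L" for a L
  proof -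
    interpret L: real_distribution L by (rule that)
    have "(\<lambda>n. \<integral>x. cts_step a (a + 1 / Suc n) x \<partial>L) \<longlonglongrightarrow> (\<integral>x. indicator {..a} x \<partial>L)"
    proof (rule integral_dominated_convergence[where w = "\<lambda>_. 1"])
      show "AE x in L. (\<lambda>n. cts_step a (a + 1 / Suc n) x) \<longlonglongrightarrow> indicator {..a} x"
      proof (intro AE_I2)
        fix x :: real
        show "(\<lambda>n. cts_step a (a + 1 / Suc n) x) \<longlonglongrightarrow> indicator {..a} x"
        proof (cases "x \<le> a")
          case False
          have "(\<lambda>n. a + 1 / Suc n) \<longlonglongrightarrow> a + 0"
            by (intro tendsto_intros LIMSEQ_inverse_real_of_nat[unfolded inverse_eq_divide])
          then have "\<forall>\<^sub>F n in sequentially. a + 1 / Suc n < x"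
            using False by (intro order_tendstoD) auto
          then have "\<forall>\<^sub>F n in sequentially. cts_step a (a + 1 / Suc n) x = indicator {..a} x"
            by (rule eventually_mono) (use False in \<open>auto simp: cts_step_def\<close>)
          then show ?thesis by (rule tendsto_eventually)
        qed (simp add: cts_step_def)
      qed
    next
      have "\<bar>cts_step a b x\<bar> \<le> 1" if "a < b" for b x
        using that by (auto simp: cts_step_def abs_le_iff divide_le_eq_1)
      then show "AE x in L. norm (cts_step a (a + 1 / Suc n) x) \<le> 1" for n
        by (intro AE_I2) simp
    qed (auto simp: cts_step_def)
    then show ?thesis by (simp add: cdf_def)
  qed
  have "cdf N a = cdf M a" for a
  proof (rule LIMSEQ_unique[OF cdf[OF N, of a]])
    have "continuous_on UNIV (cts_step a (a + 1 / Suc n))" for n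
      by (intro uniformly_continuous_imp_continuous cts_step_uniformly_continuous) simp
    then show "(\<lambda>n. \<integral>x. cts_step a (a + 1 / Suc n) x \<partial>N) \<longlonglongrightarrow> cdf M a"
      using cdf[OF M, of a] by (simp only: eq)
  qed
  then show ?thesis using cdf_unique[OF N M] by auto
qed


section \<open>Closed walks and their density\<close>

text \<open>The matrix entry of the k-th power of the adjacency operator at (u, v), see
  \<open>op_power_adj_op_delta\<close>. Real values avoid conversions in the averages.\<close>

fun walks :: "'a sgraph \<Rightarrow> nat \<Rightarrow> 'a \<Rightarrow> 'a \<Rightarrow> real" where
  "walks G 0 u v = (if u = v then 1 else 0)"
| "walks G (Suc k) u v = (\<Sum>w\<in>neighbours G u. walks G k w v)"

lemma neighbours_commute: "v \<in> neighbours G w \<longleftrightarrow> w \<in> neighbours G v"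
  by (simp add: neighbours_def insert_commute)

lemma graph_neighbours_subset: "graph G \<Longrightarrow> neighbours G v \<subseteq> verts G"
  unfolding graph_def neighbours_def by (auto simp: doubleton_eq_iff)

lemma graph_neighbours_verts: "graph G \<Longrightarrow> w \<in> neighbours G v \<Longrightarrow> v \<in> verts G"
  using graph_neighbours_subset neighbours_commute by fast

lemma graph_degree_bound:
  assumes "graph G"
  obtains d :: nat where "\<And>v. finite (neighbours G v)" "\<And>v. card (neighbours G v) \<le> d"
proof -
  from assms obtain d where d: "\<forall>v\<in>verts G. finite (neighbours G v) \<and> card (neighbours G v) \<le> d"
    unfolding graph_def by blast
  have "neighbours G v = {}" if "v \<notin> verts G" for v
    using graph_neighbours_verts[OF assms] that by blast
  then have "finite (neighbours G v) \<and> card (neighbours G v) \<le> d" for v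
    using d by (cases "v \<in> verts G") auto
  then show ?thesis using that by blast
qed

lemma finite_neighbours: "graph G \<Longrightarrow> finite (neighbours G v)"
  using graph_degree_bound by metis

lemma walks_nonneg: "0 \<le> walks G k u v"
  by (induction k arbitrary: u) (auto intro: sum_nonneg)

lemma walks_le:
  assumes "\<And>v. card (neighbours G v) \<le> d"
  shows "walks G k u v \<le> real d ^ k"
proof (induction k arbitrary: u)
  case (Suc k)
  have "(\<Sum>w\<in>neighbours G u. walks G k w v) \<le> card (neighbours G u) * real d ^ k"
    by (rule sum_bounded_above) (use Suc in auto)
  also have "\<dots> \<le> d * real d ^ k"
    using assms by (intro mult_right_mono) auto
  finally show ?case by simp
qed simp

lemma walks_iso:
  assumes inj: "inj_on f (verts G)" and G: "graph G"
    and nb: "\<And>u. u \<in> verts G \<Longrightarrow> neighbours H (f u) = f ` neighbours G u"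
    and "u \<in> verts G" "v \<in> verts G"
  shows "walks H k (f u) (f v) = walks G k u v"
  using \<open>u \<in> verts G\<close>
proof (induction k arbitrary: u)
  case 0
  then show ?case using inj \<open>v \<in> verts G\<close> by (auto dest: inj_onD)
next
  case (Suc k)
  have sub: "neighbours G u \<subseteq> verts G" by (rule graph_neighbours_subset) fact
  have "walks H (Suc k) (f u) (f v) = (\<Sum>w\<in>f ` neighbours G u. walks H k w (f v))"
    using Suc.prems by (simp add: nb)
  also have "\<dots> = (\<Sum>w\<in>neighbours G u. walks H k (f w) (f v))"
    using inj sub by (subst sum.reindex) (auto intro: inj_on_subset)
  also have "\<dots> = walks G (Suc k) u v"
    using Suc.IH sub by (auto intro!: sum.cong)
  finally show ?case .
qed

text \<open>Bundles the limits with the conditions that make them stable. The frontier ratio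
  controls walks that leave \<open>K n\<close>, and the growth of \<open>K n\<close> makes finite
  changes negligible; both are re-established after each perturbation so that perturbations can be
  chained.\<close>

definition walk_moments :: "'a sgraph \<Rightarrow> (nat \<Rightarrow> 'a set) \<Rightarrow> (nat \<Rightarrow> real) \<Rightarrow> bool" where
  "walk_moments G K m \<longleftrightarrow> graph G \<and> (\<forall>n. finite (K n)) \<and>
     filterlim (\<lambda>n. real (card (K n))) at_top sequentially \<and>
     (\<lambda>n. real (card (frontier_verts G (K n))) / real (card (K n))) \<longlonglongrightarrow> 0 \<and>
     (\<forall>k. (\<lambda>n. (\<Sum>v\<in>K n. walks G k v v) / real (card (K n))) \<longlonglongrightarrow> m k)"

section \<open>Stability of the walk densities under perturbations\<close>

lemma tendsto_ratio_zero:
  fixes f g :: "nat \<Rightarrow> real"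
  assumes "g \<longlonglongrightarrow> 0" "\<And>n. \<bar>f n\<bar> \<le> C * g n"
  shows "f \<longlonglongrightarrow> 0"
  by (rule Lim_null_comparison[OF _ tendsto_mult_right_zero[OF assms(1), of C]])
    (use assms(2) in auto)

lemma sum_diff_sym_diff_le:
  fixes w :: "'a \<Rightarrow> real"
  assumes "finite A" "finite B" "\<And>v. \<bar>w v\<bar> \<le> c"
  shows "\<bar>(\<Sum>v\<in>A. w v) - (\<Sum>v\<in>B. w v)\<bar> \<le> c * card (sym_diff A B)"
proof -
  have "(\<Sum>v\<in>A. w v) = (\<Sum>v\<in>A \<inter> B. w v) + (\<Sum>v\<in>A - B. w v)"
    using assms(1) by (subst sum.union_disjoint[symmetric]) (auto intro!: sum.cong)
  moreover have "(\<Sum>v\<in>B. w v) = (\<Sum>v\<in>A \<inter> B. w v) + (\<Sum>v\<in>B - A. w v)"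
    using assms(2) by (subst sum.union_disjoint[symmetric]) (auto intro!: sum.cong)
  ultimately have "\<bar>(\<Sum>v\<in>A. w v) - (\<Sum>v\<in>B. w v)\<bar> \<le> (\<Sum>v\<in>A - B. \<bar>w v\<bar>) + (\<Sum>v\<in>B - A. \<bar>w v\<bar>)"
    using sum_abs[of w "A - B"] sum_abs[of w "B - A"] by linarith
  also have "\<dots> = (\<Sum>v\<in>sym_diff A B. \<bar>w v\<bar>)"
    using assms by (subst sum.union_disjoint) auto
  also have "\<dots> \<le> card (sym_diff A B) * c"
    by (rule sum_bounded_above) (use assms in auto)
  finally show ?thesis by (simp add: mult.commute)
qed

text \<open>If u has different counts for k + 1 steps, then u lies in the exceptional set, or some
  neighbour of u inside S has different counts for k steps. As a vertex has at most d neighbours,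
  a(k+1) <= |B| + d a(k), which sums to the geometric factor. The end point v is arbitrary because
  removing the first step of a closed walk leaves a walk that need not be closed.\<close>

lemma card_walks_changed_le:
  fixes G H :: "'a sgraph" and S :: "'a set"
  assumes G: "graph G" and H: "graph H" and d: "\<And>v. card (neighbours G v) \<le> d" and S: "finite S"
  shows "card {u \<in> S. \<exists>v. walks G k u v \<noteq> walks H k u v} \<le>
    (\<Sum>i<k. d ^ i) * card ({u \<in> S. neighbours G u \<noteq> neighbours H u} \<union> frontier_verts G S)"
    (is "card (?A k) \<le> _ * card ?B")
proof (induction k)
  case (Suc k)
  have fin: "finite ?B" "finite (?A k)" using S by (auto simp: frontier_verts_def)
  have "?A (Suc k) \<subseteq> ?B \<union> (\<Union>w\<in>?A k. neighbours G w)"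
  proof
    fix u assume u: "u \<in> ?A (Suc k)"
    show "u \<in> ?B \<union> (\<Union>w\<in>?A k. neighbours G w)"
    proof (cases "u \<in> ?B")
      case False
      then have eq: "neighbours G u = neighbours H u" and nf: "u \<notin> frontier_verts G S" using u by auto
      from u obtain v where "u \<in> S" "walks G (Suc k) u v \<noteq> walks H (Suc k) u v" by blast
      then obtain w where w: "w \<in> neighbours G u" "walks G k w v \<noteq> walks H k w v"
        using eq by (auto intro: sum.cong)
      have "w \<in> verts G" using graph_neighbours_subset[OF G] w by blast
      then have "w \<in> S" using nf w \<open>u \<in> S\<close> by (auto simp: frontier_verts_def neighbours_def)
      then show ?thesis using w neighbours_commute by fast
    qed simp
  qed
  then have "card (?A (Suc k)) \<le> card (?B \<union> (\<Union>w\<in>?A k. neighbours G w))"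
    using fin finite_neighbours[OF G] by (intro card_mono) auto
  also have "\<dots> \<le> card ?B + card (\<Union>w\<in>?A k. neighbours G w)" by (rule card_Un_le)
  also have "card (\<Union>w\<in>?A k. neighbours G w) \<le> (\<Sum>w\<in>?A k. card (neighbours G w))"
    by (rule card_UN_le) (rule fin)
  also have "\<dots> \<le> card (?A k) * d" using sum_bounded_above[of "?A k" "\<lambda>w. card (neighbours G w)" d] d by simp
  also have "card (?A k) * d \<le> (\<Sum>i<k. d ^ i) * card ?B * d" using Suc.IH by (rule mult_right_mono) simp
  also have "card ?B + (\<Sum>i<k. d ^ i) * card ?B * d = (\<Sum>i<Suc k. d ^ i) * card ?B"
    by (simp add: sum.lessThan_Suc_shift sum_distrib_left sum_distrib_right algebra_simps del: sum.lessThan_Suc)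
  finally show ?case by simp
qed simp

text \<open>Let v be on the new frontier with H-neighbour w outside S'. If v is not in S, or w is in
  S, then v belongs to the symmetric difference or is adjacent to it, which accounts for the factor
  1 + d. Otherwise v was already on the old frontier or its neighbourhood has changed.\<close>

lemma card_frontier_verts_perturbed_le:
  assumes G: "graph G" and H: "graph H" and d: "\<And>v. card (neighbours H v) \<le> d"
    and fin: "finite S" "finite S'"
  shows "card (frontier_verts H S') \<le>
    (1 + d) * card (sym_diff S S') + card ({u \<in> S. neighbours G u \<noteq> neighbours H u} \<union> frontier_verts G S)"
    (is "_ \<le> _ + card ?B")
proof -
  let ?D = "sym_diff S S'"
  have fin': "finite ?D" "finite ?B" using fin by (auto simp: frontier_verts_def)
  have "frontier_verts H S' \<subseteq> ?D \<union> (\<Union>w\<in>?D. neighbours H w) \<union> ?B"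
  proof
    fix v assume "v \<in> frontier_verts H S'"
    then obtain w where w: "v \<in> S'" "w \<notin> S'" "w \<in> neighbours H v" by (auto simp: frontier_verts_def neighbours_def)
    show "v \<in> ?D \<union> (\<Union>w\<in>?D. neighbours H w) \<union> ?B"
    proof (cases "v \<in> S \<and> neighbours G v = neighbours H v \<and> w \<notin> S")
      case True
      then have "w \<in> neighbours G v" using w by simp
      then have "v \<in> frontier_verts G S"
        using True graph_neighbours_subset[OF G, of v] by (auto simp: frontier_verts_def neighbours_def)
      then show ?thesis by blast
    next
      case False
      then show ?thesis using w neighbours_commute[of v H w] by blast
    qed
  qed
  then have "card (frontier_verts H S') \<le> card (?D \<union> (\<Union>w\<in>?D. neighbours H w) \<union> ?B)"
    using fin' finite_neighbours[OF H] by (intro card_mono) auto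
  also have "\<dots> \<le> card ?D + card (\<Union>w\<in>?D. neighbours H w) + card ?B"
    by (meson add_le_mono1 card_Un_le order_trans)
  also have "card (\<Union>w\<in>?D. neighbours H w) \<le> (\<Sum>w\<in>?D. card (neighbours H w))"
    by (rule card_UN_le) (rule fin')
  also have "\<dots> \<le> card ?D * d" using sum_bounded_above[of ?D "\<lambda>w. card (neighbours H w)" d] d by simp
  finally show ?thesis by (simp add: algebra_simps)
qed


text \<open>Every quantity changes by at most a constant times \<delta> + \<beta>, where \<delta>
  counts the change of the exhaustion and \<beta> the changed or frontier vertices. Both are
  negligible against the size of \<open>K n\<close>.\<close>

lemma walk_moments_perturb:
  assumes wm: "walk_moments G K m" and H: "graph H" and fin': "\<And>n. finite (K' n)"
    and close: "(\<lambda>n. real (card (sym_diff (K n) (K' n))) / real (card (K n))) \<longlonglongrightarrow> 0"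
    and bad: "(\<lambda>n. real (card {u \<in> K n. neighbours G u \<noteq> neighbours H u}) / real (card (K n))) \<longlonglongrightarrow> 0"
  shows "walk_moments H K' m"
proof -
  from wm have G: "graph G" and fin: "\<And>n. finite (K n)"
    and inf: "filterlim (\<lambda>n. real (card (K n))) at_top sequentially"
    and fr: "(\<lambda>n. real (card (frontier_verts G (K n))) / real (card (K n))) \<longlonglongrightarrow> 0"
    and mom: "\<And>k. (\<lambda>n. (\<Sum>v\<in>K n. walks G k v v) / real (card (K n))) \<longlonglongrightarrow> m k"
    by (auto simp: walk_moments_def)
  obtain d1 where d1: "\<And>v. card (neighbours G v) \<le> d1" using graph_degree_bound[OF G] by metis
  obtain d2 where d2: "\<And>v. card (neighbours H v) \<le> d2" using graph_degree_bound[OF H] by metis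
  define d where "d = max d1 d2"
  have dG: "card (neighbours G v) \<le> d" and dH: "card (neighbours H v) \<le> d" for v
    using d1[of v] d2[of v] by (auto simp: d_def)
  define a b where "a n = real (card (K n))" and "b n = real (card (K' n))" for n
  define \<delta> where "\<delta> n = real (card (sym_diff (K n) (K' n)))" for n
  define \<beta> where "\<beta> n = real (card ({u \<in> K n. neighbours G u \<noteq> neighbours H u} \<union> frontier_verts G (K n)))" for n
  have \<delta>: "(\<lambda>n. \<delta> n / a n) \<longlonglongrightarrow> 0" using close by (simp add: \<delta>_def a_def)
  have \<beta>: "(\<lambda>n. \<beta> n / a n) \<longlonglongrightarrow> 0"
  proof (rule tendsto_ratio_zero[where C = 1])
    show "(\<lambda>n. real (card {u \<in> K n. neighbours G u \<noteq> neighbours H u}) / a n +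
      real (card (frontier_verts G (K n))) / a n) \<longlonglongrightarrow> 0"
      using tendsto_add[OF bad fr] by (simp add: a_def)
    have "\<beta> n \<le> real (card {u \<in> K n. neighbours G u \<noteq> neighbours H u}) + real (card (frontier_verts G (K n)))" for n
      unfolding \<beta>_def of_nat_add[symmetric] of_nat_le_iff by (rule card_Un_le)
    then show "\<bar>\<beta> n / a n\<bar> \<le> 1 * (real (card {u \<in> K n. neighbours G u \<noteq> neighbours H u}) / a n +
      real (card (frontier_verts G (K n))) / a n)" for n
      by (simp add: \<beta>_def a_def add_divide_distrib[symmetric] divide_right_mono)
  qed
  have a_pos: "\<forall>\<^sub>F n in sequentially. a n > 0"
    using inf unfolding a_def filterlim_at_top_dense by blast
  \<comment> \<open>Because the sizes of K' n and K n are asymptotically equal, the remaining limits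
    can be computed with the old denominator (\<open>rescale\<close>).\<close>
  have ba: "(\<lambda>n. b n / a n) \<longlonglongrightarrow> 1"
  proof -
    have "(\<lambda>n. (b n - a n) / a n) \<longlonglongrightarrow> 0"
    proof (rule tendsto_ratio_zero[OF \<delta>, where C = 1])
      have "\<bar>a n - b n\<bar> \<le> \<delta> n" for n
        using sum_diff_sym_diff_le[OF fin[of n] fin'[of n], of "\<lambda>_. 1" 1] by (simp add: a_def b_def \<delta>_def)
      then show "\<bar>(b n - a n) / a n\<bar> \<le> 1 * (\<delta> n / a n)" for n
        by (simp add: abs_minus_commute a_def divide_right_mono)
    qed
    then have "(\<lambda>n. (b n - a n) / a n + 1) \<longlonglongrightarrow> 0 + 1" by (intro tendsto_intros)
    moreover have "\<forall>\<^sub>F n in sequentially. (b n - a n) / a n + 1 = b n / a n"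
      by (rule eventually_mono[OF a_pos]) (simp add: field_simps)
    ultimately show ?thesis by (simp add: filterlim_cong)
  qed
  have rescale: "(\<lambda>n. x n / b n) \<longlonglongrightarrow> l" if "(\<lambda>n. x n / a n) \<longlonglongrightarrow> l" for x l
  proof -
    have "(\<lambda>n. (x n / a n) / (b n / a n)) \<longlonglongrightarrow> l / 1" by (intro tendsto_divide that ba) simp
    moreover have "\<forall>\<^sub>F n in sequentially. (x n / a n) / (b n / a n) = x n / b n"
      by (rule eventually_mono[OF a_pos]) simp
    ultimately show ?thesis using Lim_transform_eventually by fastforce
  qed
  have "filterlim b at_top sequentially"
  proof -
    have "filterlim (\<lambda>n. (b n / a n) * a n) at_top sequentially"
      by (rule filterlim_tendsto_pos_mult_at_top[OF ba]) (use inf in \<open>auto simp: a_def[abs_def]\<close>)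
    moreover have "\<forall>\<^sub>F n in sequentially. (b n / a n) * a n = b n"
      by (rule eventually_mono[OF a_pos]) simp
    ultimately show ?thesis by (simp add: filterlim_cong)
  qed
  moreover have "(\<lambda>n. real (card (frontier_verts H (K' n))) / b n) \<longlonglongrightarrow> 0"
  proof (rule rescale, rule tendsto_ratio_zero[where C = 1])
    show "(\<lambda>n. (1 + real d) * (\<delta> n / a n) + \<beta> n / a n) \<longlonglongrightarrow> 0"
      using tendsto_add[OF tendsto_mult_right_zero[OF \<delta>, of "1 + real d"] \<beta>] by simp
    fix n
    have "real (card (frontier_verts H (K' n))) \<le> real ((1 + d) * card (sym_diff (K n) (K' n)) +
        card ({u \<in> K n. neighbours G u \<noteq> neighbours H u} \<union> frontier_verts G (K n)))"
      unfolding of_nat_le_iff by (rule card_frontier_verts_perturbed_le[OF G H dH fin fin'])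
    then have "real (card (frontier_verts H (K' n))) \<le> (1 + real d) * \<delta> n + \<beta> n"
      unfolding \<delta>_def \<beta>_def by (simp add: distrib_right)
    then show "\<bar>real (card (frontier_verts H (K' n))) / a n\<bar> \<le> 1 * ((1 + real d) * (\<delta> n / a n) + \<beta> n / a n)"
      by (simp add: a_def add_divide_distrib[symmetric] divide_right_mono)
  qed
  moreover have "(\<lambda>n. (\<Sum>v\<in>K' n. walks H k v v) / b n) \<longlonglongrightarrow> m k" for k
  proof (rule rescale)
    \<comment> \<open>Each affected vertex changes the sum by at most d^k, and the geometric sum is
      the factor from \<open>card_walks_changed_le\<close>.\<close>
    define c where "c = real d ^ k * real (\<Sum>i<k. d ^ i)"
    have wG: "\<bar>walks G k u v\<bar> \<le> real d ^ k" and wH: "\<bar>walks H k u v\<bar> \<le> real d ^ k" for u v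
      using walks_nonneg[of _ k u v] walks_le[OF dG, of k u v] walks_le[OF dH, of k u v] by auto
    have "(\<lambda>n. ((\<Sum>v\<in>K' n. walks H k v v) - (\<Sum>v\<in>K n. walks G k v v)) / a n) \<longlonglongrightarrow> 0"
    proof (rule tendsto_ratio_zero[where C = 1])
      show "(\<lambda>n. real d ^ k * (\<delta> n / a n) + c * (\<beta> n / a n)) \<longlonglongrightarrow> 0"
        using tendsto_add[OF tendsto_mult_right_zero[OF \<delta>, of "real d ^ k"] tendsto_mult_right_zero[OF \<beta>, of c]] by simp
      fix n
      let ?A = "{u \<in> K n. \<exists>v. walks G k u v \<noteq> walks H k u v}"
      have "(\<Sum>v\<in>K n. walks G k v v) - (\<Sum>v\<in>K n. walks H k v v) = (\<Sum>v\<in>?A. walks G k v v - walks H k v v)"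
        unfolding sum_subtractf[symmetric] by (rule sum.mono_neutral_right) (use fin in auto)
      also have "\<bar>\<dots>\<bar> \<le> (\<Sum>v\<in>?A. \<bar>walks G k v v - walks H k v v\<bar>)" by (rule sum_abs)
      also have "\<dots> \<le> card ?A * real d ^ k"
      proof (rule sum_bounded_above)
        fix u
        show "\<bar>walks G k u u - walks H k u u\<bar> \<le> real d ^ k"
          using walks_nonneg[of G k u u] walks_nonneg[of H k u u] walks_le[OF dG, of k u u] walks_le[OF dH, of k u u]
          by linarith
      qed
      also have "\<dots> \<le> real ((\<Sum>i<k. d ^ i) * card ({u \<in> K n. neighbours G u \<noteq> neighbours H u} \<union> frontier_verts G (K n))) * real d ^ k"
        by (intro mult_right_mono) (use card_walks_changed_le[OF G H dG fin] in \<open>auto simp only: of_nat_le_iff zero_le_power of_nat_0_le_iff\<close>)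
      also have "\<dots> = c * \<beta> n" by (simp only: c_def \<beta>_def of_nat_mult mult_ac)
      finally have "\<bar>(\<Sum>v\<in>K n. walks G k v v) - (\<Sum>v\<in>K n. walks H k v v)\<bar> \<le> c * \<beta> n" .
      moreover have "\<bar>(\<Sum>v\<in>K n. walks H k v v) - (\<Sum>v\<in>K' n. walks H k v v)\<bar> \<le> real d ^ k * \<delta> n"
        unfolding \<delta>_def by (rule sum_diff_sym_diff_le[OF fin fin' wH])
      ultimately have "\<bar>(\<Sum>v\<in>K' n. walks H k v v) - (\<Sum>v\<in>K n. walks G k v v)\<bar> \<le> real d ^ k * \<delta> n + c * \<beta> n"
        by linarith
      then show "\<bar>((\<Sum>v\<in>K' n. walks H k v v) - (\<Sum>v\<in>K n. walks G k v v)) / a n\<bar> \<le>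
          1 * (real d ^ k * (\<delta> n / a n) + c * (\<beta> n / a n))"
        by (simp add: a_def add_divide_distrib[symmetric] divide_right_mono)
    qed
    from tendsto_add[OF this mom[of k]] show "(\<lambda>n. (\<Sum>v\<in>K' n. walks H k v v) / a n) \<longlonglongrightarrow> m k"
      by (simp add: a_def add_divide_distrib[symmetric])
  qed
  ultimately show ?thesis
    using H fin' by (simp add: walk_moments_def b_def[abs_def])
qed

text \<open>All changes happen inside fixed finite sets, while the size of \<open>K n\<close> tends
  to infinity. A vertex with changed neighbourhood lies on one of the finitely many changed
  edges.\<close>

lemma walk_moments_finite_perturbation:
  assumes wm: "walk_moments G K m" and P: "finite_perturbation G H" and K: "\<And>n. K n \<subseteq> verts G"
  shows "walk_moments H (modified_exhaustion G K H) m"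
proof (rule walk_moments_perturb[OF wm])
  from wm have G: "graph G" and fin: "\<And>n. finite (K n)"
    and inf: "filterlim (\<lambda>n. real (card (K n))) at_top sequentially"
    by (auto simp: walk_moments_def)
  from P show H: "graph H" by (simp add: finite_perturbation_def)
  have ratio: "(\<lambda>n. real (card (S n)) / real (card (K n))) \<longlonglongrightarrow> 0"
    if "finite T" "\<And>n. S n \<subseteq> T" for S :: "nat \<Rightarrow> 'a set" and T
  proof (rule tendsto_ratio_zero)
    show "(\<lambda>n. 1 / real (card (K n))) \<longlonglongrightarrow> 0"
      by (rule tendsto_divide_0[OF tendsto_const filterlim_at_top_imp_at_infinity[OF inf]])
    show "\<bar>real (card (S n)) / real (card (K n))\<bar> \<le> real (card T) * (1 / real (card (K n)))" for n
      using card_mono[OF that(1) that(2)[of n]] by (simp add: divide_right_mono)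
  qed
  show "finite (modified_exhaustion G K H n)" for n
    using fin[of n] P by (auto simp: modified_exhaustion_def finite_perturbation_def)
  show "(\<lambda>n. real (card (sym_diff (K n) (modified_exhaustion G K H n))) / real (card (K n))) \<longlonglongrightarrow> 0"
  proof (rule ratio)
    show "finite (sym_diff (verts G) (verts H))" using P by (simp add: finite_perturbation_def)
    show "sym_diff (K n) (modified_exhaustion G K H n) \<subseteq> sym_diff (verts G) (verts H)" for n
      using K[of n] by (auto simp: modified_exhaustion_def)
  qed
  show "(\<lambda>n. real (card {u \<in> K n. neighbours G u \<noteq> neighbours H u}) / real (card (K n))) \<longlonglongrightarrow> 0"
  proof (rule ratio)
    have "finite e" if "e \<in> edges G \<union> edges H" for e
      using G H that unfolding graph_def by blast
    then show "finite (\<Union>(sym_diff (edges G) (edges H)))"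
      using P by (auto simp: finite_perturbation_def)
    show "{u \<in> K n. neighbours G u \<noteq> neighbours H u} \<subseteq> \<Union>(sym_diff (edges G) (edges H))" for n
      by (auto simp: neighbours_def)
  qed
qed

section \<open>Invariance under relabelling of the vertices\<close>

lemma neighbours_relabel:
  assumes X: "graph X" and inj: "inj_on f (verts X)" and "u \<in> verts X"
  shows "neighbours (relabel f X) (f u) = f ` neighbours X u"
proof (intro equalityI subsetI)
  fix w assume "w \<in> neighbours (relabel f X) (f u)"
  then obtain e where e: "e \<in> edges X" "{f u, w} = f ` e" by (auto simp: neighbours_def relabel_def)
  then obtain a b where ab: "e = {a, b}" "a \<in> verts X" "b \<in> verts X" using X unfolding graph_def by blast
  with e have "(f u = f a \<and> w = f b) \<or> (f u = f b \<and> w = f a)" by (auto simp: doubleton_eq_iff)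
  then have "(u = a \<and> w = f b) \<or> (u = b \<and> w = f a)" using inj ab \<open>u \<in> verts X\<close> by (auto dest: inj_onD)
  then show "w \<in> f ` neighbours X u" using e ab by (auto simp: neighbours_def insert_commute)
next
  fix w assume "w \<in> f ` neighbours X u"
  then obtain x where x: "w = f x" "{u, x} \<in> edges X" by (auto simp: neighbours_def)
  then have "f ` {u, x} \<in> (`) f ` edges X" by (intro imageI)
  then show "w \<in> neighbours (relabel f X) (f u)" using x by (simp add: neighbours_def relabel_def)
qed

lemma graph_relabel:
  assumes X: "graph X" and inj: "inj_on f (verts X)"
  shows "graph (relabel f X)"
  unfolding graph_def
proof (intro conjI)
  show "countable (verts (relabel f X))" using X by (simp add: graph_def relabel_def)
  show "edges (relabel f X) \<subseteq> {{v, w} |v w. v \<in> verts (relabel f X) \<and> w \<in> verts (relabel f X) \<and> v \<noteq> w}"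
  proof
    fix e assume "e \<in> edges (relabel f X)"
    then obtain e' where e': "e' \<in> edges X" "e = f ` e'" by (auto simp: relabel_def)
    then obtain v w where "e' = {v, w}" "v \<in> verts X" "w \<in> verts X" "v \<noteq> w"
      using X unfolding graph_def by blast
    moreover from this have "f v \<noteq> f w" using inj by (auto dest: inj_onD)
    ultimately show "e \<in> {{v, w} |v w. v \<in> verts (relabel f X) \<and> w \<in> verts (relabel f X) \<and> v \<noteq> w}"
      using e' by (auto simp: relabel_def)
  qed
  obtain d where d: "\<And>v. finite (neighbours X v)" "\<And>v. card (neighbours X v) \<le> d"
    using graph_degree_bound[OF X] by metis
  show "\<exists>d. \<forall>v\<in>verts (relabel f X). finite (neighbours (relabel f X) v) \<and> card (neighbours (relabel f X) v) \<le> d"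
  proof (intro exI ballI)
    fix v assume "v \<in> verts (relabel f X)"
    then obtain u where "v = f u" "u \<in> verts X" by (auto simp: relabel_def)
    then show "finite (neighbours (relabel f X) v) \<and> card (neighbours (relabel f X) v) \<le> d"
      using d[of u] card_image_le[OF d(1), of f u] by (simp add: neighbours_relabel[OF X inj])
  qed
qed

text \<open>Stated as an equivalence because it is used both ways: to return to \<open>X\<close>
  from its copy over \<open>nat\<close>, and to move from \<open>X\<close> to its copy under
  \<open>Some\<close>.\<close>

lemma walk_moments_relabel:
  assumes X: "graph X" and inj: "inj_on f (verts X)" and K: "\<And>n. K n \<subseteq> verts X"
  shows "walk_moments (relabel f X) (\<lambda>n. f ` K n) m \<longleftrightarrow> walk_moments X K m"
proof -
  have injK: "inj_on f (K n)" for n using inj K by (rule inj_on_subset)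
  have "frontier_verts (relabel f X) (f ` S) = f ` frontier_verts X S" if S: "S \<subseteq> verts X" for S
  proof -
    have "f v \<in> frontier_verts (relabel f X) (f ` S) \<longleftrightarrow> v \<in> frontier_verts X S" if "v \<in> S" for v
    proof -
      have "v \<in> verts X" using S that by blast
      have mem: "f w \<in> f ` S \<longleftrightarrow> w \<in> S" if "w \<in> verts X" for w
        using inj that S by (auto dest: inj_onD)
      have "f v \<in> frontier_verts (relabel f X) (f ` S) \<longleftrightarrow>
          (\<exists>w\<in>verts (relabel f X). w \<notin> f ` S \<and> w \<in> neighbours (relabel f X) (f v))"
        using that by (auto simp: frontier_verts_def neighbours_def)
      also have "\<dots> \<longleftrightarrow> (\<exists>w\<in>neighbours X v. f w \<notin> f ` S)"
        using graph_neighbours_subset[OF X, of v] \<open>v \<in> verts X\<close>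
        by (auto simp: neighbours_relabel[OF X inj]) (auto simp: relabel_def)
      also have "\<dots> \<longleftrightarrow> (\<exists>w\<in>neighbours X v. w \<notin> S)"
        using graph_neighbours_subset[OF X, of v] mem by blast
      also have "\<dots> \<longleftrightarrow> v \<in> frontier_verts X S"
        using that graph_neighbours_subset[OF X, of v] by (auto simp: frontier_verts_def neighbours_def)
      finally show ?thesis .
    qed
    moreover have "frontier_verts (relabel f X) (f ` S) \<subseteq> f ` S" "frontier_verts X S \<subseteq> S"
      by (auto simp: frontier_verts_def)
    ultimately show ?thesis by blast
  qed
  moreover have "inj_on f (frontier_verts X (K n))" for n
    by (rule inj_on_subset[OF injK[of n]]) (auto simp: frontier_verts_def)
  ultimately have fr: "card (frontier_verts (relabel f X) (f ` K n)) = card (frontier_verts X (K n))" for n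
    using K by (simp add: card_image)
  have "(\<Sum>v\<in>f ` K n. walks (relabel f X) k v v) = (\<Sum>v\<in>K n. walks X k v v)" for n k
    unfolding sum.reindex[OF injK] comp_def
    by (rule sum.cong[OF refl], subst walks_iso[OF inj X neighbours_relabel[OF X inj]]) (use K[of n] in auto)
  then show ?thesis
    using X graph_relabel[OF X inj]
    by (simp add: walk_moments_def fr card_image[OF injK] finite_image_iff[OF injK])
qed


section \<open>Walk densities of periodic amenable graphs\<close>

lemma exhaustion_card_at_top:
  assumes K: "exhaustion X K" and inf: "infinite (verts X)"
  shows "filterlim (\<lambda>n. real (card (K n))) at_top sequentially"
  unfolding filterlim_at_top
proof
  fix Z :: real
  have mono: "incseq K" and fin: "\<And>n. finite (K n)" and un: "(\<Union>n. K n) = verts X"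
    using K by (auto simp: exhaustion_def)
  have cover: "\<exists>n. T \<subseteq> K n" if "finite T" "T \<subseteq> verts X" for T
    using that
  proof (induction T)
    case (insert x T)
    then obtain n where "T \<subseteq> K n" by auto
    moreover obtain i where "x \<in> K i" using un insert.prems by auto
    ultimately have "insert x T \<subseteq> K (max n i)" using incseqD[OF mono, of n "max n i"] incseqD[OF mono, of i "max n i"] by auto
    then show ?case by blast
  qed simp
  obtain T where T: "T \<subseteq> verts X" "finite T" "card T = nat \<lceil>Z\<rceil>"
    using infinite_arbitrarily_large[OF inf] by blast
  then obtain n0 where n0: "T \<subseteq> K n0" using cover by blast
  have "Z \<le> card (K n)" if "n \<ge> n0" for n
  proof -
    have "card T \<le> card (K n)" using n0 mono that by (intro card_mono fin) (auto dest: incseqD)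
    then show ?thesis using T(3) by linarith
  qed
  then show "\<forall>\<^sub>F n in sequentially. Z \<le> real (card (K n))"
    by (rule eventually_sequentiallyI)
qed

lemma graph_aut_walks:
  assumes X: "graph X" and \<gamma>: "\<gamma> \<in> graph_auts X" and v: "v \<in> verts X"
  shows "walks X k (\<gamma> v) (\<gamma> v) = walks X k v v"
proof (rule walks_iso[OF _ X _ v v])
  have bij: "bij_betw \<gamma> (verts X) (verts X)"
    and edge: "\<And>v w. v \<in> verts X \<Longrightarrow> w \<in> verts X \<Longrightarrow> {\<gamma> v, \<gamma> w} \<in> edges X \<longleftrightarrow> {v, w} \<in> edges X"
    using \<gamma> by (auto simp: graph_auts_def Bij_def)
  show "inj_on \<gamma> (verts X)" using bij by (rule bij_betw_imp_inj_on)
  fix u assume u: "u \<in> verts X"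
  show "neighbours X (\<gamma> u) = \<gamma> ` neighbours X u"
  proof (intro equalityI subsetI)
    fix w assume w: "w \<in> neighbours X (\<gamma> u)"
    then have "w \<in> verts X" using graph_neighbours_subset[OF X] by blast
    then obtain w' where "w = \<gamma> w'" "w' \<in> verts X" using bij by (auto simp: bij_betw_def)
    then show "w \<in> \<gamma> ` neighbours X u" using w u edge by (auto simp: neighbours_def)
  next
    fix w assume "w \<in> \<gamma> ` neighbours X u"
    then obtain w' where w': "w = \<gamma> w'" "w' \<in> neighbours X u" by blast
    then have "w' \<in> verts X" using graph_neighbours_subset[OF X] by blast
    then show "w \<in> neighbours X (\<gamma> u)" using w' u edge by (auto simp: neighbours_def)
  qed
qed

text \<open>If \<gamma> v = \<gamma>' v', the group element inverse(\<gamma>') \<gamma> takes v in F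
  to v' in F. The transversal property gives v = v', and then freeness forces this element to be the
  identity. This makes the size of E F the product of the sizes of E and F.\<close>

lemma free_action_inj_on:
  assumes \<Gamma>: "subgroup \<Gamma> (BijGroup V)"
    and free: "\<And>\<gamma> v. \<gamma> \<in> \<Gamma> \<Longrightarrow> \<gamma> \<noteq> (\<lambda>x\<in>V. x) \<Longrightarrow> v \<in> V \<Longrightarrow> \<gamma> v \<noteq> v"
    and F: "F \<subseteq> V"
    and transversal: "\<And>\<gamma> v. \<gamma> \<in> \<Gamma> \<Longrightarrow> v \<in> F \<Longrightarrow> \<gamma> v \<in> F \<Longrightarrow> \<gamma> v = v"
  shows "inj_on (\<lambda>(\<gamma>, v). \<gamma> v) (\<Gamma> \<times> F)"
proof -
  interpret B: group "BijGroup V" by (rule group_BijGroup)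
  have carr: "carrier (BijGroup V) = Bij V" by (simp add: BijGroup_def)
  have one: "\<one>\<^bsub>BijGroup V\<^esub> = (\<lambda>x\<in>V. x)" by (simp add: BijGroup_def)
  have sub: "\<Gamma> \<subseteq> Bij V" using subgroup.subset[OF \<Gamma>] carr by simp
  have "\<gamma> = \<gamma>' \<and> v = v'" if gv: "\<gamma> \<in> \<Gamma>" "\<gamma>' \<in> \<Gamma>" "v \<in> F" "v' \<in> F" "\<gamma> v = \<gamma>' v'" for \<gamma> \<gamma>' v v'
  proof -
    let ?\<delta> = "inv\<^bsub>BijGroup V\<^esub> \<gamma>' \<otimes>\<^bsub>BijGroup V\<^esub> \<gamma>"
    have \<delta>: "?\<delta> \<in> \<Gamma>" using subgroup.m_closed[OF \<Gamma> subgroup.m_inv_closed[OF \<Gamma> gv(2)] gv(1)] .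

    have b: "\<gamma> \<in> Bij V" "\<gamma>' \<in> Bij V" "inv\<^bsub>BijGroup V\<^esub> \<gamma>' \<in> Bij V"
      using gv sub subsetD[OF subgroup.subset[OF \<Gamma>] subgroup.m_inv_closed[OF \<Gamma> gv(2)]] unfolding carr by blast+
    have vV: "v \<in> V" "v' \<in> V" using gv F by auto
    have "\<gamma> v \<in> V" using Bij_imp_funcset[OF b(1)] vV(1) by (rule funcset_mem)
    have mult: "g \<otimes>\<^bsub>BijGroup V\<^esub> \<gamma> = compose V g \<gamma>" if "g \<in> Bij V" for g
      using that b(1) by (simp add: BijGroup_def)
    have "?\<delta> v = (inv\<^bsub>BijGroup V\<^esub> \<gamma>') (\<gamma> v)"
      using vV by (simp add: mult[OF b(3)] compose_def)
    also have "\<dots> = inv_into V \<gamma>' (\<gamma>' v')"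
      using \<open>\<gamma> v \<in> V\<close> gv(5) by (simp add: inv_BijGroup[OF b(2)])
    also have "\<dots> = v'" using b(2) vV by (intro inv_into_f_f) (simp_all add: Bij_def bij_betw_def)
    finally have "?\<delta> v = v'" .
    then have "v = v'" using transversal[OF \<delta> gv(3)] gv(4) by simp
    then have "?\<delta> = \<one>\<^bsub>BijGroup V\<^esub>" using free[OF \<delta> _ vV(1)] \<open>?\<delta> v = v'\<close> unfolding one by metis
    then have "\<gamma> = \<gamma>'" using B.inv_solve_left'[of "\<one>\<^bsub>BijGroup V\<^esub>" \<gamma>' \<gamma>] B.r_one[of \<gamma>'] B.one_closed b unfolding carr by simp
    with \<open>v = v'\<close> show ?thesis by simp
  qed
  then show ?thesis by (auto simp: inj_on_def)
qed

text \<open>On the translates \<open>E n\<close> F the average is exactly the mean over the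
  fundamental domain, since automorphisms preserve closed walk counts and the action is free.
  \<open>K n\<close> differs from these translates only inside its frontier, which is
  negligible.\<close>

lemma periodic_amenable_walk_moments:
  assumes "periodic_amenable X K"
  obtains m where "walk_moments X K m"
proof -
  let ?V = "verts X"
  from assms have X: "graph X" and inf: "infinite ?V" and ex: "exhaustion X K"
    and fr: "(\<lambda>n. real (card (frontier_verts X (K n))) / real (card (K n))) \<longlonglongrightarrow> 0"
    by (auto simp: periodic_amenable_def amenable_exhaustion_def)
  from assms obtain \<Gamma> F E where
    "let G = BijGroup ?V\<lparr>carrier := \<Gamma>\<rparr> in
        subgroup \<Gamma> (BijGroup ?V) \<and> \<Gamma> \<subseteq> graph_auts X \<and>
        countable \<Gamma> \<and> amenable_group G \<and>
        (\<forall>\<gamma>\<in>\<Gamma>. \<gamma> \<noteq> \<one>\<^bsub>G\<^esub> \<longrightarrow> (\<forall>v\<in>?V. \<gamma> v \<noteq> v)) \<and>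
        finite (orbits G ?V (\<lambda>\<gamma>. \<gamma>)) \<and>
        F \<subseteq> ?V \<and> (\<forall>B\<in>orbits G ?V (\<lambda>\<gamma>. \<gamma>). \<exists>!v. v \<in> F \<inter> B) \<and>
        (\<forall>n :: nat. finite (E n) \<and> E n \<subseteq> \<Gamma> \<and>
           K n - frontier_verts X (K n) \<subseteq> {\<gamma> v | \<gamma> v. \<gamma> \<in> E n \<and> v \<in> F} \<and>
           {\<gamma> v | \<gamma> v. \<gamma> \<in> E n \<and> v \<in> F} \<subseteq> K n)"
    unfolding periodic_amenable_def by (elim conjE exE) (rule that)
  note P = this[unfolded Let_def]
  have one: "\<one>\<^bsub>BijGroup ?V\<lparr>carrier := \<Gamma>\<rparr>\<^esub> = (\<lambda>x\<in>?V. x)" by (simp add: BijGroup_def)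
  have \<Gamma>: "subgroup \<Gamma> (BijGroup ?V)" "\<Gamma> \<subseteq> graph_auts X"
    and orb: "finite (orbits (BijGroup ?V\<lparr>carrier := \<Gamma>\<rparr>) ?V (\<lambda>\<gamma>. \<gamma>))"
    and F1: "F \<subseteq> ?V"
    using P by - (elim conjE, assumption)+
  have free: "\<gamma> v \<noteq> v" if "\<gamma> \<in> \<Gamma>" "\<gamma> \<noteq> (\<lambda>x\<in>?V. x)" "v \<in> ?V" for \<gamma> v
    using P that unfolding one by (elim conjE) (drule (1) bspec, simp)
  have F2: "\<exists>!v. v \<in> F \<inter> B" if "B \<in> orbits (BijGroup ?V\<lparr>carrier := \<Gamma>\<rparr>) ?V (\<lambda>\<gamma>. \<gamma>)" for B
    using P by (elim conjE) (erule bspec[OF _ that])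
  note F = F1 F2
  have E: "\<And>n. finite (E n)" "\<And>n. E n \<subseteq> \<Gamma>"
    "\<And>n. K n - frontier_verts X (K n) \<subseteq> {\<gamma> v | \<gamma> v. \<gamma> \<in> E n \<and> v \<in> F}"
    "\<And>n. {\<gamma> v | \<gamma> v. \<gamma> \<in> E n \<and> v \<in> F} \<subseteq> K n"
    using P by - (elim conjE, simp only:)+
  let ?O = "orbits (BijGroup ?V\<lparr>carrier := \<Gamma>\<rparr>) ?V (\<lambda>\<gamma>. \<gamma>)"
  have O: "?O = {{\<gamma> v | \<gamma>. \<gamma> \<in> \<Gamma>} | v. v \<in> ?V}"
    by (simp add: orbits_def orbit_def)
  have id: "(\<lambda>x\<in>?V. x) \<in> \<Gamma>" using subgroup.one_closed[OF \<Gamma>(1)] by (simp add: BijGroup_def)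
  have self: "v \<in> {\<gamma> v | \<gamma>. \<gamma> \<in> \<Gamma>}" if "v \<in> ?V" for v
    using id that by (auto intro!: exI[of _ "\<lambda>x\<in>?V. x"])
  have transversal: "\<gamma> v = v" if "\<gamma> \<in> \<Gamma>" "v \<in> F" "\<gamma> v \<in> F" for \<gamma> v
  proof -
    have "v \<in> ?V" using that F by auto
    then have "{\<gamma> v | \<gamma>. \<gamma> \<in> \<Gamma>} \<in> ?O" unfolding O by blast
    moreover have "v \<in> F \<inter> {\<gamma> v | \<gamma>. \<gamma> \<in> \<Gamma>}" "\<gamma> v \<in> F \<inter> {\<gamma> v | \<gamma>. \<gamma> \<in> \<Gamma>}"
      using self[OF \<open>v \<in> ?V\<close>] that by blast+
    ultimately show ?thesis using F(2)[of "{\<gamma> v | \<gamma>. \<gamma> \<in> \<Gamma>}"] by (metis (no_types, lifting))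
  qed
  have inj: "inj_on (\<lambda>(\<gamma>, v). \<gamma> v) (\<Gamma> \<times> F)"
    using \<Gamma>(1) free F(1) transversal by (rule free_action_inj_on)
  have finF: "finite F"
  proof (rule finite_subset)
    show "F \<subseteq> (\<lambda>B. THE v. v \<in> F \<inter> B) ` ?O"
    proof
      fix v assume v: "v \<in> F"
      then have "v \<in> ?V" using F by auto
      then have B: "{\<gamma> v | \<gamma>. \<gamma> \<in> \<Gamma>} \<in> ?O" unfolding O by blast
      have "(THE u. u \<in> F \<inter> {\<gamma> v | \<gamma>. \<gamma> \<in> \<Gamma>}) = v"
        by (rule the1_equality[OF F(2)[OF B]]) (use v self[OF \<open>v \<in> ?V\<close>] in blast)
      then show "v \<in> (\<lambda>B. THE v. v \<in> F \<inter> B) ` ?O" by (rule image_eqI[OF sym]) (rule B)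
    qed
  qed (use orb in simp)
  have "?V \<noteq> {}" using inf by auto
  then have "F \<noteq> {}" using F(2) O by blast
  then have F_pos: "real (card F) > 0" using finF by (simp add: card_gt_0_iff)
  define S where "S n = {\<gamma> v | \<gamma> v. \<gamma> \<in> E n \<and> v \<in> F}" for n
  have S: "S n = (\<lambda>(\<gamma>, v). \<gamma> v) ` (E n \<times> F)" for n by (auto simp: S_def)
  have injE: "inj_on (\<lambda>(\<gamma>, v). \<gamma> v) (E n \<times> F)" for n
    by (rule inj_on_subset[OF inj]) (use E(2) in auto)
  have finS: "finite (S n)" and cardS: "card (S n) = card (E n) * card F" for n
    unfolding S using E(1) finF by (simp_all add: card_image[OF injE] card_cartesian_product)
  have finK: "finite (K n)" for n using ex by (simp add: exhaustion_def)
  have sd: "card (sym_diff (K n) (S n)) \<le> card (frontier_verts X (K n))" for n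
    using E(3,4)[of n] finK[of n] unfolding S_def[symmetric]
    by (intro card_mono) (auto simp: frontier_verts_def)
  obtain d where d: "\<And>v. card (neighbours X v) \<le> d" using graph_degree_bound[OF X] by metis
  define c where "c k = (\<Sum>v\<in>F. walks X k v v) / card F" for k
  have sumS: "(\<Sum>v\<in>S n. walks X k v v) = c k * card (S n)" for n k
  proof -
    have "(\<Sum>v\<in>S n. walks X k v v) = (\<Sum>(\<gamma>, v)\<in>E n \<times> F. walks X k (\<gamma> v) (\<gamma> v))"
      unfolding S by (subst sum.reindex[OF injE]) (auto intro!: sum.cong)
    also have "\<dots> = (\<Sum>(\<gamma>, v)\<in>E n \<times> F. walks X k v v)"
      using E(2)[of n] \<Gamma>(2) F(1) by (intro sum.cong) (auto intro!: graph_aut_walks X)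
    also have "\<dots> = card (E n) * (\<Sum>v\<in>F. walks X k v v)"
      by (simp add: sum.cartesian_product[symmetric])
    finally show ?thesis using F_pos by (simp add: c_def cardS)
  qed
  have top: "filterlim (\<lambda>n. real (card (K n))) at_top sequentially"
    using ex inf by (rule exhaustion_card_at_top)
  have "(\<lambda>n. (\<Sum>v\<in>K n. walks X k v v) / card (K n)) \<longlonglongrightarrow> c k" for k
  proof -
    have w: "\<bar>walks X k u v\<bar> \<le> real d ^ k" for u v
      using walks_nonneg[of X k u v] walks_le[OF d, of k u v] by auto
    have "(\<lambda>n. ((\<Sum>v\<in>K n. walks X k v v) - c k * card (K n)) / card (K n)) \<longlonglongrightarrow> 0"
    proof (rule tendsto_ratio_zero[OF fr])
      fix n
      let ?s = "real (card (sym_diff (K n) (S n)))" and ?f = "real (card (frontier_verts X (K n)))"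
      have "\<bar>(\<Sum>v\<in>K n. walks X k v v) - (\<Sum>v\<in>S n. walks X k v v)\<bar> \<le> real d ^ k * ?s"
        by (rule sum_diff_sym_diff_le[OF finK finS w])
      moreover have "\<bar>(\<Sum>v\<in>K n. c k) - (\<Sum>v\<in>S n. c k)\<bar> \<le> \<bar>c k\<bar> * ?s"
        by (rule sum_diff_sym_diff_le[OF finK finS]) simp
      ultimately have "\<bar>(\<Sum>v\<in>K n. walks X k v v) - c k * card (K n)\<bar> \<le> (real d ^ k + \<bar>c k\<bar>) * ?s"
        unfolding sumS by (simp add: algebra_simps)
      also have "\<dots> \<le> (real d ^ k + \<bar>c k\<bar>) * ?f"
        using sd[of n] by (intro mult_left_mono) auto
      finally show "\<bar>((\<Sum>v\<in>K n. walks X k v v) - c k * card (K n)) / card (K n)\<bar>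
          \<le> (real d ^ k + \<bar>c k\<bar>) * (?f / card (K n))"
        by (simp add: divide_right_mono)
    qed
    then have "(\<lambda>n. ((\<Sum>v\<in>K n. walks X k v v) - c k * card (K n)) / card (K n) + c k) \<longlonglongrightarrow> 0 + c k"
      by (intro tendsto_intros)
    moreover have "\<forall>\<^sub>F n in sequentially. real (card (K n)) > 0"
      using top unfolding filterlim_at_top_dense by blast
    then have "\<forall>\<^sub>F n in sequentially. ((\<Sum>v\<in>K n. walks X k v v) - c k * card (K n)) / card (K n) + c k
        = (\<Sum>v\<in>K n. walks X k v v) / card (K n)"
      by (rule eventually_mono) (simp add: field_simps)
    ultimately show ?thesis using Lim_transform_eventually by fastforce
  qed
  then have "walk_moments X K c"
    using X finK top fr by (simp add: walk_moments_def)
  then show ?thesis by (rule that)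
qed


section \<open>The adjacency operator\<close>

text \<open>The form <A a, b> is a sum over oriented edges, and reversing the orientation exchanges
  a and b. Rewriting the iterated sum as a sum over pairs needs absolute summability; it holds
  because each vertex is the first, or the second, entry of at most d pairs.\<close>

lemma selfadjoint_adj_op:
  assumes G: "graph G" shows "selfadjoint (adj_op G)"
  unfolding selfadjoint_def
proof (intro allI)
  fix f g :: "'a ell2"
  let ?P = "Sigma UNIV (neighbours G)"
  obtain d where d: "\<And>v. finite (neighbours G v)" "\<And>v. card (neighbours G v) \<le> d"
    using graph_degree_bound[OF G] by metis
  have sq: "(\<Sum>p\<in>F. (cmod (ell2_fun h (fst p)))\<^sup>2) \<le> d * (norm h)\<^sup>2" if F: "finite F" "F \<subseteq> ?P" for F h
  proof -
    have "(\<Sum>p\<in>F. (cmod (ell2_fun h (fst p)))\<^sup>2) \<le> (\<Sum>p\<in>Sigma (fst ` F) (neighbours G). (cmod (ell2_fun h (fst p)))\<^sup>2)"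
    proof (rule sum_mono2)
      show "F \<subseteq> Sigma (fst ` F) (neighbours G)" using F(2) by force
    qed (use F d in auto)
    also have "\<dots> = (\<Sum>v\<in>fst ` F. \<Sum>w\<in>neighbours G v. (cmod (ell2_fun h v))\<^sup>2)"
      using F d by (subst sum.Sigma) (auto intro!: sum.cong)
    also have "\<dots> \<le> (\<Sum>v\<in>fst ` F. d * (cmod (ell2_fun h v))\<^sup>2)"
      using d by (intro sum_mono) (auto intro!: mult_right_mono)
    also have "\<dots> \<le> d * (norm h)\<^sup>2"
      unfolding sum_distrib_left[symmetric] using F finite_sum_le_norm_ell2[of "fst ` F" h]
      by (intro mult_left_mono) auto
    finally show ?thesis .
  qed
  have swap_P: "prod.swap ` ?P = ?P" by (force simp: neighbours_commute)
  have sq': "(\<Sum>p\<in>F. (cmod (ell2_fun h (snd p)))\<^sup>2) \<le> d * (norm h)\<^sup>2" if F: "finite F" "F \<subseteq> ?P" for F h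
  proof -
    have "(\<Sum>p\<in>F. (cmod (ell2_fun h (snd p)))\<^sup>2) = (\<Sum>p\<in>prod.swap ` F. (cmod (ell2_fun h (fst p)))\<^sup>2)"
      by (subst sum.reindex) (auto intro!: sum.cong)
    also have "\<dots> \<le> d * (norm h)\<^sup>2" using F swap_P by (intro sq) (auto simp: neighbours_commute)
    finally show ?thesis .
  qed
  have summ: "(\<lambda>(v, w). Re (ell2_fun a w * cnj (ell2_fun b v))) summable_on ?P" for a b :: "'a ell2"
  proof (rule Infinite_Sum.abs_summable_summable, rule nonneg_bdd_above_summable_on)
    show "bdd_above (sum (\<lambda>x. norm (case x of (v, w) \<Rightarrow> Re (ell2_fun a w * cnj (ell2_fun b v)))) ` {F. F \<subseteq> ?P \<and> finite F})"
    proof (rule bdd_aboveI2)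
      fix F assume F: "F \<in> {F. F \<subseteq> ?P \<and> finite F}"
      have "norm (case x of (v, w) \<Rightarrow> Re (ell2_fun a w * cnj (ell2_fun b v))) \<le>
          (cmod (ell2_fun a (snd x)))\<^sup>2 + (cmod (ell2_fun b (fst x)))\<^sup>2" for x
      proof -
        obtain v w where x: "x = (v, w)" by fastforce
        have "\<bar>Re (ell2_fun a w * cnj (ell2_fun b v))\<bar> \<le> cmod (ell2_fun a w) * cmod (ell2_fun b v)"
          using abs_Re_le_cmod[of "ell2_fun a w * cnj (ell2_fun b v)"] by (simp add: norm_mult)
        also have "\<dots> \<le> (cmod (ell2_fun a w))\<^sup>2 + (cmod (ell2_fun b v))\<^sup>2"
          using sum_squares_bound[of "cmod (ell2_fun a w)" "cmod (ell2_fun b v)"]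
            mult_nonneg_nonneg[OF norm_ge_zero norm_ge_zero, of "ell2_fun a w" "ell2_fun b v"] by linarith
        finally show ?thesis by (simp add: x)
      qed
      then have "(\<Sum>x\<in>F. norm (case x of (v, w) \<Rightarrow> Re (ell2_fun a w * cnj (ell2_fun b v)))) \<le>
          (\<Sum>x\<in>F. (cmod (ell2_fun a (snd x)))\<^sup>2) + (\<Sum>x\<in>F. (cmod (ell2_fun b (fst x)))\<^sup>2)"
        unfolding sum.distrib[symmetric] by (rule sum_mono)
      also have "\<dots> \<le> d * (norm a)\<^sup>2 + d * (norm b)\<^sup>2"
        using F by (intro add_mono sq sq') auto
      finally show "(\<Sum>x\<in>F. norm (case x of (v, w) \<Rightarrow> Re (ell2_fun a w * cnj (ell2_fun b v)))) \<le> d * (norm a)\<^sup>2 + d * (norm b)\<^sup>2" .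
    qed
  qed simp
  have form: "inner (blinfun_apply (adj_op G) a) b = infsum (\<lambda>(v, w). Re (ell2_fun a w * cnj (ell2_fun b v))) ?P" for a b :: "'a ell2"
  proof -
    have "inner (blinfun_apply (adj_op G) a) b = (\<Sum>\<^sub>\<infinity>v. \<Sum>\<^sub>\<infinity>w\<in>neighbours G v. Re (ell2_fun a w * cnj (ell2_fun b v)))"
      unfolding inner_ell2.rep_eq adj_op_apply[OF G]
      by (simp add: d sum_distrib_left sum.distrib algebra_simps)
    also have "\<dots> = infsum (\<lambda>(v, w). Re (ell2_fun a w * cnj (ell2_fun b v))) ?P"
      by (rule infsum_Sigma'_banach[OF summ])
    finally show ?thesis .
  qed
  have "bij_betw prod.swap ?P ?P" using swap_P by (auto simp: bij_betw_def)
  from infsum_reindex_bij_betw[OF this, of "\<lambda>(v, w). Re (ell2_fun f w * cnj (ell2_fun g v))"]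
  show "inner (blinfun_apply (adj_op G) f) g = inner f (blinfun_apply (adj_op G) g)"
    unfolding inner_commute[of f] form by (simp add: case_prod_unfold mult.commute)
qed

section \<open>Walk counts as diagonal entries and traces\<close>

lemma op_power_adj_op_delta:
  assumes "graph G"
  shows "ell2_fun (blinfun_apply (op_power (adj_op G) k) (delta v)) u = of_real (walks G k u v)"
  by (induction k arbitrary: u) (simp_all add: adj_op_apply[OF assms])

text \<open>The Riesz functional of the sequence m. For m i = \<open>walks G i v v\<close> it is p
  |-> <p(A) delta_v, delta_v>.\<close>

definition moment_functional :: "(nat \<Rightarrow> real) \<Rightarrow> real poly \<Rightarrow> real" where
  "moment_functional m p = (\<Sum>i\<le>degree p. coeff p i * m i)"

lemma moment_functional_eq:
  "degree p \<le> n \<Longrightarrow> moment_functional m p = (\<Sum>i\<le>n. coeff p i * m i)"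
  unfolding moment_functional_def by (rule sum.mono_neutral_left) (auto simp: coeff_eq_0)

lemma moment_functional_add: "moment_functional m (p + q) = moment_functional m p + moment_functional m q"
proof -
  let ?n = "max (degree p) (degree q)"
  have "degree (p + q) \<le> ?n" by (rule degree_add_le) auto
  then show ?thesis
    by (simp add: moment_functional_eq[of _ ?n] sum.distrib distrib_right)
qed

lemma moment_functional_smult: "moment_functional m (smult c p) = c * moment_functional m p"
  by (simp add: moment_functional_eq[OF degree_smult_le] moment_functional_def sum_distrib_left mult.assoc)

lemma poly_op_adj_op_diagonal:
  assumes "graph G"
  shows "ell2_fun (blinfun_apply (poly_op p (adj_op G)) (delta v)) v =
    of_real (moment_functional (\<lambda>i. walks G i v v) p)"
  by (simp add: poly_op_def moment_functional_def blinfun.sum_left blinfun.bilinear_simps ell2_fun_sum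
      scaleR_ell2.rep_eq op_power_adj_op_delta[OF assms])

lemma inner_poly_op_adj_op_delta:
  assumes "graph G"
  shows "inner (blinfun_apply (poly_op p (adj_op G)) (delta v)) (delta v) = moment_functional (\<lambda>i. walks G i v v) p"
  by (simp add: inner_delta_right poly_op_adj_op_diagonal[OF assms])

lemma moment_functional_walks_tendsto:
  assumes "walk_moments G K m"
  shows "(\<lambda>n. (\<Sum>v\<in>K n. moment_functional (\<lambda>i. walks G i v v) p) / card (K n)) \<longlonglongrightarrow> moment_functional m p"
proof -
  have "(\<Sum>v\<in>K n. moment_functional (\<lambda>i. walks G i v v) p) / card (K n) =
      (\<Sum>i\<le>degree p. coeff p i * ((\<Sum>v\<in>K n. walks G i v v) / card (K n)))" for n
    unfolding moment_functional_def by (subst sum.swap) (simp add: sum_divide_distrib sum_distrib_left)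
  moreover have "(\<lambda>n. \<Sum>i\<le>degree p. coeff p i * ((\<Sum>v\<in>K n. walks G i v v) / card (K n))) \<longlonglongrightarrow> moment_functional m p"
    unfolding moment_functional_def using assms by (intro tendsto_intros) (auto simp: walk_moments_def)
  ultimately show ?thesis by simp
qed

lemma walk_moments_card_pos:
  assumes "walk_moments G K m" shows "\<forall>\<^sub>F n in sequentially. card (K n) > 0"
proof -
  have "\<forall>\<^sub>F n in sequentially. real (card (K n)) > 0"
    using assms unfolding walk_moments_def filterlim_at_top_dense by blast
  then show ?thesis by simp
qed

lemma op_trace_proj:
  assumes "finite S"
  shows "op_trace (T o\<^sub>L proj_op S) = (\<Sum>v\<in>S. ell2_fun (blinfun_apply T (delta v)) v)"
proof -
  have P: "blinfun_apply (proj_op S) (delta v) = (if v \<in> S then delta v else 0)" for v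
    by (auto simp: ell2_fun_inject[symmetric] fun_eq_iff proj_op_apply zero_ell2.rep_eq)
  have "op_trace (T o\<^sub>L proj_op S) = (\<Sum>\<^sub>\<infinity>v\<in>S. ell2_fun (blinfun_apply T (delta v)) v)"
    unfolding op_trace_def by (rule infsum_cong_neutral) (auto simp: P zero_ell2.rep_eq)
  then show ?thesis using assms by simp
qed

text \<open>By symmetry the diagonal entry of D^2 at v is the squared norm of the column D delta_v,
  whose entries are 1 or -1 on the symmetric difference of the two neighbourhoods and 0
  elsewhere.\<close>

lemma op_trace_sq_adj_op_diff:
  assumes X: "graph X" and Y: "graph Y" and S: "finite S"
  shows "op_trace ((adj_op X - adj_op Y) o\<^sub>L (adj_op X - adj_op Y) o\<^sub>L proj_op S) =
    of_nat (\<Sum>v\<in>S. card (sym_diff (neighbours X v) (neighbours Y v)))"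
proof -
  let ?D = "adj_op X - adj_op Y"
  have D: "ell2_fun (blinfun_apply ?D f) v = (\<Sum>w\<in>neighbours X v. ell2_fun f w) - (\<Sum>w\<in>neighbours Y v. ell2_fun f w)" for f v
    by (simp add: blinfun.bilinear_simps minus_ell2.rep_eq adj_op_apply[OF X] adj_op_apply[OF Y])
  have fin: "finite (neighbours X v)" "finite (neighbours Y v)" for v
    using X Y by (auto intro: finite_neighbours)
  have col: "ell2_fun (blinfun_apply ?D (delta v)) w =
      (if w \<in> neighbours X v then 1 else 0) - (if w \<in> neighbours Y v then 1 else 0)" for v w
    by (simp add: D fin) (auto simp: neighbours_commute)
  have "ell2_fun (blinfun_apply ?D (blinfun_apply ?D (delta v))) v = of_nat (card (sym_diff (neighbours X v) (neighbours Y v)))" for v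
  proof -
    let ?A = "neighbours X v" and ?B = "neighbours Y v"
    have "ell2_fun (blinfun_apply ?D (blinfun_apply ?D (delta v))) v =
        (\<Sum>w\<in>?A. 1 - (if w \<in> ?B then 1 else 0)) - (\<Sum>w\<in>?B. (if w \<in> ?A then 1 else 0) - (1::complex))"
      unfolding D[of "blinfun_apply ?D (delta v)"] col by (simp cong: sum.cong)
    also have "(\<Sum>w\<in>?A. 1 - (if w \<in> ?B then 1 else 0)) = (\<Sum>w\<in>?A - ?B. 1 :: complex)"
      by (rule sum.mono_neutral_cong_right) (auto simp: fin)
    also have "(\<Sum>w\<in>?B. (if w \<in> ?A then 1 else 0) - 1) = (\<Sum>w\<in>?B - ?A. - 1 :: complex)"
      by (rule sum.mono_neutral_cong_right) (auto simp: fin)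
    finally show ?thesis by (subst card_Un_disjoint) (auto simp: fin)
  qed
  then show ?thesis using S by (simp add: op_trace_proj)
qed

text \<open>A vertex whose neighbourhood changes contributes at least 1 to the trace, so the trace
  condition bounds the number of such vertices.\<close>

lemma walk_moments_density_zero_perturbation:
  assumes wm: "walk_moments G K m" and P: "density_zero_perturbation G K H"
  shows "walk_moments H K m"
proof (rule walk_moments_perturb[OF wm])
  from wm have G: "graph G" and fin: "\<And>n. finite (K n)" by (auto simp: walk_moments_def)
  from P show H: "graph H" by (simp add: density_zero_perturbation_def)
  let ?s = "\<lambda>n. \<Sum>v\<in>K n. card (sym_diff (neighbours G v) (neighbours H v))"
  have "(\<lambda>n. of_real (real (?s n) / real (card (K n))) :: complex) \<longlonglongrightarrow> of_real 0"
    using P by (simp add: density_zero_perturbation_def op_trace_sq_adj_op_diff[OF G H fin])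
  then have "(\<lambda>n. real (?s n) / real (card (K n))) \<longlonglongrightarrow> 0"
    by (simp only: tendsto_of_real_iff)
  then show "(\<lambda>n. real (card {u \<in> K n. neighbours G u \<noteq> neighbours H u}) / real (card (K n))) \<longlonglongrightarrow> 0"
  proof (rule tendsto_ratio_zero)
    fix n
    have "card {u \<in> K n. neighbours G u \<noteq> neighbours H u} = (\<Sum>v | v \<in> K n \<and> neighbours G v \<noteq> neighbours H v. 1)"
      by simp
    also have "\<dots> \<le> (\<Sum>v | v \<in> K n \<and> neighbours G v \<noteq> neighbours H v. card (sym_diff (neighbours G v) (neighbours H v)))"
    proof (rule sum_mono)
      fix v assume "v \<in> {v \<in> K n. neighbours G v \<noteq> neighbours H v}"
      then have "sym_diff (neighbours G v) (neighbours H v) \<noteq> {}" by blast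
      then have "card (sym_diff (neighbours G v) (neighbours H v)) > 0"
        using finite_neighbours[OF G] finite_neighbours[OF H] by (simp add: card_gt_0_iff)
      then show "1 \<le> card (sym_diff (neighbours G v) (neighbours H v))" by simp
    qed
    also have "\<dots> \<le> ?s n" by (rule sum_mono2) (use fin in auto)
    finally show "\<bar>real (card {u \<in> K n. neighbours G u \<noteq> neighbours H u}) / real (card (K n))\<bar> \<le> 1 * (real (?s n) / real (card (K n)))"
      by (simp add: divide_right_mono del: of_nat_sum)
  qed
qed (use wm in \<open>auto simp: walk_moments_def\<close>)

text \<open>The two alternatives chain the same two stability results in opposite orders. Everything
  takes place over \<open>nat\<close> and is carried back to \<open>X\<close> at the end.\<close>

lemma essentially_periodic_walk_moments:
  assumes "essentially_periodic X K"
  obtains m where "graph X" "\<And>n. K n \<subseteq> verts X" "walk_moments X K m"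
proof -
  from assms obtain f :: "'a \<Rightarrow> nat" and Z L Y where X: "graph X" and inj: "inj_on f (verts X)"
    and per: "periodic_amenable Z L" and K: "\<And>n. K n \<subseteq> verts X"
    and cases: "density_zero_perturbation Z L Y \<and> finite_perturbation Y (relabel f X) \<and>
           (\<forall>n. f ` K n = modified_exhaustion Y L (relabel f X) n)
         \<or> finite_perturbation Z Y \<and>
           density_zero_perturbation Y (modified_exhaustion Z L Y) (relabel f X) \<and>
           (\<forall>n. f ` K n = modified_exhaustion Z L Y n)"
    unfolding essentially_periodic_def by blast
  obtain m where m: "walk_moments Z L m" using periodic_amenable_walk_moments[OF per] by metis
  have L: "L n \<subseteq> verts Z" for n
    using per by (auto simp: periodic_amenable_def amenable_exhaustion_def exhaustion_def)
  from cases have "walk_moments (relabel f X) (\<lambda>n. f ` K n) m"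
  proof
    assume A: "density_zero_perturbation Z L Y \<and> finite_perturbation Y (relabel f X) \<and>
           (\<forall>n. f ` K n = modified_exhaustion Y L (relabel f X) n)"
    then have "walk_moments Y L m" using walk_moments_density_zero_perturbation[OF m] by blast
    moreover have "L n \<subseteq> verts Y" for n using A L by (simp add: density_zero_perturbation_def)
    ultimately have "walk_moments (relabel f X) (modified_exhaustion Y L (relabel f X)) m"
      using A by (intro walk_moments_finite_perturbation) auto
    moreover have "(\<lambda>n. f ` K n) = modified_exhaustion Y L (relabel f X)" using A by auto
    ultimately show ?thesis by simp
  next
    assume A: "finite_perturbation Z Y \<and> density_zero_perturbation Y (modified_exhaustion Z L Y) (relabel f X) \<and>
           (\<forall>n. f ` K n = modified_exhaustion Z L Y n)"
    then have "walk_moments Y (modified_exhaustion Z L Y) m"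
      using walk_moments_finite_perturbation[OF m _ L] by blast
    then have "walk_moments (relabel f X) (modified_exhaustion Z L Y) m"
      using A walk_moments_density_zero_perturbation by blast
    moreover have "(\<lambda>n. f ` K n) = modified_exhaustion Z L Y" using A by auto
    ultimately show ?thesis by simp
  qed
  then have "walk_moments X K m" by (simp add: walk_moments_relabel[OF X inj K])
  then show ?thesis using that X K by blast
qed

text \<open>For a polynomial that is nonnegative on the interval, p(A) is a positive operator, so
  its diagonal entries are nonnegative. Averaging and passing to the limit preserve this; the
  normalisation is the single walk of length 0.\<close>

lemma spectral_measure_exists:
  assumes wm: "walk_moments G K m"
  obtains \<nu> where "real_distribution \<nu>" "AE t in \<nu>. \<bar>t\<bar> \<le> norm (adj_op G)"
    "\<And>p. (\<integral>t. poly p t \<partial>\<nu>) = moment_functional m p"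
proof (rule moment_problem_symmetric_interval[of "moment_functional m" "norm (adj_op G)"])
  from wm have G: "graph G" by (simp add: walk_moments_def)
  show "0 \<le> moment_functional m p" if p: "\<And>t. \<bar>t\<bar> \<le> norm (adj_op G) \<Longrightarrow> 0 \<le> poly p t" for p
  proof (rule LIMSEQ_le_const[OF moment_functional_walks_tendsto[OF wm]])
    have "0 \<le> moment_functional (\<lambda>i. walks G i v v) p" for v
      unfolding inner_poly_op_adj_op_delta[OF G, symmetric]
      by (rule poly_op_nonneg[OF selfadjoint_adj_op[OF G] p])
    then show "\<exists>N. \<forall>n\<ge>N. 0 \<le> (\<Sum>v\<in>K n. moment_functional (\<lambda>i. walks G i v v) p) / card (K n)"
      by (intro exI allI impI divide_nonneg_nonneg sum_nonneg) auto
  qed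
  show "moment_functional m 1 = 1"
  proof (rule LIMSEQ_unique[OF moment_functional_walks_tendsto[OF wm]])
    show "(\<lambda>n. (\<Sum>v\<in>K n. moment_functional (\<lambda>i. walks G i v v) 1) / card (K n)) \<longlonglongrightarrow> 1"
      by (rule tendsto_eventually, rule eventually_mono[OF walk_moments_card_pos[OF wm]])
        (simp add: moment_functional_def)
  qed
qed (auto simp: moment_functional_add moment_functional_smult intro: that)


section \<open>The density of states\<close>

lemma poly_approximation:
  fixes \<phi> :: "real \<Rightarrow> real"
  assumes "continuous_on UNIV \<phi>" "e > 0"
  obtains p :: "real poly" where "\<And>t. \<bar>t\<bar> \<le> R \<Longrightarrow> \<bar>\<phi> t - poly p t\<bar> < e"
proof -
  have "continuous_on {-R..R} \<phi>" using assms(1) continuous_on_subset by blast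
  then obtain g where g: "real_polynomial_function g" "\<And>t. t \<in> {-R..R} \<Longrightarrow> \<bar>\<phi> t - g t\<bar> < e"
    using Stone_Weierstrass_real_polynomial_function[of "{-R..R}" \<phi> e] assms(2) by auto
  then obtain a n where "g = (\<lambda>x. \<Sum>i\<le>n. a i * x ^ i)" unfolding real_polynomial_function_iff_sum by blast
  then have "g t = poly (\<Sum>i\<le>n. monom (a i) i) t" for t
    by (simp add: poly_sum poly_monom)
  with g(2) show ?thesis by (intro that[of "\<Sum>i\<le>n. monom (a i) i"]) (auto simp: abs_le_iff)
qed

text \<open>By \<open>norm_poly_op_le\<close>, uniformly close polynomials give operators close in
  norm. So approximating sequences are Cauchy and all have the same limit.\<close>

lemma fun_calc_tendsto:
  assumes T: "selfadjoint T" and \<phi>: "continuous_on UNIV \<phi>"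
    and q: "uniform_limit {- norm T..norm T} (\<lambda>n. poly (q n)) \<phi> sequentially"
  shows "(\<lambda>n. poly_op (q n) T) \<longlonglongrightarrow> fun_calc \<phi> T"
proof -
  let ?I = "{- norm T..norm T}"
  have diff_le: "norm (poly_op p T - poly_op p' T) \<le> e + e'"
    if "\<And>t. t \<in> ?I \<Longrightarrow> \<bar>\<phi> t - poly p t\<bar> < e" "\<And>t. t \<in> ?I \<Longrightarrow> \<bar>\<phi> t - poly p' t\<bar> < e'" for p p' e e'
    unfolding poly_op_diff[symmetric]
  proof (rule norm_poly_op_le[OF T])
    fix t assume "\<bar>t\<bar> \<le> norm T"
    then have "t \<in> ?I" by auto
    from that(1)[OF this] that(2)[OF this] show "\<bar>poly (p - p') t\<bar> \<le> e + e'" by simp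
  qed
  have unif: "\<forall>\<^sub>F n in sequentially. \<forall>t\<in>?I. \<bar>\<phi> t - poly (r n) t\<bar> < e"
    if "uniform_limit ?I (\<lambda>n. poly (r n)) \<phi> sequentially" "e > 0" for r :: "nat \<Rightarrow> real poly" and e
    using uniform_limitD[OF that] by (simp add: dist_real_def abs_minus_commute)
  have "\<exists>p :: real poly. \<forall>t\<in>?I. \<bar>\<phi> t - poly p t\<bar> < inverse (real (Suc n))" for n
    using poly_approximation[OF \<phi>, of "inverse (real (Suc n))" "norm T"]
    by (metis abs_le_iff atLeastAtMost_iff inverse_positive_iff_positive minus_le_iff of_nat_0_less_iff zero_less_Suc)
  then obtain p :: "nat \<Rightarrow> real poly"
    where p: "\<And>n t. t \<in> ?I \<Longrightarrow> \<bar>\<phi> t - poly (p n) t\<bar> < inverse (real (Suc n))" by metis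
  have p_unif: "uniform_limit ?I (\<lambda>n. poly (p n)) \<phi> sequentially"
  proof (rule uniform_limitI)
    fix e :: real assume "e > 0"
    then have "\<forall>\<^sub>F n in sequentially. inverse (real (Suc n)) < e"
      using LIMSEQ_inverse_real_of_nat by (rule order_tendstoD(2)[rotated])
    then show "\<forall>\<^sub>F n in sequentially. \<forall>t\<in>?I. dist (poly (p n) t) (\<phi> t) < e"
    proof (rule eventually_mono, intro ballI)
      fix n t assume "inverse (real (Suc n)) < e" "t \<in> ?I"
      then show "dist (poly (p n) t) (\<phi> t) < e"
        using p[of t n] unfolding dist_real_def by linarith
    qed
  qed
  have "Cauchy (\<lambda>n. poly_op (p n) T)"
  proof (rule metric_CauchyI)
    fix e :: real assume "e > 0"
    then obtain N where N: "\<And>n. n \<ge> N \<Longrightarrow> \<forall>t\<in>?I. \<bar>\<phi> t - poly (p n) t\<bar> < e / 3"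
      using unif[OF p_unif, of "e/3"] by (auto simp: eventually_sequentially)
    have "dist (poly_op (p m) T) (poly_op (p n) T) < e" if "m \<ge> N" "n \<ge> N" for m n
      using diff_le[of "p m" "e/3" "p n" "e/3"] N[OF that(1)] N[OF that(2)] \<open>e > 0\<close>
      by (simp add: dist_norm)
    then show "\<exists>M. \<forall>m\<ge>M. \<forall>n\<ge>M. dist (poly_op (p m) T) (poly_op (p n) T) < e" by blast
  qed
  then obtain S where S: "(\<lambda>n. poly_op (p n) T) \<longlonglongrightarrow> S"
    using Cauchy_convergent_iff convergent_def by blast
  have conv: "(\<lambda>n. poly_op (r n) T) \<longlonglongrightarrow> S"
    if r: "uniform_limit ?I (\<lambda>n. poly (r n)) \<phi> sequentially" for r :: "nat \<Rightarrow> real poly"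
  proof -
    have "(\<lambda>n. poly_op (r n) T - poly_op (p n) T) \<longlonglongrightarrow> 0"
    proof (rule tendstoI)
      fix e :: real assume "e > 0"
      then have "e / 3 > 0" by simp
      from unif[OF r this] unif[OF p_unif this]
      show "\<forall>\<^sub>F n in sequentially. dist (poly_op (r n) T - poly_op (p n) T) 0 < e"
      proof eventually_elim
        case (elim n)
        then show ?case using diff_le[of "r n" "e/3" "p n" "e/3"] \<open>e > 0\<close> by simp
      qed
    qed
    from tendsto_add[OF this S] show ?thesis by simp
  qed
  \<comment> \<open>Uniqueness uses the sequence \<open>p\<close> constructed above: without any
    approximating sequence the defining condition would hold for every operator.\<close>
  have "fun_calc \<phi> T = S"
    unfolding fun_calc_def
  proof (rule the_equality)
    show "\<forall>p. uniform_limit ?I (\<lambda>n. poly (p n)) \<phi> sequentially \<longrightarrow> (\<lambda>n. poly_op (p n) T) \<longlonglongrightarrow> S"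
      using conv by blast
    fix S' assume "\<forall>p. uniform_limit ?I (\<lambda>n. poly (p n)) \<phi> sequentially \<longrightarrow> (\<lambda>n. poly_op (p n) T) \<longlonglongrightarrow> S'"
    then show "S' = S" using p_unif S LIMSEQ_unique by blast
  qed
  with conv[OF q] show ?thesis by simp
qed

lemma norm_fun_calc_diff_le:
  assumes T: "selfadjoint T" and \<phi>: "continuous_on UNIV \<phi>"
    and p: "\<And>t. \<bar>t\<bar> \<le> norm T \<Longrightarrow> \<bar>\<phi> t - poly p t\<bar> \<le> e"
  shows "norm (fun_calc \<phi> T - poly_op p T) \<le> e"
proof -
  have "\<exists>q :: real poly. \<forall>t. \<bar>t\<bar> \<le> norm T \<longrightarrow> \<bar>\<phi> t - poly q t\<bar> < inverse (real (Suc n))" for n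
    by (rule poly_approximation[OF \<phi>, of "inverse (real (Suc n))" "norm T"]) auto
  then obtain q :: "nat \<Rightarrow> real poly"
    where q: "\<And>n t. \<bar>t\<bar> \<le> norm T \<Longrightarrow> \<bar>\<phi> t - poly (q n) t\<bar> < inverse (real (Suc n))" by metis
  have "uniform_limit {- norm T..norm T} (\<lambda>n. poly (q n)) \<phi> sequentially"
  proof (rule uniform_limitI)
    fix e :: real assume "e > 0"
    then have "\<forall>\<^sub>F n in sequentially. inverse (real (Suc n)) < e"
      using LIMSEQ_inverse_real_of_nat by (rule order_tendstoD(2)[rotated])
    then show "\<forall>\<^sub>F n in sequentially. \<forall>t\<in>{- norm T..norm T}. dist (poly (q n) t) (\<phi> t) < e"
    proof (rule eventually_mono, intro ballI)
      fix n t assume "inverse (real (Suc n)) < e" "t \<in> {- norm T..norm T}"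
      then show "dist (poly (q n) t) (\<phi> t) < e"
        using q[of t n] unfolding dist_real_def by (simp add: abs_le_iff)
    qed
  qed
  from fun_calc_tendsto[OF T \<phi> this]
  have lim: "(\<lambda>n. norm (poly_op (q n) T - poly_op p T)) \<longlonglongrightarrow> norm (fun_calc \<phi> T - poly_op p T)"
    by (intro tendsto_intros)
  have "(\<lambda>n. e + inverse (real (Suc n))) \<longlonglongrightarrow> e + 0"
    by (intro tendsto_intros LIMSEQ_inverse_real_of_nat)
  then have "norm (fun_calc \<phi> T - poly_op p T) \<le> e + 0"
  proof (rule LIMSEQ_le[OF lim])
    have "norm (poly_op (q n) T - poly_op p T) \<le> e + inverse (real (Suc n))" for n
      unfolding poly_op_diff[symmetric]
    proof (rule norm_poly_op_le[OF T])
      fix t assume t: "\<bar>t\<bar> \<le> norm T"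
      show "\<bar>poly (q n - p) t\<bar> \<le> e + inverse (real (Suc n))"
        using p[OF t] q[OF t, of n] unfolding poly_diff by linarith
    qed
    then show "\<exists>N. \<forall>n\<ge>N. norm (poly_op (q n) T - poly_op p T) \<le> e + inverse (real (Suc n))" by blast
  qed
  then show ?thesis by simp
qed

lemma selfadjoint_hamiltonian: "graph G \<Longrightarrow> selfadjoint (hamiltonian G)"
  unfolding hamiltonian_def
  by (intro selfadjoint_diff selfadjoint_scaleR selfadjoint_id selfadjoint_adj_op)

lemma poly_op_hamiltonian:
  "poly_op p (hamiltonian G) = poly_op (pcompose p [:norm (adj_op G), -1:]) (adj_op G)"
proof -
  have "hamiltonian G = poly_op [:norm (adj_op G), -1:] (adj_op G)"
    by (rule blinfun_eqI) (simp add: hamiltonian_def poly_op_pCons blinfun.bilinear_simps)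
  then show ?thesis by (simp add: poly_op_pcompose)
qed

text \<open>For polynomials the traces converge because they are averaged walk counts; uniform
  approximation extends this to continuous functions. \<open>R\<close> is kept apart from the norm
  of the operator so that the measure found for \<open>X\<close> can be used for the graph with
  pendant.\<close>

lemma is_dos_distr:
  assumes wm: "walk_moments G K m"
    and \<nu>: "real_distribution \<nu>" "AE t in \<nu>. \<bar>t\<bar> \<le> R" "\<And>p. (\<integral>t. poly p t \<partial>\<nu>) = moment_functional m p"
  shows "is_dos G K (distr \<nu> borel (\<lambda>t. norm (adj_op G) - t))"
proof -
  from wm have G: "graph G" and fin: "\<And>n. finite (K n)" by (auto simp: walk_moments_def)
  interpret \<nu>: real_distribution \<nu> by (rule \<nu>)
  let ?M = "norm (adj_op G)" and ?H = "hamiltonian G"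
  \<comment> \<open>Large enough for both approximations: the functional calculus needs the interval
    up to ||H||, the integral needs the values of M - t on the support of \<nu>.\<close>
  define R' where "R' = max (norm ?H) (?M + R)"
  define tr where "tr n S = op_trace (S o\<^sub>L proj_op (K n)) / of_nat (card (K n))" for n S
  have tr_diff: "norm (tr n S - tr n T) \<le> norm (S - T)" for n S T
  proof -
    have "op_trace (S o\<^sub>L proj_op (K n)) - op_trace (T o\<^sub>L proj_op (K n)) =
        (\<Sum>v\<in>K n. ell2_fun (blinfun_apply (S - T) (delta v)) v)"
      by (simp add: op_trace_proj fin blinfun.bilinear_simps minus_ell2.rep_eq sum_subtractf)
    also have "norm \<dots> \<le> card (K n) * norm (S - T)"
      by (rule order.trans[OF norm_sum]) (intro sum_bounded_above cmod_diagonal_le_norm)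
    finally have "norm (tr n S - tr n T) \<le> card (K n) * norm (S - T) / card (K n)"
      unfolding tr_def diff_divide_distrib[symmetric] norm_divide norm_of_nat by (rule divide_right_mono) simp
    \<comment> \<open>Only an inequality, since for empty \<open>K n\<close> the left side is 0 by
      division by zero.\<close>
    also have "\<dots> \<le> norm (S - T)" by simp
    finally show ?thesis .
  qed
  have int: "integrable \<nu> (\<lambda>t. \<phi> (?M - t))"
    and int_diff: "\<And>p e. (\<And>h. \<bar>h\<bar> \<le> R' \<Longrightarrow> \<bar>\<phi> h - poly p h\<bar> \<le> e) \<Longrightarrow>
      \<bar>(\<integral>t. \<phi> (?M - t) \<partial>\<nu>) - (\<integral>t. poly p (?M - t) \<partial>\<nu>)\<bar> \<le> e"
    if \<phi>: "continuous_on UNIV \<phi>" for \<phi> :: "real \<Rightarrow> real"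
  proof -
    have AE_R': "AE t in \<nu>. \<bar>?M - t\<bar> \<le> R'"
      using \<nu>(2)
    proof eventually_elim
      case (elim t)
      then have "\<bar>?M - t\<bar> \<le> ?M + R" using norm_ge_zero[of "adj_op G"] by linarith
      then show ?case by (simp add: R'_def)
    qed
    have int: "integrable \<nu> (\<lambda>t. \<phi> (?M - t))" if \<phi>: "continuous_on UNIV \<phi>" for \<phi> :: "real \<Rightarrow> real"
    proof -
      have "compact (\<phi> ` {-R'..R'})"
        using \<phi> by (intro compact_continuous_image) (auto intro: continuous_on_subset)
      then obtain B where B: "\<And>h. \<bar>h\<bar> \<le> R' \<Longrightarrow> \<bar>\<phi> h\<bar> \<le> B"
        using compact_imp_bounded by (force simp: bounded_iff abs_le_iff)
      have [measurable]: "\<phi> \<in> borel_measurable borel" by (rule borel_measurable_continuous_onI) fact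
      show ?thesis
        by (rule \<nu>.integrable_const_bound[of _ B]) (use AE_R' B in \<open>auto elim!: AE_mp\<close>)
    qed
    show "integrable \<nu> (\<lambda>t. \<phi> (?M - t))" by (rule int) fact
    fix p :: "real poly" and e assume p: "\<And>h. \<bar>h\<bar> \<le> R' \<Longrightarrow> \<bar>\<phi> h - poly p h\<bar> \<le> e"
    have ip: "integrable \<nu> (\<lambda>t. poly p (?M - t))" by (rule int) (intro continuous_intros)
    have "\<bar>(\<integral>t. \<phi> (?M - t) \<partial>\<nu>) - (\<integral>t. poly p (?M - t) \<partial>\<nu>)\<bar> = \<bar>\<integral>t. \<phi> (?M - t) - poly p (?M - t) \<partial>\<nu>\<bar>"
      using int[OF \<phi>] ip by simp
    also have "\<dots> \<le> (\<integral>t. \<bar>\<phi> (?M - t) - poly p (?M - t)\<bar> \<partial>\<nu>)"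
      by (rule integral_abs_bound)
    also have "\<dots> \<le> (\<integral>t. e \<partial>\<nu>)"
      using int[OF \<phi>] ip AE_R' p by (intro integral_mono_AE) (auto elim!: AE_mp)
    also have "\<dots> = e" using \<nu>.prob_space by simp
    finally show "\<bar>(\<integral>t. \<phi> (?M - t) \<partial>\<nu>) - (\<integral>t. poly p (?M - t) \<partial>\<nu>)\<bar> \<le> e" .
  qed
  have tr_poly: "(\<lambda>n. tr n (poly_op p ?H)) \<longlonglongrightarrow> of_real (\<integral>t. poly p (?M - t) \<partial>\<nu>)" for p
  proof -
    let ?q = "pcompose p [:?M, -1:]"
    have "tr n (poly_op p ?H) = of_real ((\<Sum>v\<in>K n. moment_functional (\<lambda>i. walks G i v v) ?q) / card (K n))" for n
      by (simp add: tr_def poly_op_hamiltonian op_trace_proj fin poly_op_adj_op_diagonal[OF G])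
    moreover have "(\<integral>t. poly p (?M - t) \<partial>\<nu>) = moment_functional m ?q"
      unfolding \<nu>(3)[symmetric] by (intro Bochner_Integration.integral_cong refl) (simp add: poly_pcompose)
    ultimately show ?thesis
      using tendsto_of_real[OF moment_functional_walks_tendsto[OF wm, of ?q], where 'a = complex] by (simp only:)
  qed
  have conv: "(\<lambda>n. tr n (fun_calc \<phi> ?H)) \<longlonglongrightarrow> of_real (\<integral>t. \<phi> (?M - t) \<partial>\<nu>)"
    if \<phi>: "continuous_on UNIV \<phi>" for \<phi> :: "real \<Rightarrow> real"
  proof (rule LIMSEQ_I)
    fix e :: real assume e: "e > 0"
    then obtain p :: "real poly" where p: "\<And>h. \<bar>h\<bar> \<le> R' \<Longrightarrow> \<bar>\<phi> h - poly p h\<bar> < e / 4"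
      using poly_approximation[OF \<phi>, of "e/4" R'] by auto
    have "norm (fun_calc \<phi> ?H - poly_op p ?H) \<le> e / 4"
      by (rule norm_fun_calc_diff_le[OF selfadjoint_hamiltonian[OF G] \<phi>])
        (use p in \<open>force simp: R'_def intro: less_imp_le\<close>)
    then have 1: "norm (tr n (fun_calc \<phi> ?H) - tr n (poly_op p ?H)) \<le> e / 4" for n
      using tr_diff order_trans by blast
    have 2: "norm (of_real (\<integral>t. poly p (?M - t) \<partial>\<nu>) - of_real (\<integral>t. \<phi> (?M - t) \<partial>\<nu>) :: complex) \<le> e / 4"
      unfolding of_real_diff[symmetric] norm_of_real
      using int_diff[OF \<phi>, of p "e/4"] p by (simp add: abs_minus_commute less_imp_le)
    obtain N where N: "\<And>n. n \<ge> N \<Longrightarrow> norm (tr n (poly_op p ?H) - of_real (\<integral>t. poly p (?M - t) \<partial>\<nu>)) < e / 4"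
      using LIMSEQ_D[OF tr_poly[of p], of "e/4"] e by auto
    have "norm (tr n (fun_calc \<phi> ?H) - of_real (\<integral>t. \<phi> (?M - t) \<partial>\<nu>)) < e" if "n \<ge> N" for n
    proof -
      have "norm (tr n (fun_calc \<phi> ?H) - of_real (\<integral>t. \<phi> (?M - t) \<partial>\<nu>)) \<le>
          norm (tr n (fun_calc \<phi> ?H) - tr n (poly_op p ?H)) +
          norm (tr n (poly_op p ?H) - of_real (\<integral>t. poly p (?M - t) \<partial>\<nu>)) +
          norm (of_real (\<integral>t. poly p (?M - t) \<partial>\<nu>) - of_real (\<integral>t. \<phi> (?M - t) \<partial>\<nu>) :: complex)"
        using norm_triangle_ineq[of "(tr n (fun_calc \<phi> ?H) - tr n (poly_op p ?H)) +
            (tr n (poly_op p ?H) - of_real (\<integral>t. poly p (?M - t) \<partial>\<nu>))"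
            "of_real (\<integral>t. poly p (?M - t) \<partial>\<nu>) - of_real (\<integral>t. \<phi> (?M - t) \<partial>\<nu>)"]
          norm_triangle_ineq[of "tr n (fun_calc \<phi> ?H) - tr n (poly_op p ?H)"
            "tr n (poly_op p ?H) - of_real (\<integral>t. poly p (?M - t) \<partial>\<nu>)"]
        by simp
      then show ?thesis using 1[of n] 2 N[OF that] e by linarith
    qed
    then show "\<exists>no. \<forall>n\<ge>no. norm (tr n (fun_calc \<phi> ?H) - of_real (\<integral>t. \<phi> (?M - t) \<partial>\<nu>)) < e" by blast
  qed
  show ?thesis
    unfolding is_dos_def
  proof (intro conjI allI impI)
    fix \<phi> :: "real \<Rightarrow> real" assume \<phi>: "continuous_on UNIV \<phi>"
    then have [measurable]: "\<phi> \<in> borel_measurable borel" by (rule borel_measurable_continuous_onI)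
    show "integrable (distr \<nu> borel (\<lambda>t. ?M - t)) \<phi>"
      using int[OF \<phi>] by (subst integrable_distr_eq) auto
    show "(\<lambda>n. op_trace (fun_calc \<phi> ?H o\<^sub>L proj_op (K n)) / of_nat (card (K n)))
        \<longlonglongrightarrow> complex_of_real (\<integral>h. \<phi> h \<partial>distr \<nu> borel (\<lambda>t. ?M - t))"
      using conv[OF \<phi>] unfolding tr_def by (subst integral_distr) auto
  qed simp
qed

lemma dos_eq_distr:
  assumes wm: "walk_moments G K m"
    and \<nu>: "real_distribution \<nu>" "AE t in \<nu>. \<bar>t\<bar> \<le> R" "\<And>p. (\<integral>t. poly p t \<partial>\<nu>) = moment_functional m p"
  shows "dos G K = distr \<nu> borel (\<lambda>t. norm (adj_op G) - t)" (is "_ = ?N")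
  unfolding dos_def
proof (rule the_equality)
  have N: "is_dos G K ?N" by (rule is_dos_distr) fact+
  then show "is_dos G K ?N" .
  interpret \<nu>: real_distribution \<nu> by (rule \<nu>)
  fix N' assume N': "is_dos G K N'"
  show "N' = ?N"
  proof (rule real_distribution_eqI_continuous)
    show "real_distribution ?N"
      by (auto simp: real_distribution_def real_distribution_axioms_def intro!: \<nu>.prob_space_distr)
    fix f :: "real \<Rightarrow> real" assume "continuous_on UNIV f"
    with N N' have "complex_of_real (\<integral>h. f h \<partial>N') = of_real (\<integral>h. f h \<partial>?N)"
      unfolding is_dos_def using LIMSEQ_unique by blast
    then show "(\<integral>x. f x \<partial>N') = (\<integral>x. f x \<partial>?N)" by (simp only: of_real_eq_iff)
  qed (use N' in \<open>auto simp: is_dos_def\<close>)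
qed


section \<open>The pendant vertex\<close>

lemma infsum_option:
  fixes f :: "'a option \<Rightarrow> real"
  assumes "(\<lambda>x. f (Some x)) summable_on UNIV"
  shows "f summable_on UNIV" "(\<Sum>\<^sub>\<infinity>x. f x) = f None + (\<Sum>\<^sub>\<infinity>x. f (Some x))"
proof -
  have s: "f summable_on range Some"
    using assms by (subst summable_on_reindex) (auto simp: comp_def)
  have "(\<Sum>\<^sub>\<infinity>x\<in>range Some. f x) = (\<Sum>\<^sub>\<infinity>x. f (Some x))"
    by (subst infsum_reindex) (auto simp: comp_def)
  with s show "f summable_on UNIV" "(\<Sum>\<^sub>\<infinity>x. f x) = f None + (\<Sum>\<^sub>\<infinity>x. f (Some x))"
    unfolding UNIV_option_conv by (auto simp: summable_on_insert_iff infsum_insert)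
qed

text \<open>The orthogonal decomposition of the space for the enlarged graph into the line at # and
  the old space.\<close>

lift_definition ell2_option :: "complex \<Rightarrow> 'a ell2 \<Rightarrow> 'a option ell2" is
  "\<lambda>a f x. case x of None \<Rightarrow> a | Some v \<Rightarrow> f v"
  by (rule infsum_option(1)) simp

lemma inner_ell2_option: "inner (ell2_option a f) (ell2_option b g) = Re (a * cnj b) + inner f g"
  unfolding inner_ell2.rep_eq ell2_option.rep_eq
  by (subst infsum_option(2)) (use ell2_inner_summable[of f g] in simp_all)

text \<open>\<open>finite_perturbation\<close> compares graphs over one vertex type, hence the copy
  of \<open>X\<close> under \<open>Some\<close>. In this way the enlarged graph inherits the walk
  densities of \<open>X\<close>.\<close>

lemma finite_perturbation_add_pendant:
  assumes X: "graph X" and x: "x \<in> verts X"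
  shows "finite_perturbation (relabel Some X) (add_pendant X x)"
  unfolding finite_perturbation_def
proof (intro conjI)
  let ?Y = "add_pendant X x"
  have R: "graph (relabel Some X)" by (rule graph_relabel[OF X]) simp
  show "graph ?Y"
    unfolding graph_def
  proof (intro conjI)
    show "countable (verts ?Y)" using X by (simp add: add_pendant_def graph_def)
    show "edges ?Y \<subseteq> {{v, w} |v w. v \<in> verts ?Y \<and> w \<in> verts ?Y \<and> v \<noteq> w}"
    proof -
      have "edges (relabel Some X) \<subseteq> {{v, w} |v w. v \<in> verts (relabel Some X) \<and> w \<in> verts (relabel Some X) \<and> v \<noteq> w}"
        using R unfolding graph_def by blast
      moreover have "edges ?Y = insert {None, Some x} (edges (relabel Some X))"
        "verts ?Y = insert None (verts (relabel Some X))" "Some x \<in> verts (relabel Some X)"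
        using x by (auto simp: add_pendant_def relabel_def)
      ultimately show ?thesis by blast
    qed
    have sub: "neighbours ?Y v \<subseteq> insert None (insert (Some x) (neighbours (relabel Some X) v))" for v
      by (auto simp: neighbours_def add_pendant_def relabel_def doubleton_eq_iff)
    obtain e where e: "\<And>v. finite (neighbours (relabel Some X) v)" "\<And>v. card (neighbours (relabel Some X) v) \<le> e"
      using graph_degree_bound[OF R] by metis
    have "finite (neighbours ?Y v) \<and> card (neighbours ?Y v) \<le> e + 2" for v
    proof
      show "finite (neighbours ?Y v)" using sub e(1) finite_subset by blast
      have "card (neighbours ?Y v) \<le> card (insert None (insert (Some x) (neighbours (relabel Some X) v)))"
        using e(1) by (intro card_mono sub) auto
      also have "\<dots> \<le> e + 2" using e(2)[of v] e(1) by (simp add: card_insert_if)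
      finally show "card (neighbours ?Y v) \<le> e + 2" .
    qed
    then show "\<exists>d. \<forall>v\<in>verts ?Y. finite (neighbours ?Y v) \<and> card (neighbours ?Y v) \<le> d" by blast
  qed
  show "finite (sym_diff (verts (relabel Some X)) (verts ?Y))"
    by (rule finite_subset[of _ "{None}"]) (auto simp: relabel_def add_pendant_def)
  show "finite (sym_diff (edges (relabel Some X)) (edges ?Y))"
    by (rule finite_subset[of _ "{{None, Some x}}"]) (auto simp: relabel_def add_pendant_def)
qed

lemma walk_moments_add_pendant:
  assumes wm: "walk_moments X K m" and K: "\<And>n. K n \<subseteq> verts X" and x: "x \<in> verts X"
  shows "walk_moments (add_pendant X x) (add_pendant_exhaustion K) m"
proof -
  from wm have X: "graph X" by (simp add: walk_moments_def)
  have "walk_moments (relabel Some X) (\<lambda>n. Some ` K n) m"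
    by (subst walk_moments_relabel[OF X _ K]) (use wm in simp_all)
  moreover have "Some ` K n \<subseteq> verts (relabel Some X)" for n using K by (auto simp: relabel_def)
  ultimately have "walk_moments (add_pendant X x) (modified_exhaustion (relabel Some X) (\<lambda>n. Some ` K n) (add_pendant X x)) m"
    by (intro walk_moments_finite_perturbation finite_perturbation_add_pendant[OF X x])
  moreover have "modified_exhaustion (relabel Some X) (\<lambda>n. Some ` K n) (add_pendant X x) = add_pendant_exhaustion K"
    using K by (auto simp: fun_eq_iff modified_exhaustion_def relabel_def add_pendant_def add_pendant_exhaustion_def)
  ultimately show ?thesis by simp
qed

text \<open>The block form of the new operator: 0 at #, A on the old space, and coupling through
  delta_x off the diagonal.\<close>

lemma adj_op_add_pendant:
  assumes X: "graph X" and x: "x \<in> verts X"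
  shows "blinfun_apply (adj_op (add_pendant X x)) (ell2_option (of_real s) g) =
    ell2_option (ell2_fun g x) (blinfun_apply (adj_op X) g + s *\<^sub>R delta x)"
proof -
  have Y: "graph (add_pendant X x)"
    using finite_perturbation_add_pendant[OF X x] by (simp add: finite_perturbation_def)
  have N: "neighbours (add_pendant X x) None = {Some x}"
    by (auto simp: neighbours_def add_pendant_def doubleton_eq_iff)
  have edge: "{Some v, Some w} \<in> (`) Some ` edges X \<longleftrightarrow> {v, w} \<in> edges X" for v w
  proof -
    have "{Some v, Some w} = Some ` e \<longleftrightarrow> e = {v, w}" for e
      using inj_image_eq_iff[of Some "{v, w}" e] by auto
    then show ?thesis by (auto simp: image_iff)
  qed
  have no_edge: "{Some v, None} \<notin> (`) Some ` edges X" for v by auto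
  have S: "neighbours (add_pendant X x) (Some v) = Some ` neighbours X v \<union> (if v = x then {None} else {})" for v
  proof (rule Set.set_eqI)
    fix w
    show "w \<in> neighbours (add_pendant X x) (Some v) \<longleftrightarrow> w \<in> Some ` neighbours X v \<union> (if v = x then {None} else {})"
    proof (cases w)
      case None
      then show ?thesis using no_edge[of v] by (auto simp: neighbours_def add_pendant_def doubleton_eq_iff)
    next
      case (Some u)
      then show ?thesis using edge[of v u] by (auto simp: neighbours_def add_pendant_def doubleton_eq_iff)
    qed
  qed
  show ?thesis
    unfolding ell2_fun_inject[symmetric]
  proof
    fix u
    show "ell2_fun (blinfun_apply (adj_op (add_pendant X x)) (ell2_option (of_real s) g)) u =
      ell2_fun (ell2_option (ell2_fun g x) (blinfun_apply (adj_op X) g + s *\<^sub>R delta x)) u"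
    proof (cases u)
      case None
      then show ?thesis by (simp add: adj_op_apply[OF Y] N ell2_option.rep_eq)
    next
      case (Some v)
      have "(\<Sum>w\<in>Some ` neighbours X v \<union> (if v = x then {None} else {}). ell2_fun (ell2_option (of_real s) g) w) =
          (\<Sum>w\<in>neighbours X v. ell2_fun g w) + (if v = x then of_real s else 0)"
        by (subst sum.union_disjoint) (auto simp: finite_neighbours[OF X] sum.reindex ell2_option.rep_eq)
      then show ?thesis
        by (simp add: Some adj_op_apply[OF Y] adj_op_apply[OF X] S ell2_option.rep_eq plus_ell2.rep_eq scaleR_ell2.rep_eq)
    qed
  qed
qed

text \<open>The form of M - A' at the vector (s, g) is M s^2 - 2 s r + q with r = Re g(x). It is
  nonnegative for all real s, and its minimum at s = r/M gives r^2 <= M q.\<close>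

lemma pendant_norm_le_imp:
  assumes X: "graph X" and x: "x \<in> verts X" and le: "norm (adj_op (add_pendant X x)) \<le> M"
  shows "(Re (ell2_fun g x))\<^sup>2 \<le> M * (M * (norm g)\<^sup>2 - inner (blinfun_apply (adj_op X) g) g)"
proof -
  let ?r = "Re (ell2_fun g x)" and ?q = "M * (norm g)\<^sup>2 - inner (blinfun_apply (adj_op X) g) g"
  have ineq: "2 * s * ?r \<le> M * s\<^sup>2 + ?q" for s
  proof -
    let ?f = "ell2_option (of_real s) g"
    have "inner (blinfun_apply (adj_op (add_pendant X x)) ?f) ?f =
        2 * s * ?r + inner (blinfun_apply (adj_op X) g) g"
      unfolding adj_op_add_pendant[OF X x] inner_ell2_option inner_add_left inner_scaleR_left
        inner_commute[of "delta x" g] inner_delta_right by simp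
    moreover have "inner (blinfun_apply (adj_op (add_pendant X x)) ?f) ?f \<le> M * (norm ?f)\<^sup>2"
    proof -
      have "norm (blinfun_apply (adj_op (add_pendant X x)) ?f) \<le> M * norm ?f"
        using norm_blinfun[of "adj_op (add_pendant X x)" ?f] mult_right_mono[OF le norm_ge_zero[of ?f]] by linarith
      then have "norm (blinfun_apply (adj_op (add_pendant X x)) ?f) * norm ?f \<le> M * norm ?f * norm ?f"
        by (rule mult_right_mono) simp
      then show ?thesis
        using norm_cauchy_schwarz[of "blinfun_apply (adj_op (add_pendant X x)) ?f" ?f]
        by (simp add: power2_eq_square)
    qed
    moreover have "(norm ?f)\<^sup>2 = s\<^sup>2 + (norm g)\<^sup>2"
      by (simp add: power2_norm_eq_inner inner_ell2_option) (simp add: power2_eq_square)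
    ultimately show ?thesis by (simp add: algebra_simps)
  qed
  have M: "0 \<le> M" using le norm_ge_zero order_trans by blast
  show ?thesis
  proof (cases "M = 0")
    case True
    have "?r = 0"
    proof (rule ccontr)
      assume "?r \<noteq> 0"
      \<comment> \<open>For M = 0 the form is affine in s. This s makes the left side equal to q +
        1, so the slope r must vanish.\<close>
      then show False using ineq[of "(?q + 1) / (2 * ?r)"] True by simp
    qed
    then show ?thesis using True by simp
  next
    case False
    then have "M > 0" using M by simp
    with ineq[of "?r / M"] have "?r\<^sup>2 / M \<le> ?q" by (simp add: power2_eq_square field_simps)
    then show ?thesis using \<open>M > 0\<close> by (simp add: field_simps)
  qed
qed


section \<open>Comparison of the critical densities\<close>

lemma critical_density_eq:
  assumes wm: "walk_moments G K m"
    and \<nu>: "real_distribution \<nu>" "AE t in \<nu>. \<bar>t\<bar> \<le> R" "\<And>p. (\<integral>t. poly p t \<partial>\<nu>) = moment_functional m p"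
  shows "critical_density G K \<beta> = (\<integral>\<^sup>+t. 1 / ennreal (exp (\<beta> * (norm (adj_op G) - t)) - 1) \<partial>\<nu>)"
proof -
  interpret \<nu>: real_distribution \<nu> by (rule \<nu>)
  show ?thesis
    unfolding critical_density_def dos_eq_distr[OF wm \<nu>] by (subst nn_integral_distr) measurable
qed

text \<open>Almost surely the energy norm - t is at least norm - R > 0, so the integrand is bounded
  with respect to a probability measure.\<close>

lemma critical_density_finite_of_gap:
  assumes wm: "walk_moments G K m"
    and \<nu>: "real_distribution \<nu>" "AE t in \<nu>. \<bar>t\<bar> \<le> R" "\<And>p. (\<integral>t. poly p t \<partial>\<nu>) = moment_functional m p"
    and R: "R < norm (adj_op G)" and \<beta>: "\<beta> > 0"
  shows "critical_density G K \<beta> < \<infinity>"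
proof -
  interpret \<nu>: real_distribution \<nu> by (rule \<nu>)
  let ?M = "norm (adj_op G)"
  have gap: "exp (\<beta> * (?M - R)) - 1 > 0" using R \<beta> by simp
  have "critical_density G K \<beta> \<le> (\<integral>\<^sup>+t. ennreal (1 / (exp (\<beta> * (?M - R)) - 1)) \<partial>\<nu>)"
    unfolding critical_density_eq[OF wm \<nu>]
  proof (rule nn_integral_mono_AE)
    show "AE t in \<nu>. 1 / ennreal (exp (\<beta> * (?M - t)) - 1) \<le> ennreal (1 / (exp (\<beta> * (?M - R)) - 1))"
      using \<nu>(2)
    proof eventually_elim
      case (elim t)
      then have le: "exp (\<beta> * (?M - R)) - 1 \<le> exp (\<beta> * (?M - t)) - 1" using \<beta> by simp
      \<comment> \<open>Division in \<open>ennreal\<close> agrees with real division only for a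
        positive denominator, which the gap provides.\<close>
      then have "1 / ennreal (exp (\<beta> * (?M - t)) - 1) = ennreal (1 / (exp (\<beta> * (?M - t)) - 1))"
        using gap divide_ennreal[of 1 "exp (\<beta> * (?M - t)) - 1"] by simp
      also have "\<dots> \<le> ennreal (1 / (exp (\<beta> * (?M - R)) - 1))"
        using le gap by (intro ennreal_leI divide_left_mono) auto
      finally show ?case .
    qed
  qed
  also have "\<dots> < \<infinity>" using \<nu>.emeasure_space_1 by (simp add: nn_integral_const)
  finally show ?thesis .
qed

text \<open>\<open>pendant_norm_le_imp\<close> is applied to g = p(A) delta_v at each vertex, and
  selfadjointness moves both factors p(A) to one side. The vertexwise inequalities are then averaged
  over \<open>K n\<close>.\<close>

lemma no_bound_state_integral_inequality:
  assumes wm: "walk_moments X K m" and K: "\<And>n. K n \<subseteq> verts X"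
    and \<nu>: "\<And>p. (\<integral>t. poly p t \<partial>\<nu>) = moment_functional m p"
    and le: "\<And>x. x \<in> verts X \<Longrightarrow> norm (adj_op (add_pendant X x)) \<le> M"
  shows "(\<integral>t. poly p t \<partial>\<nu>)\<^sup>2 \<le> M * (\<integral>t. (M - t) * (poly p t)\<^sup>2 \<partial>\<nu>)"
proof -
  from wm have X: "graph X" by (simp add: walk_moments_def)
  let ?A = "adj_op X" and ?q = "[:M, -1:] * (p * p)"
  let ?L = "\<lambda>p v. moment_functional (\<lambda>i. walks X i v v) p"
  have vertex: "(?L p v)\<^sup>2 \<le> M * ?L ?q v" if "v \<in> verts X" for v
  proof -
    let ?g = "blinfun_apply (poly_op p ?A) (delta v)"
    note sa = selfadjointD[OF selfadjoint_poly_op[OF selfadjoint_adj_op[OF X]], of p]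
    \<comment> \<open>Placing one p on the outside allows p(A) to be moved to the other argument of
      the inner product.\<close>
    have eq: "?q = p * ([:M, -1:] * p)" by (simp only: mult_ac)
    have "?L ?q v = inner (blinfun_apply (poly_op (p * ([:M, -1:] * p)) ?A) (delta v)) (delta v)"
      unfolding eq by (rule inner_poly_op_adj_op_delta[OF X, symmetric])
    also have "inner (blinfun_apply (poly_op (p * ([:M, -1:] * p)) ?A) (delta v)) (delta v) =
        inner (blinfun_apply (poly_op [:M, -1:] ?A) ?g) ?g"
      unfolding poly_op_mult by (simp add: sa)
    also have "\<dots> = M * (norm ?g)\<^sup>2 - inner (blinfun_apply ?A ?g) ?g"
      by (simp add: poly_op_pCons blinfun.bilinear_simps inner_diff_left power2_norm_eq_inner)
    finally have "?L ?q v = M * (norm ?g)\<^sup>2 - inner (blinfun_apply ?A ?g) ?g" .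
    moreover have "Re (ell2_fun ?g v) = ?L p v"
      by (simp add: poly_op_adj_op_diagonal[OF X])
    ultimately show ?thesis
      using pendant_norm_le_imp[OF X that le[OF that], of ?g] by simp
  qed
  have "(moment_functional m p)\<^sup>2 \<le> M * moment_functional m ?q"
  proof (rule LIMSEQ_le)
    show "(\<lambda>n. ((\<Sum>v\<in>K n. ?L p v) / card (K n))\<^sup>2) \<longlonglongrightarrow> (moment_functional m p)\<^sup>2"
      by (intro tendsto_intros moment_functional_walks_tendsto wm)
    show "(\<lambda>n. M * ((\<Sum>v\<in>K n. ?L ?q v) / card (K n))) \<longlonglongrightarrow> M * moment_functional m ?q"
      by (intro tendsto_intros moment_functional_walks_tendsto wm)
    have "((\<Sum>v\<in>K n. ?L p v) / card (K n))\<^sup>2 \<le> M * ((\<Sum>v\<in>K n. ?L ?q v) / card (K n))" for n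
    proof -
      \<comment> \<open>The square of a mean is at most the mean of the squares, so the inequality
        at single vertices survives averaging.\<close>
      have "(\<Sum>v\<in>K n. ?L p v)\<^sup>2 \<le> card (K n) * (\<Sum>v\<in>K n. (?L p v)\<^sup>2)"
        using Cauchy_Schwarz_ineq_sum[of "\<lambda>_. 1" "?L p" "K n"] by simp
      also have "\<dots> \<le> card (K n) * (\<Sum>v\<in>K n. M * ?L ?q v)"
        using K[of n] vertex by (intro mult_left_mono sum_mono) auto
      finally have "(\<Sum>v\<in>K n. ?L p v)\<^sup>2 / (card (K n))\<^sup>2 \<le> card (K n) * (\<Sum>v\<in>K n. M * ?L ?q v) / (card (K n))\<^sup>2"
        by (rule divide_right_mono) simp
      then show ?thesis
        by (simp add: power_divide sum_distrib_left[symmetric] power2_eq_square split: if_splits)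
    qed
    then show "\<exists>N. \<forall>n\<ge>N. ((\<Sum>v\<in>K n. ?L p v) / card (K n))\<^sup>2 \<le> M * ((\<Sum>v\<in>K n. ?L ?q v) / card (K n))" by blast
  qed
  moreover have "(\<integral>t. (M - t) * (poly p t)\<^sup>2 \<partial>\<nu>) = moment_functional m ?q"
    unfolding \<nu>[symmetric]
    by (intro Bochner_Integration.integral_cong refl) (simp add: power2_eq_square algebra_simps)
  ultimately show ?thesis by (simp add: \<nu>)
qed

text \<open>The polynomials \<open>p n\<close> are partial sums of the geometric series of 1/(M - t)
  in powers of r, and (M - t) p_n = 1 - r^n lies in [0, 1]. This bounds their integrals by M
  uniformly in n, and Fatou's lemma transfers the bound to the limit.\<close>

lemma inverse_integral_le:
  assumes "real_distribution \<nu>" and supp: "AE t in \<nu>. \<bar>t\<bar> \<le> M" and M: "0 \<le> M"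
    and ineq: "\<And>p. (\<integral>t. poly p t \<partial>\<nu>)\<^sup>2 \<le> M * (\<integral>t. (M - t) * (poly p t)\<^sup>2 \<partial>\<nu>)"
  shows "(\<integral>\<^sup>+t. 1 / ennreal (M - t) \<partial>\<nu>) \<le> ennreal M"
proof -
  interpret \<nu>: real_distribution \<nu> by fact
  \<comment> \<open>On the support 0 <= M - t <= 2M, so any positive c >= 2M puts r in [0, 1]; the
    summand 1 keeps c positive for M = 0.\<close>
  define c where "c = 2 * M + 1"
  have c: "c > 0" using M by (simp add: c_def)
  define r where "r t = 1 - (M - t) / c" for t
  define p where "p n = (\<Sum>k<n. smult (1 / c) ([:1 - M / c, 1 / c:] ^ k))" for n :: nat
  have p_eq: "poly (p n) t = (\<Sum>k<n. r t ^ k) / c" for n t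
    by (simp add: p_def poly_sum r_def sum_divide_distrib diff_divide_distrib algebra_simps)
  have r: "0 \<le> r t" "r t \<le> 1" if "\<bar>t\<bar> \<le> M" for t
    using that c by (auto simp: r_def c_def field_simps)
  have p_nonneg: "0 \<le> poly (p n) t" if "\<bar>t\<bar> \<le> M" for n t
    unfolding p_eq using r[OF that] c by (intro divide_nonneg_pos sum_nonneg) auto
  have geom: "(M - t) * poly (p n) t = 1 - r t ^ n" for n t
  proof -
    have "(M - t) * poly (p n) t = (M - t) / c * (\<Sum>k<n. r t ^ k)" by (simp add: p_eq)
    also have "(M - t) / c = 1 - r t" by (simp add: r_def)
    finally show ?thesis by (simp add: one_diff_power_eq)
  qed
  have p_int: "integrable \<nu> (\<lambda>t. poly q t)" for q
  proof -
    have "compact (poly q ` {-M..M})" by (intro compact_continuous_image continuous_intros) auto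
    then obtain B where B: "\<And>t. \<bar>t\<bar> \<le> M \<Longrightarrow> \<bar>poly q t\<bar> \<le> B"
      using compact_imp_bounded by (force simp: bounded_iff abs_le_iff)
    have [measurable]: "poly q \<in> borel_measurable borel"
      by (intro borel_measurable_continuous_onI continuous_intros)
    show ?thesis
      by (rule \<nu>.integrable_const_bound[of _ B]) (use supp B in \<open>auto elim!: AE_mp\<close>)
  qed
  have I_le: "(\<integral>t. poly (p n) t \<partial>\<nu>) \<le> M" for n
  proof -
    let ?I = "\<integral>t. poly (p n) t \<partial>\<nu>"
    have "integrable \<nu> (\<lambda>t. poly ([:M, -1:] * (p n * p n)) t)" by (rule p_int)
    then have "integrable \<nu> (\<lambda>t. (M - t) * (poly (p n) t)\<^sup>2)"
      by (simp add: power2_eq_square algebra_simps)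
    moreover have "AE t in \<nu>. (M - t) * (poly (p n) t)\<^sup>2 \<le> poly (p n) t"
      using supp
    proof eventually_elim
      case (elim t)
      have "(M - t) * (poly (p n) t)\<^sup>2 = (1 - r t ^ n) * poly (p n) t"
        by (simp add: geom[symmetric] power2_eq_square mult.assoc)
      also have "\<dots> \<le> 1 * poly (p n) t"
        using r[OF elim] p_nonneg[OF elim] by (intro mult_right_mono) auto
      finally show ?case by simp
    qed
    ultimately have "(\<integral>t. (M - t) * (poly (p n) t)\<^sup>2 \<partial>\<nu>) \<le> ?I"
      using p_int by (intro integral_mono_AE)
    \<comment> \<open>The pointwise bound replaces the quadratic integral by I itself. Dividing by I
      is possible because the integral of a polynomial is finite.\<close>
    then have "?I\<^sup>2 \<le> M * ?I" using ineq[of "p n"] M by (meson mult_left_mono order_trans)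
    moreover have "0 \<le> ?I" using supp p_nonneg by (intro integral_nonneg_AE) (auto elim!: AE_mp)
    ultimately show ?thesis using M by (cases "?I = 0") (auto simp: power2_eq_square)
  qed
  \<comment> \<open>At t = M every power of r is 1 and p_n = n/c diverges, which matches the value
    1/0 in \<open>ennreal\<close>. So an atom of \<nu> at the top of the interval is
    covered.\<close>
  have lim: "(\<lambda>n. ennreal (poly (p n) t)) \<longlonglongrightarrow> 1 / ennreal (M - t)" if t: "\<bar>t\<bar> \<le> M" for t
  proof (cases "t = M")
    case True
    then have "poly (p n) t = real n * (1 / c)" for n by (simp add: p_eq r_def)
    moreover have "filterlim (\<lambda>n. real n * (1 / c)) at_top sequentially"
      using c by (intro filterlim_at_top_mult_tendsto_pos[OF tendsto_const] filterlim_real_sequentially) auto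
    ultimately show ?thesis
      using True by (simp add: ennreal_tendsto_top_eq_at_top)
  next
    case False
    then have pos: "M - t > 0" using t by auto
    then have "r t < 1" using c by (simp add: r_def)
    then have "(\<lambda>n. (1 - r t ^ n) / (M - t)) \<longlonglongrightarrow> (1 - 0) / (M - t)"
      using r[OF t] pos by (intro tendsto_intros LIMSEQ_power_zero) auto
    moreover have "(1 - r t ^ n) / (M - t) = poly (p n) t" for n
      using geom[of t n] pos by (simp add: field_simps)
    ultimately have "(\<lambda>n. poly (p n) t) \<longlonglongrightarrow> 1 / (M - t)" by simp
    then have "(\<lambda>n. ennreal (poly (p n) t)) \<longlonglongrightarrow> ennreal (1 / (M - t))"
      by (rule tendsto_ennrealI)
    then show ?thesis using pos divide_ennreal[of 1 "M - t"] by simp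
  qed
  have "(\<integral>\<^sup>+t. 1 / ennreal (M - t) \<partial>\<nu>) \<le> (\<integral>\<^sup>+t. liminf (\<lambda>n. ennreal (poly (p n) t)) \<partial>\<nu>)"
  proof (rule nn_integral_mono_AE)
    show "AE t in \<nu>. 1 / ennreal (M - t) \<le> liminf (\<lambda>n. ennreal (poly (p n) t))"
      using supp by eventually_elim (simp add: lim_imp_Liminf[OF _ lim])
  qed
  also have "\<dots> \<le> liminf (\<lambda>n. \<integral>\<^sup>+t. ennreal (poly (p n) t) \<partial>\<nu>)"
    by (rule nn_integral_liminf) (use p_int in auto)
  also have "\<dots> \<le> liminf (\<lambda>n. ennreal M)"
  proof (rule Liminf_mono, rule always_eventually, rule allI)
    fix n
    have "(\<integral>\<^sup>+t. ennreal (poly (p n) t) \<partial>\<nu>) = ennreal (\<integral>t. poly (p n) t \<partial>\<nu>)"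
      using supp p_nonneg by (intro nn_integral_eq_integral p_int) (auto elim!: AE_mp)
    then show "(\<integral>\<^sup>+t. ennreal (poly (p n) t) \<partial>\<nu>) \<le> ennreal M"
      using I_le[of n] by (simp add: ennreal_leI)
  qed
  also have "\<dots> = ennreal M" by (simp add: Liminf_const)
  finally show ?thesis .
qed

text \<open>Since exp x - 1 >= x, the Bose factor at energy h is at most 1/(\<beta> h).\<close>

lemma critical_density_finite_of_inverse_integral:
  assumes wm: "walk_moments G K m"
    and \<nu>: "real_distribution \<nu>" "AE t in \<nu>. \<bar>t\<bar> \<le> norm (adj_op G)" "\<And>p. (\<integral>t. poly p t \<partial>\<nu>) = moment_functional m p"
    and fin: "(\<integral>\<^sup>+t. 1 / ennreal (norm (adj_op G) - t) \<partial>\<nu>) < \<infinity>" and \<beta>: "\<beta> > 0"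
  shows "critical_density G K \<beta> < \<infinity>"
proof -
  interpret \<nu>: real_distribution \<nu> by (rule \<nu>)
  let ?M = "norm (adj_op G)"
  have "critical_density G K \<beta> \<le> (\<integral>\<^sup>+t. ennreal (1 / \<beta>) * (1 / ennreal (?M - t)) \<partial>\<nu>)"
    unfolding critical_density_eq[OF wm \<nu>]
  proof (rule nn_integral_mono_AE)
    show "AE t in \<nu>. 1 / ennreal (exp (\<beta> * (?M - t)) - 1) \<le> ennreal (1 / \<beta>) * (1 / ennreal (?M - t))"
      using \<nu>(2)
    proof eventually_elim
      case (elim t)
      show ?case
      proof (cases "t = ?M")
        \<comment> \<open>Both sides are infinite at zero energy; on the right this uses that
          1/\<beta> is nonzero.\<close>
        case True
        then show ?thesis using \<beta> by (simp add: ennreal_mult_top)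
      next
        case False
        then have pos: "?M - t > 0" using elim by auto
        have le: "\<beta> * (?M - t) \<le> exp (\<beta> * (?M - t)) - 1"
          using exp_ge_add_one_self[of "\<beta> * (?M - t)"] by linarith
        have bpos: "0 < \<beta> * (?M - t)" using \<beta> pos by simp
        then have "1 / ennreal (exp (\<beta> * (?M - t)) - 1) = ennreal (1 / (exp (\<beta> * (?M - t)) - 1))"
          using divide_ennreal[of 1 "exp (\<beta> * (?M - t)) - 1"] by simp
        also have "\<dots> \<le> ennreal (1 / (\<beta> * (?M - t)))"
          using le bpos by (intro ennreal_leI divide_left_mono) auto
        also have "\<dots> = ennreal (1 / \<beta>) * ennreal (1 / (?M - t))"
          using \<beta> pos by (subst ennreal_mult[symmetric]) auto
        also have "ennreal (1 / (?M - t)) = 1 / ennreal (?M - t)"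
          using pos divide_ennreal[of 1 "?M - t"] by simp
        finally show ?thesis .
      qed
    qed
  qed
  also have "\<dots> = ennreal (1 / \<beta>) * (\<integral>\<^sup>+t. 1 / ennreal (?M - t) \<partial>\<nu>)"
    by (rule nn_integral_cmult) measurable
  also have "\<dots> < \<infinity>" using fin by (simp add: ennreal_mult_less_top)
  finally show ?thesis .
qed

theorem proposition7p3:
  fixes X :: "'a sgraph" and K :: "nat \<Rightarrow> 'a set" and \<beta> :: real
  assumes "essentially_periodic X K"
    and "\<beta> > 0"
    and "critical_density X K \<beta> = \<infinity>"
  shows "\<exists>x\<^sub>0\<in>verts X. \<forall>\<beta>'>0.
           critical_density (add_pendant X x\<^sub>0) (add_pendant_exhaustion K) \<beta>' < \<infinity>"
proof -
  obtain m where X: "graph X" and K: "\<And>n. K n \<subseteq> verts X" and wm: "walk_moments X K m"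
    using essentially_periodic_walk_moments[OF assms(1)] by metis
  obtain \<nu> where \<nu>: "real_distribution \<nu>" "AE t in \<nu>. \<bar>t\<bar> \<le> norm (adj_op X)"
    "\<And>p. (\<integral>t. poly p t \<partial>\<nu>) = moment_functional m p"
    using spectral_measure_exists[OF wm] by metis
  have "\<exists>x\<in>verts X. norm (adj_op X) < norm (adj_op (add_pendant X x))"
  proof (rule ccontr)
    assume "\<not> ?thesis"
    then have "\<And>x. x \<in> verts X \<Longrightarrow> norm (adj_op (add_pendant X x)) \<le> norm (adj_op X)"
      by (meson not_less)
    then have "(\<integral>\<^sup>+t. 1 / ennreal (norm (adj_op X) - t) \<partial>\<nu>) \<le> ennreal (norm (adj_op X))"
      by (intro inverse_integral_le \<nu> norm_ge_zero no_bound_state_integral_inequality[OF wm K \<nu>(3)])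
    then have "(\<integral>\<^sup>+t. 1 / ennreal (norm (adj_op X) - t) \<partial>\<nu>) < \<infinity>"
      by (rule le_less_trans) simp
    then have "critical_density X K \<beta> < \<infinity>"
      by (rule critical_density_finite_of_inverse_integral[OF wm \<nu> _ assms(2)])
    then show False using assms(3) by simp
  qed
  then obtain x where x: "x \<in> verts X" "norm (adj_op X) < norm (adj_op (add_pendant X x))" by blast
  have "walk_moments (add_pendant X x) (add_pendant_exhaustion K) m"
    by (rule walk_moments_add_pendant[OF wm K x(1)])
  \<comment> \<open>The measure \<nu> of \<open>X\<close> serves the enlarged graph as well, as the
    moments m are the same. The bound on its support is the old norm, strictly below the new one,
    and x was chosen independently of \<beta>'.\<close>
  then have "critical_density (add_pendant X x) (add_pendant_exhaustion K) \<beta>' < \<infinity>" if "\<beta>' > 0" for \<beta>'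
    using \<nu> x(2) that by (rule critical_density_finite_of_gap)
  then show ?thesis using x(1) by blast
qed

end
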